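(* Fix $C_\star>(3+\sqrt5)^2$ and $\kappa\ge 2C_\star$. Let $h,\gamma>0$ satisfy $h<2/\sqrt\kappa$, and set $$\beta=e^{-\gamma h},\qquad s=\frac{h^2}{2}(1+\beta),\qquad q_\kappa=\frac{1-C_\star/\kappa}{1+C_\star/\kappa}.$$ Then at least one of the following two cases holds. (Q) There is $\lambda\in[1,\kappa]$ such that, for the quadratic potential $U_\lambda(x)=\lambda|x|^2/2$ on $\mathbb R^2$, two initial states $z,\widetilde z\in\mathbb R^4$ satisfy $$\lim_{n\to\infty}\bigl\|\delta_z(Q_{h,\gamma}^{U_\lambda})^n-\delta_{\widetilde z}(Q_{h,\gamma}^{U_\lambda})^n\bigr\|_{\mathrm{TV}}^{1/n}=\rho_{\mathrm q}(s,\beta;\kappa)\ge q_\kappa .$$ (C) There exist $U\in\mathcal U_\kappa^2$ and constants $c_0,C_0>0$ such that, for every $R\ge1$, the following holds. The dilated potential $U_R(x)=R^2U(x/R)$ also belongs to $\mathcal U_\kappa^2$, the kernel $Q_{h,\gamma}^{U_R}$ has a unique invariant law $\pi_R$, and there is an initial state $z_R\in\mathbb R^4$ satisfying $$W_2(\delta_{z_R},\pi_R)\le C_0(1+R),$$ while $$\bigl\|\delta_{z_R}(Q_{h,\gamma}^{U_R})^n-\pi_R\bigr\|_{\mathrm{TV}}\ge\frac38\qquad\text{for all integers }0\le n\le\Bigl\lfloor\frac1{16}e^{c_0R^2}\Bigr\rfloor .$$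
   Context: OBABO chain. For a differentiable $U:\mathbb R^d\to\mathbb R$ and $h,\gamma>0$, put $r=e^{-\gamma h/2}$, $\beta=r^2=e^{-\gamma h}$, $\sigma=(1-\beta)^{1/2}$. One OBABO step maps $(x,v)\in\mathbb R^d\times\mathbb R^d$ to $(x^+,v^+)$ by $v^{(a)}=rv+\sigma\xi^{(1)}$, $v^{(b)}=v^{(a)}-\frac h2\nabla U(x)$, $x^+=x+hv^{(b)}$, $v^{(c)}=v^{(b)}-\frac h2\nabla U(x^+)$, $v^+=rv^{(c)}+\sigma\xi^{(2)}$, where $\xi^{(1)},\xi^{(2)}$ are independent $\mathcal N(0,\mathrm{Id}_d)$. Iterating with i.i.d. copies of $(\xi^{(1)},\xi^{(2)})$ defines a Markov chain on $\mathbb R^d\times\mathbb R^d$ with transition kernel $Q_{h,\gamma}^U$. Class of potentials: $\mathcal U_\kappa^d=\{U\in C^\infty(\mathbb R^d): \mathrm{Id}_d\preceq\nabla^2U(x)\preceq\kappa\,\mathrm{Id}_d\text{ for every }x\}$. Distances: $\|\nu-\widetilde\nu\|_{\mathrm{TV}}=\sup_A|\nu(A)-\widetilde\nu(A)|$ (sup over Borel sets), and $W_2$ is the $2$-Wasserstein distance for the Euclidean metric. $\delta_z$ is the Dirac mass at $z$. An invariant law is an invariant probability measure. For $\lambda\in[1,\kappa]$, $$A_\lambda(s,\beta)=\begin{pmatrix}1+\beta-s\lambda&-\beta\\1&0\end{pmatrix},\qquad \rho_{\mathrm q}(s,\beta;\kappa)=\max_{\lambda\in[1,\kappa]}\rho(A_\lambda(s,\beta)),$$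 where $\rho(\cdot)$ denotes the spectral radius. *)

theory Defs
  imports
    "HOL-Probability.Probability"
    "Jordan_Normal_Form.Spectral_Radius"
begin

section \<open>Potentials\<close>

definition gradient :: "('a::euclidean_space \<Rightarrow> real) \<Rightarrow> 'a \<Rightarrow> 'a" where
  "gradient U x = (THE D. GDERIV U x :> D)"

definition hessian :: "('a::euclidean_space \<Rightarrow> real) \<Rightarrow> 'a \<Rightarrow> 'a \<Rightarrow> 'a" where
  "hessian U x = frechet_derivative (gradient U) (at x)"

text \<open>On a finite-dimensional space, differentiability together with \<open>C\<^sup>k\<close> directional
  derivatives in every direction is the same as being \<open>C\<^sup>k\<^sup>+\<^sup>1\<close>.\<close>

primrec Ck_differentiable :: "nat \<Rightarrow> ('a::euclidean_space \<Rightarrow> real) \<Rightarrow> bool" where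
  "Ck_differentiable 0 f \<longleftrightarrow> continuous_on UNIV f"
| "Ck_differentiable (Suc k) f \<longleftrightarrow>
     f differentiable_on UNIV \<and>
     (\<forall>v. Ck_differentiable k (\<lambda>x. frechet_derivative f (at x) v))"

definition C_infinity :: "('a::euclidean_space \<Rightarrow> real) \<Rightarrow> bool" where
  "C_infinity f \<longleftrightarrow> (\<forall>k. Ck_differentiable k f)"

text \<open>The Loewner order, for symmetric linear operators.\<close>

definition loewner_le :: "('a::euclidean_space \<Rightarrow> 'a) \<Rightarrow> ('a \<Rightarrow> 'a) \<Rightarrow> bool" where
  "loewner_le A B \<longleftrightarrow> (\<forall>v. inner (A v) v \<le> inner (B v) v)"

definition potentials :: "real \<Rightarrow> ('a::euclidean_space \<Rightarrow> real) set" where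
  "potentials \<kappa> = {U. C_infinity U \<and>
     (\<forall>x. loewner_le (\<lambda>v. v) (hessian U x) \<and> loewner_le (hessian U x) (\<lambda>v. \<kappa> *\<^sub>R v))}"

definition quadratic_potential :: "real \<Rightarrow> 'a::euclidean_space \<Rightarrow> real" where
  "quadratic_potential l x = l * (norm x)\<^sup>2 / 2"

definition dilated_potential :: "real \<Rightarrow> ('a::euclidean_space \<Rightarrow> real) \<Rightarrow> 'a \<Rightarrow> real" where
  "dilated_potential R U x = R\<^sup>2 * U (x /\<^sub>R R)"

section \<open>The OBABO chain\<close>

definition std_gaussian :: "'a::euclidean_space measure" where
  "std_gaussian = density lborel (\<lambda>x. ennreal (\<Prod>b\<in>Basis. std_normal_density (inner x b)))"

definition obabo_step ::
  "real \<Rightarrow> real \<Rightarrow> ('a::euclidean_space \<Rightarrow> real) \<Rightarrow> 'a \<times> 'a \<Rightarrow> 'a \<times> 'a \<Rightarrow> 'a \<times> 'a" where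
  "obabo_step h \<gamma> U = (\<lambda>(x, v) (\<xi>1, \<xi>2).
     let r = exp (- \<gamma> * h / 2);
         \<sigma> = sqrt (1 - r\<^sup>2);
         va = r *\<^sub>R v + \<sigma> *\<^sub>R \<xi>1;
         vb = va - (h / 2) *\<^sub>R gradient U x;
         x' = x + h *\<^sub>R vb;
         vc = vb - (h / 2) *\<^sub>R gradient U x'
     in (x', r *\<^sub>R vc + \<sigma> *\<^sub>R \<xi>2))"

definition obabo_kernel ::
  "real \<Rightarrow> real \<Rightarrow> ('a::euclidean_space \<Rightarrow> real) \<Rightarrow> 'a \<times> 'a \<Rightarrow> ('a \<times> 'a) measure" where
  "obabo_kernel h \<gamma> U z =
     distr (std_gaussian \<Otimes>\<^sub>M std_gaussian) borel (\<lambda>\<xi>. obabo_step h \<gamma> U z \<xi>)"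

definition dirac_iterate ::
  "('b::topological_space \<Rightarrow> 'b measure) \<Rightarrow> nat \<Rightarrow> 'b \<Rightarrow> 'b measure" where
  "dirac_iterate Q n z = ((\<lambda>\<mu>. Giry_Monad.bind \<mu> Q) ^^ n) (return borel z)"

definition invariant_law ::
  "('b::topological_space \<Rightarrow> 'b measure) \<Rightarrow> 'b measure \<Rightarrow> bool" where
  "invariant_law Q \<mu> \<longleftrightarrow>
     prob_space \<mu> \<and> sets \<mu> = sets borel \<and> Giry_Monad.bind \<mu> Q = \<mu>"

section \<open>Distances between probability measures\<close>

definition tv_dist :: "'b::topological_space measure \<Rightarrow> 'b measure \<Rightarrow> real" where
  "tv_dist \<mu> \<nu> = (SUP A\<in>sets borel. \<bar>measure \<mu> A - measure \<nu> A\<bar>)"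

definition couplings ::
  "'b::topological_space measure \<Rightarrow> 'b measure \<Rightarrow> ('b \<times> 'b) measure set" where
  "couplings \<mu> \<nu> = {\<Gamma>. sets \<Gamma> = sets (borel \<Otimes>\<^sub>M borel) \<and>
     distr \<Gamma> borel fst = \<mu> \<and> distr \<Gamma> borel snd = \<nu>}"

definition ennreal_sqrt :: "ennreal \<Rightarrow> ennreal" where
  "ennreal_sqrt a = (if a = \<infinity> then \<infinity> else ennreal (sqrt (enn2real a)))"

text \<open>Extended-valued, so that an upper bound by a real number includes finiteness.
  On \<open>'a \<times> 'a\<close> the library's \<open>dist\<close> is the Euclidean product metric.\<close>

definition W2 :: "'b::metric_space measure \<Rightarrow> 'b measure \<Rightarrow> ennreal" where
  "W2 \<mu> \<nu> = (INF \<Gamma>\<in>couplings \<mu> \<nu>.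
     ennreal_sqrt (\<integral>\<^sup>+p. ennreal ((dist (fst p) (snd p))\<^sup>2) \<partial>\<Gamma>))"

section \<open>The quadratic rate\<close>

definition A_matrix :: "real \<Rightarrow> real \<Rightarrow> real \<Rightarrow> real mat" where
  "A_matrix l s \<beta> = mat_of_rows_list 2 [[1 + \<beta> - s * l, - \<beta>], [1, 0]]"

text \<open>The supremum is a maximum, by continuity in \<open>l\<close> and compactness of \<open>{1..\<kappa>}\<close>.\<close>

definition rho_q :: "real \<Rightarrow> real \<Rightarrow> real \<Rightarrow> real" where
  "rho_q s \<beta> \<kappa> =
     (SUP l\<in>{1..\<kappa>}. spectral_radius (map_mat complex_of_real (A_matrix l s \<beta>)))"

end

theory Submission
  imports Defs
begin

text \<open>
  One OBABO step is a heavy-ball step in disguise. If \<open>u\<close> is the position that would come next without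
  noise and \<open>x\<close> the present position, the pair \<open>(u, x)\<close> evolves by
  \<open>x\<^bsub>k+1\<^esub> = x\<^sub>k + \<beta> (x\<^sub>k - x\<^bsub>k-1\<^esub>) - s \<nabla>U(x\<^sub>k) + noise\<close> (\<open>lookahead_obabo_step\<close>). For a quadratic
  potential of curvature \<open>l\<close> this is the linear recursion with matrix \<^const>\<open>A_matrix\<close>, and under
  \<open>h < 2 / sqrt \<kappa>\<close> it is stable for every \<open>l \<in> {1..\<kappa>}\<close>. The dichotomy is according to whether the
  quadratic rate \<open>\<rho>\<close> is at least \<open>q\<close>.

  If \<open>\<rho> \<ge> q\<close>, take the worst curvature \<open>l\<close> and a root \<open>w\<close> of modulus \<open>\<rho>\<close> of the characteristic polynomial. On
  the plane, seen as the complex numbers, \<open>w\<close> has an eigendirection, along which a shift of the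
  initial state by \<open>D\<close> translates the law after \<open>n\<close> steps by \<open>w\<^sup>n D\<close>. The total variation distance of the
  law from this translate is comparable to the length of the translation, so its \<open>n\<close>-th root tends to \<open>\<rho>\<close>
  (\<open>quadratic_total_variation_rate\<close>).

  If \<open>\<rho> < q\<close>, the step is long: \<open>s \<kappa> \<ge> 25 (1 - \<beta>)\<close>
  (\<open>quadratic_rate_below_imp_curvature\<close>). A long step lets the noiseless recursion cycle for some
  convex potential. For a suitable \<open>K\<close> there is a complex number \<open>c\<close> such that the \<open>K\<close>-th roots of
  unity \<open>x\<^sub>t\<close> form an orbit for any gradient that equals \<open>x\<^sub>t + (\<kappa> - 1) c x\<^sub>t\<close> at \<open>x\<^sub>t\<close>, and such that \<open>c x\<^sub>t\<close> is the
  point nearest to \<open>x\<^sub>t\<close> in the polygon with vertices \<open>c x\<^sub>t\<close>, robustly (\<open>exists_cycle\<close>). The projection to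
  the polygon is the gradient of a convex function, is nonexpansive, and is locally constant near each
  \<open>x\<^sub>t\<close>. After smoothing, \<open>\<bar>x\<bar>\<^sup>2 / 2\<close> plus \<open>\<kappa> - 1\<close> times that function is therefore an admissible potential
  (\<open>exists_cyclic_potential\<close>) with an exact cycle, near which the recursion is linear with curvature \<open>1\<close>
  and hence attracts to the cycle.

  Dilation by \<open>R\<close> keeps the Hessian bounds and makes the noise small relative to the cycle, so that a
  step leaves the moving trap around the cycle with probability at most \<open>4 exp (- \<eta>\<^sup>2 R\<^sup>2 / 4)\<close>, and the chain
  keeps the phase of the cycle for exponentially many steps (\<open>metastable_cycle\<close>). The invariant law
  has no phase: it gives disjoint consecutive traps nearly equal mass. This separates the two laws
  in total variation (\<open>cycle_total_variation\<close>). The invariant law exists, is unique and has the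
  required second moment because the gradient is a bounded perturbation of \<open>x\<close>: the chain has a quadratic
  Lyapunov function and a positive transition density, so that it regenerates
  (\<open>regeneration_invariant_law\<close>).
\<close>

section \<open>The spectral radius of the heavy-ball matrix\<close>

text \<open>The larger modulus of the two roots of \<open>z\<^sup>2 - a z + b\<close>. Conjugate roots have product \<open>b\<close>, hence
  modulus \<open>sqrt b\<close> each.\<close>

definition quadratic_radius :: "real \<Rightarrow> real \<Rightarrow> real" where
  "quadratic_radius a b = (if a\<^sup>2 \<le> 4 * b then sqrt b else (\<bar>a\<bar> + sqrt (a\<^sup>2 - 4 * b)) / 2)"

text \<open>\<^const>\<open>A_matrix\<close> is the companion matrix of \<open>z\<^sup>2 - (1 + \<beta> - s l) z + \<beta>\<close>: an eigenvector
  for \<open>z\<close> must be a multiple of \<open>(z, 1)\<close>.\<close>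

lemma eigenvalue_A_matrix:
  "eigenvalue (map_mat complex_of_real (A_matrix l s \<beta>)) z \<longleftrightarrow>
     z\<^sup>2 - of_real (1 + \<beta> - s * l) * z + of_real \<beta> = 0"
proof -
  define A where "A = map_mat complex_of_real (A_matrix l s \<beta>)"
  have A: "A \<in> carrier_mat 2 2"
    by (auto simp: A_def A_matrix_def mat_of_rows_list_def)
  have e00: "A $$ (0, 0) = of_real (1 + \<beta> - s * l)" and e01: "A $$ (0, Suc 0) = - of_real \<beta>"
    and e10: "A $$ (Suc 0, 0) = 1" and e11: "A $$ (Suc 0, Suc 0) = 0"
    by (auto simp: A_def A_matrix_def mat_of_rows_list_def)
  have comp: "(A *\<^sub>v v) $ 0 = of_real (1 + \<beta> - s * l) * v $ 0 - of_real \<beta> * v $ Suc 0"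
    "(A *\<^sub>v v) $ Suc 0 = v $ 0" if "v \<in> carrier_vec 2" for v
    using that A e00 e01 e10 e11
    by (auto simp: scalar_prod_def numeral_2_eq_2 simp del: of_real_add of_real_diff of_real_mult)
  show ?thesis
  proof
    assume "eigenvalue (map_mat complex_of_real (A_matrix l s \<beta>)) z"
    then obtain v where v: "v \<in> carrier_vec 2" "v \<noteq> 0\<^sub>v 2" "A *\<^sub>v v = z \<cdot>\<^sub>v v"
      using A by (auto simp: eigenvalue_def eigenvector_def A_def[symmetric])
    have 0: "of_real (1 + \<beta> - s * l) * v $ 0 - of_real \<beta> * v $ Suc 0 = z * v $ 0" "v $ 0 = z * v $ Suc 0"
      using comp[OF v(1)] v by auto
    then have "(z\<^sup>2 - of_real (1 + \<beta> - s * l) * z + of_real \<beta>) * v $ Suc 0 = 0"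
      by (simp add: algebra_simps power2_eq_square)
    moreover have "v $ Suc 0 \<noteq> 0"
    proof
      assume "v $ Suc 0 = 0"
      with 0 have "v $ i = 0" if "i < 2" for i using that by (cases i) (auto simp: less_Suc_eq numeral_2_eq_2)
      then have "v = 0\<^sub>v 2" using v(1) by (intro eq_vecI) auto
      with v(2) show False by simp
    qed
    ultimately show "z\<^sup>2 - of_real (1 + \<beta> - s * l) * z + of_real \<beta> = 0" by simp
  next
    assume z: "z\<^sup>2 - of_real (1 + \<beta> - s * l) * z + of_real \<beta> = 0"
    define v where "v = vec 2 (\<lambda>i. if i = 0 then z else 1)"
    have v: "v \<in> carrier_vec 2" "v $ 0 = z" "v $ Suc 0 = 1" by (auto simp: v_def)
    have "A *\<^sub>v v = z \<cdot>\<^sub>v v"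
    proof (rule eq_vecI)
      show "(A *\<^sub>v v) $ i = (z \<cdot>\<^sub>v v) $ i" if "i < dim_vec (z \<cdot>\<^sub>v v)" for i
      proof -
        have "i = 0 \<or> i = Suc 0" using that v by auto
        then show ?thesis
        proof
          assume "i = 0"
          moreover have "of_real (1 + \<beta> - s * l) * z - of_real \<beta> = z * z"
          proof -
            have "of_real (1 + \<beta> - s * l) * z - of_real \<beta> - z * z = - (z\<^sup>2 - of_real (1 + \<beta> - s * l) * z + of_real \<beta>)"
              by (simp add: power2_eq_square)
            then show ?thesis unfolding z by simp
          qed
          ultimately show ?thesis using comp(1)[OF v(1)] v by (simp del: index_mult_mat_vec)
        qed (use comp(2)[OF v(1)] v in \<open>simp del: index_mult_mat_vec\<close>)
      qed
    qed (use A v in auto)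
    moreover have "v \<noteq> 0\<^sub>v 2" using v(3) by (metis index_zero_vec(1) less_2_cases_iff One_nat_def zero_neq_one)
    ultimately show "eigenvalue (map_mat complex_of_real (A_matrix l s \<beta>)) z"
      using A v(1) by (auto simp: eigenvalue_def eigenvector_def A_def[symmetric])
  qed
qed

text \<open>A complex root \<open>w\<close> of the largest modulus is produced together with the modulus, because
  the quadratic chain is started along the eigenvector that belongs to \<open>w\<close>.\<close>

lemma quadratic_radius_root:
  assumes b: "0 < b"
  obtains w :: complex where "w\<^sup>2 - of_real a * w + of_real b = 0" "cmod w = quadratic_radius a b"
    "\<And>z :: complex. z\<^sup>2 - of_real a * z + of_real b = 0 \<Longrightarrow> cmod z \<le> quadratic_radius a b"
proof (cases "a\<^sup>2 \<le> 4 * b")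
  case True
  define w where "w = Complex (a / 2) (sqrt (4 * b - a\<^sup>2) / 2)"
  have fac: "z\<^sup>2 - of_real a * z + of_real b = (z - w) * (z - cnj w)" for z :: complex
  proof -
    define e where "e = sqrt (4 * b - a\<^sup>2)"
    have "e * e = 4 * b - a * a" using True by (simp add: e_def power2_eq_square)
    then show ?thesis unfolding w_def e_def[symmetric]
      by (simp add: complex_eq_iff power2_eq_square algebra_simps)
  qed
  have "(cmod w)\<^sup>2 = b"
    using True by (simp add: w_def cmod_power2 power_divide field_simps)
  then have n: "cmod w = sqrt b" by (metis abs_norm_cancel real_sqrt_abs)
  show ?thesis
  proof (rule that[of w])
    fix z :: complex assume "z\<^sup>2 - of_real a * z + of_real b = 0"
    then have "z = w \<or> z = cnj w" by (simp add: fac)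
    then show "cmod z \<le> quadratic_radius a b" using n True by (auto simp: quadratic_radius_def)
  qed (use n True in \<open>auto simp: quadratic_radius_def fac\<close>)
next
  case False
  define d where "d = sqrt (a\<^sup>2 - 4 * b)"
  have d: "d\<^sup>2 = a\<^sup>2 - 4 * b" "0 \<le> d" using False by (auto simp: d_def)
  have fac: "z\<^sup>2 - of_real a * z + of_real b = (z - of_real ((a + d) / 2)) * (z - of_real ((a - d) / 2))"
    for z :: complex
  proof -
    have "of_real b = (of_real ((a + d) / 2) * of_real ((a - d) / 2) :: complex)"
      unfolding of_real_mult[symmetric] using d(1)
      by (intro arg_cong[where f=of_real]) (simp add: field_simps power2_eq_square)
    then show ?thesis by (simp add: algebra_simps power2_eq_square add_divide_distrib diff_divide_distrib)
  qed
  have q: "quadratic_radius a b = (\<bar>a\<bar> + d) / 2" using False by (simp add: quadratic_radius_def d_def)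
  define w :: complex where "w = of_real (if 0 \<le> a then (a + d) / 2 else (a - d) / 2)"
  have "cmod w = quadratic_radius a b" using d by (auto simp: w_def q simp del: of_real_divide of_real_add of_real_diff)
  moreover have "w\<^sup>2 - of_real a * w + of_real b = 0" by (simp add: fac w_def)
  moreover have "cmod z \<le> quadratic_radius a b" if "z\<^sup>2 - of_real a * z + of_real b = 0" for z
  proof -
    have "z = of_real ((a + d) / 2) \<or> z = of_real ((a - d) / 2)" using that unfolding fac by simp
    then have "cmod z = \<bar>(a + d) / 2\<bar> \<or> cmod z = \<bar>(a - d) / 2\<bar>" by (metis norm_of_real)
    then show ?thesis using d(2) abs_triangle_ineq[of a d] abs_triangle_ineq4[of a d] unfolding q by auto
  qed
  ultimately show ?thesis by (intro that)
qed

lemma spectral_radius_A_matrix: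
  assumes "0 < \<beta>"
  shows "spectral_radius (map_mat complex_of_real (A_matrix l s \<beta>)) = quadratic_radius (1 + \<beta> - s * l) \<beta>"
proof -
  obtain w :: complex where w: "w\<^sup>2 - of_real (1 + \<beta> - s * l) * w + of_real \<beta> = 0"
      "cmod w = quadratic_radius (1 + \<beta> - s * l) \<beta>"
    and le: "\<And>z :: complex. z\<^sup>2 - of_real (1 + \<beta> - s * l) * z + of_real \<beta> = 0 \<Longrightarrow>
      cmod z \<le> quadratic_radius (1 + \<beta> - s * l) \<beta>"
    using quadratic_radius_root[OF assms] by blast
  have A: "map_mat complex_of_real (A_matrix l s \<beta>) \<in> carrier_mat 2 2"
    by (auto simp: A_matrix_def mat_of_rows_list_def)
  show ?thesis unfolding spectral_radius_def
  proof (rule Max_eqI)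
    show "finite (norm ` spectrum (map_mat complex_of_real (A_matrix l s \<beta>)))"
      using card_finite_spectrum(1)[OF A] by simp
  qed (use w le in \<open>auto simp: spectrum_def eigenvalue_A_matrix intro!: rev_image_eqI[of w]\<close>)
qed

lemma quadratic_radius_mono:
  assumes "\<bar>a\<bar> \<le> \<bar>a'\<bar>"
  shows "quadratic_radius a b \<le> quadratic_radius a' b"
proof -
  have sq: "a\<^sup>2 \<le> a'\<^sup>2" using assms by (simp add: abs_le_square_iff)
  consider "a'\<^sup>2 \<le> 4 * b" | "a\<^sup>2 \<le> 4 * b" "\<not> a'\<^sup>2 \<le> 4 * b" | "\<not> a\<^sup>2 \<le> 4 * b" using sq by linarith
  then show ?thesis
  proof cases
    case 1 then show ?thesis using sq by (simp add: quadratic_radius_def)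
  next
    case 2
    have "4 * b \<le> a'\<^sup>2" using 2 by simp
    then have "sqrt (4 * b) \<le> \<bar>a'\<bar>" by (metis real_sqrt_abs real_sqrt_le_mono)
    then have "sqrt b \<le> \<bar>a'\<bar> / 2" by (simp add: real_sqrt_mult)
    moreover have "0 \<le> sqrt (a'\<^sup>2 - 4 * b)" using 2 by simp
    ultimately show ?thesis using 2 unfolding quadratic_radius_def by (simp add: add_divide_distrib add_increasing2)
  next
    case 3
    then show ?thesis using sq assms by (auto simp: quadratic_radius_def intro!: divide_right_mono add_mono)
  qed
qed

lemma quadratic_radius_less_one:
  assumes "0 < b" "b < 1" "\<bar>a\<bar> < 1 + b"
  shows "quadratic_radius a b < 1"
proof (cases "a\<^sup>2 \<le> 4 * b")
  case True then show ?thesis using assms by (simp add: quadratic_radius_def)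
next
  case False
  then have "4 * b < \<bar>a\<bar>\<^sup>2" by simp
  have "\<bar>a\<bar> < 2" using assms by linarith
  have "a\<^sup>2 - 4 * b < (2 - \<bar>a\<bar>)\<^sup>2" using assms by (simp add: power2_eq_square algebra_simps)
  then have "sqrt (a\<^sup>2 - 4 * b) < 2 - \<bar>a\<bar>" using \<open>\<bar>a\<bar> < 2\<close>
    by (metis abs_of_pos diff_gt_0_iff_gt real_sqrt_abs real_sqrt_less_iff)
  then show ?thesis using False by (simp add: quadratic_radius_def)
qed

text \<open>Both roots have modulus below \<open>q\<close>, so their product \<open>b\<close> is below \<open>q\<^sup>2\<close>, and \<open>z\<^sup>2 - \<bar>a\<bar> z + b\<close> is
  positive at \<open>z = q\<close>, which lies beyond its roots.\<close>

lemma quadratic_radius_less: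
  assumes "0 < b" "quadratic_radius a b < q"
  shows "b < q\<^sup>2" "\<bar>a\<bar> < q + b / q"
proof -
  have sb: "sqrt b \<le> quadratic_radius a b"
  proof (cases "a\<^sup>2 \<le> 4 * b")
    case False
    then have "quadratic_radius (2 * sqrt b) b \<le> quadratic_radius a b"
      using assms(1)
      by (intro quadratic_radius_mono) (simp only: abs_le_square_iff, simp add: power_mult_distrib)
    then show ?thesis using assms(1) by (simp add: quadratic_radius_def power_mult_distrib)
  qed (simp add: quadratic_radius_def)
  then have q: "sqrt b < q" "0 < q" using assms by (auto intro: le_less_trans[of 0 "sqrt b"])
  then show bq: "b < q\<^sup>2" using assms(1) by (metis real_less_lsqrt real_sqrt_less_iff real_sqrt_unique less_eq_real_def sqrt_le_D not_le)
  have "0 < q\<^sup>2 - \<bar>a\<bar> * q + b"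
  proof (cases "a\<^sup>2 \<le> 4 * b")
    case True
    have "\<bar>a\<bar> \<le> 2 * sqrt b" using real_sqrt_le_mono[OF True] by (simp add: real_sqrt_mult)
    then have "\<bar>a\<bar> * q \<le> 2 * sqrt b * q" using q by simp
    moreover have "0 < (q - sqrt b)\<^sup>2" using q by simp
    moreover have "(q - sqrt b)\<^sup>2 = q\<^sup>2 - 2 * sqrt b * q + b"
      using assms(1) by (simp add: power2_diff)
    ultimately show ?thesis by linarith
  next
    case False
    define d where "d = sqrt (a\<^sup>2 - 4 * b)"
    have d: "d\<^sup>2 = a\<^sup>2 - 4 * b" "0 \<le> d" using False by (auto simp: d_def)
    have "(\<bar>a\<bar> + d) / 2 < q" using assms False by (simp add: quadratic_radius_def d_def)
    then have "0 < (q - (\<bar>a\<bar> + d) / 2) * (q - (\<bar>a\<bar> - d) / 2)" using d by (intro mult_pos_pos) auto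
    also have "\<dots> = q\<^sup>2 - \<bar>a\<bar> * q + (\<bar>a\<bar>\<^sup>2 - d\<^sup>2) / 4" by (simp add: power2_eq_square field_simps)
    also have "\<dots> = q\<^sup>2 - \<bar>a\<bar> * q + b" using d by simp
    finally show ?thesis .
  qed
  then show "\<bar>a\<bar> < q + b / q" using q by (simp add: field_simps power2_eq_square)
qed

text \<open>The radius increases with \<open>\<bar>a\<bar>\<close>, and \<open>\<bar>1 + \<beta> - s l\<bar>\<close> is convex in \<open>l\<close>; hence the maximum is attained
  at one of the endpoints \<open>1\<close> and \<open>\<kappa>\<close>.\<close>

lemma rho_q_attained:
  assumes b: "0 < \<beta>" and s: "0 < s" and k: "1 \<le> \<kappa>"
  obtains l where "l \<in> {1..\<kappa>}" "rho_q s \<beta> \<kappa> = quadratic_radius (1 + \<beta> - s * l) \<beta>"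
    "quadratic_radius (1 + \<beta> - s) \<beta> \<le> rho_q s \<beta> \<kappa>"
proof -
  define l where "l = (if \<bar>1 + \<beta> - s\<bar> \<le> \<bar>1 + \<beta> - s * \<kappa>\<bar> then \<kappa> else 1)"
  have l: "l \<in> {1..\<kappa>}" using k by (auto simp: l_def)
  have max: "quadratic_radius (1 + \<beta> - s * x) \<beta> \<le> quadratic_radius (1 + \<beta> - s * l) \<beta>" if "x \<in> {1..\<kappa>}" for x
  proof (rule quadratic_radius_mono)
    have "s * 1 \<le> s * x" "s * x \<le> s * \<kappa>" using that s by (auto simp del: mult_le_cancel_left1 mult_le_cancel_left)
    then show "\<bar>1 + \<beta> - s * x\<bar> \<le> \<bar>1 + \<beta> - s * l\<bar>" unfolding l_def
      by (smt (verit) mult_cancel_left1)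
  qed
  have "rho_q s \<beta> \<kappa> = (SUP x\<in>{1..\<kappa>}. quadratic_radius (1 + \<beta> - s * x) \<beta>)"
    by (simp add: rho_q_def spectral_radius_A_matrix[OF b])
  also have "\<dots> = quadratic_radius (1 + \<beta> - s * l) \<beta>"
    using l max by (intro cSup_eq_maximum) auto
  finally show ?thesis using that[OF l] max[of 1] k by simp
qed

section \<open>A norm contracted by a stable recursion\<close>

text \<open>The form \<open>(1 + b) (\<bar>u\<bar>\<^sup>2 + \<bar>w\<bar>\<^sup>2) - 2 a \<langle>u, w\<rangle>\<close> is positive definite if \<open>\<bar>a\<bar> < 1 + b\<close>, and one step
  \<open>(u, w) \<mapsto> (a u - b w, u)\<close> decreases it by \<open>(1 - b) \<bar>a u - (1 + b) w\<bar>\<^sup>2\<close>. To gain a strict factor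
  \<open>t < 1\<close>, use the form that belongs to the coefficients \<open>a / t\<close> and \<open>b / t\<^sup>2\<close>, with \<open>w\<close> rescaled by \<open>t\<close>; these
  satisfy the same inequalities once \<open>t\<close> is close enough to \<open>1\<close>. Completing the square writes the form as
  \<open>\<bar>L (u, w)\<bar>\<^sup>2\<close> for a linear isomorphism \<open>L\<close>, so its root is a norm.\<close>

lemma heavy_ball_norm:
  fixes a b :: real
  assumes b: "0 < b" "b < 1" and a: "\<bar>a\<bar> < 1 + b"
  obtains N :: "'a::real_inner \<times> 'a \<Rightarrow> real" and c C \<theta> where
    "0 < \<theta>" "\<theta> < 1" "0 < c" "0 < C"
    "\<And>p q. N (p + q) \<le> N p + N q" "\<And>p. c * norm p \<le> N p" "\<And>p. N p \<le> C * norm p"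
    "\<And>u w. N (a *\<^sub>R u - b *\<^sub>R w, u) \<le> \<theta> * N (u, w)"
proof -
  \<comment> \<open>the strict inequalities at \<open>t = 1\<close> persist for \<open>t\<close> slightly below \<open>1\<close>\<close>
  have "\<exists>t. 0 < t \<and> t < 1 \<and> b \<le> t\<^sup>2 \<and> \<bar>a\<bar> * t < t\<^sup>2 + b"
  proof -
    have "continuous (at 1) (\<lambda>t::real. min (t\<^sup>2 - b) (t\<^sup>2 + b - \<bar>a\<bar> * t))" by (intro continuous_intros)
    moreover have "0 < min (1\<^sup>2 - b) (1\<^sup>2 + b - \<bar>a\<bar> * 1)" using assms by simp
    ultimately have "eventually (\<lambda>t. 0 < min (t\<^sup>2 - b) (t\<^sup>2 + b - \<bar>a\<bar> * t)) (at (1::real))"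
      unfolding continuous_at by (rule order_tendstoD)
    then have "eventually (\<lambda>t. 0 < min (t\<^sup>2 - b) (t\<^sup>2 + b - \<bar>a\<bar> * t)) (at_left (1::real))"
      by (simp add: eventually_at_split)
    moreover have "eventually (\<lambda>t. t < (1::real) \<and> 0 < t) (at_left 1)"
      by (intro eventually_conj eventually_at_left_real[THEN eventually_mono, of 0]) (auto simp: eventually_at_filter)
    ultimately have "eventually (\<lambda>t. 0 < min (t\<^sup>2 - b) (t\<^sup>2 + b - \<bar>a\<bar> * t) \<and> t < (1::real) \<and> 0 < t) (at_left (1::real))"
      by (rule eventually_conj)
    then obtain t where "0 < min (t\<^sup>2 - b) (t\<^sup>2 + b - \<bar>a\<bar> * t) \<and> t < (1::real) \<and> 0 < t"
      using eventually_happens'[of "at_left (1::real)"] by auto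
    then show ?thesis by (intro exI[of _ t]) auto
  qed
  then obtain t where t: "0 < t" "t < 1" "b \<le> t\<^sup>2" "\<bar>a\<bar> * t < t\<^sup>2 + b" by blast
  \<comment> \<open>the form is \<open>A \<bar>u - \<tau> w\<bar>\<^sup>2 + B \<bar>w\<bar>\<^sup>2\<close>\<close>
  define A where "A = t\<^sup>2 + b"
  define \<tau> where "\<tau> = a * t\<^sup>2 / A"
  have A: "0 < A" using b by (simp add: A_def add_nonneg_pos)
  define B where "B = A * t\<^sup>2 - a\<^sup>2 * t^4 / A"
  have "(\<bar>a\<bar> * t)\<^sup>2 < A\<^sup>2" using t A by (intro power_strict_mono) (auto simp: A_def)
  then have "a\<^sup>2 * t\<^sup>2 * t\<^sup>2 < A\<^sup>2 * t\<^sup>2" using t by (intro mult_strict_right_mono) (auto simp: power_mult_distrib)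
  then have B: "0 < B" using A by (simp add: B_def field_simps power2_eq_square power4_eq_xxxx)
  define L where "L = (\<lambda>p::'a \<times> 'a. (sqrt A *\<^sub>R (fst p - \<tau> *\<^sub>R snd p), sqrt B *\<^sub>R snd p))"
  have bl: "bounded_linear L" unfolding L_def
    by (intro bounded_linear_Pair bounded_linear_scaleR_right[THEN bounded_linear_compose]
          bounded_linear_sub bounded_linear_fst bounded_linear_snd)
  define J where "J = (\<lambda>p::'a \<times> 'a. ((1 / sqrt A) *\<^sub>R fst p + (\<tau> / sqrt B) *\<^sub>R snd p, (1 / sqrt B) *\<^sub>R snd p))"
  have blJ: "bounded_linear J" unfolding J_def
    by (intro bounded_linear_Pair bounded_linear_scaleR_right[THEN bounded_linear_compose]
          bounded_linear_add bounded_linear_fst bounded_linear_snd)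
  have JL: "J (L p) = p" for p using A B by (cases p) (simp add: J_def L_def)
  obtain C where C: "0 < C" "\<And>p. norm (L p) \<le> norm p * C" using bounded_linear.pos_bounded[OF bl] by blast
  obtain c where c: "0 < c" "\<And>p. norm (J p) \<le> norm p * c" using bounded_linear.pos_bounded[OF blJ] by blast
  have sq: "(norm (L (u, w)))\<^sup>2 = A * (inner u u + t\<^sup>2 * inner w w) - 2 * a * t\<^sup>2 * inner u w" for u w
  proof -
    have "(norm (L (u, w)))\<^sup>2 = A * (norm (u - \<tau> *\<^sub>R w))\<^sup>2 + B * (norm w)\<^sup>2"
      using A B by (simp add: L_def norm_Pair power_mult_distrib)
    also have "\<dots> = A * (inner u u - 2 * \<tau> * inner u w + \<tau>\<^sup>2 * inner w w) + B * inner w w"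
      unfolding power2_norm_eq_inner by (simp add: inner_diff algebra_simps inner_commute power2_eq_square)
    also have "\<dots> = A * inner u u - 2 * (A * \<tau>) * inner u w + (A * \<tau>\<^sup>2 + B) * inner w w"
      by (simp add: algebra_simps)
    also have "A * \<tau> = a * t\<^sup>2" using A by (simp add: \<tau>_def)
    also have "A * \<tau>\<^sup>2 + B = A * t\<^sup>2" using A by (simp add: \<tau>_def B_def power2_eq_square power4_eq_xxxx)
    finally show ?thesis by (simp add: algebra_simps)
  qed
  have con: "norm (L (a *\<^sub>R u - b *\<^sub>R w, u)) \<le> t * norm (L (u, w))" for u w
  proof -
    have "t\<^sup>2 * (norm (L (u, w)))\<^sup>2 - (norm (L (a *\<^sub>R u - b *\<^sub>R w, u)))\<^sup>2
       = (t\<^sup>2 - b) * (norm (a *\<^sub>R u - A *\<^sub>R w))\<^sup>2"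
      unfolding sq unfolding A_def power2_norm_eq_inner
      by (simp add: inner_diff inner_commute[of w u] algebra_simps power2_eq_square)
    moreover have "0 \<le> (t\<^sup>2 - b) * (norm (a *\<^sub>R u - A *\<^sub>R w))\<^sup>2" using t by simp
    ultimately have "(norm (L (a *\<^sub>R u - b *\<^sub>R w, u)))\<^sup>2 \<le> (t * norm (L (u, w)))\<^sup>2"
      by (simp add: power_mult_distrib)
    then show ?thesis by (rule power2_le_imp_le) (use t in simp)
  qed
  show ?thesis
  proof (rule that[of t "1 / c" C "\<lambda>p. norm (L p)"])
    show "norm (L (p + q)) \<le> norm (L p) + norm (L q)" for p q
      by (metis bounded_linear.linear[OF bl] linear_add norm_triangle_ineq)
    show "1 / c * norm p \<le> norm (L p)" for p using c(2)[of "L p"] c(1) by (simp add: JL field_simps)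
  qed (use t C c con in \<open>auto simp: mult.commute\<close>)
qed

section \<open>Heavy-ball cycles on roots of unity\<close>

text \<open>\<open>1 - cos (2 \<pi> / K)\<close> is \<open>3 / 2\<close> at \<open>K = 3\<close>, tends to \<open>0\<close>, and decreases by a factor of at most \<open>4\<close> from
  one \<open>K\<close> to the next, since the angle shrinks by at most half. So it cannot jump over an interval
  whose endpoints have ratio \<open>4\<close>.\<close>

lemma exists_cycle_length:
  fixes L :: real
  assumes L: "0 < L" "L < 4"
  obtains K :: nat where "3 \<le> K" "L / 10 \<le> 1 - cos (2 * pi / K)" "1 - cos (2 * pi / K) \<le> 2 * L / 5"
proof (cases "3 / 2 \<le> 2 * L / 5")
  case True
  have "cos (2 * pi / 3) = - 1 / 2" by (rule cos_120)
  then show ?thesis using L True by (intro that[of 3]) auto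
next
  case False
  have "(\<lambda>K::nat. 1 - cos (2 * pi / K)) \<longlonglongrightarrow> 1 - cos 0"
    by (intro tendsto_intros tendsto_divide_0[OF tendsto_const] filterlim_at_top_imp_at_infinity filterlim_real_sequentially)
  then have "eventually (\<lambda>K::nat. 1 - cos (2 * pi / K) < 2 * L / 5) sequentially"
    using L by (intro order_tendstoD(2)[where y="1 - cos 0"]) simp_all
  then obtain K0 where K0: "\<And>K. K \<ge> K0 \<Longrightarrow> 1 - cos (2 * pi / real K) < 2 * L / 5"
    by (auto simp: eventually_sequentially)
  define P where "P = (\<lambda>K::nat. 3 \<le> K \<and> 1 - cos (2 * pi / K) \<le> 2 * L / 5)"
  have ex: "P (max 3 K0)" using K0[of "max 3 K0"] by (simp add: P_def)
  \<comment> \<open>the first value that is not above the interval is still inside it\<close>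
  define K where "K = (LEAST K. P K)"
  have K: "P K" unfolding K_def by (rule LeastI[of P, OF ex])
  have "K \<noteq> 3"
  proof
    assume "K = 3"
    then have "1 - cos (2 * pi / 3) \<le> 2 * L / 5" using K by (simp add: P_def)
    then show False using False unfolding cos_120 by simp
  qed
  then have K4: "4 \<le> K" using K by (simp add: P_def)
  have "\<not> P (K - 1)" unfolding K_def using K4 by (intro not_less_Least) (simp add: K_def)
  then have big: "2 * L / 5 < 1 - cos (2 * pi / real (K - 1))" using K4 unfolding P_def by linarith
  have half: "1 - cos (2 * x) = 2 * (sin x)\<^sup>2" for x :: real by (simp add: cos_double_sin)
  define x where "x = pi / real K"
  define y where "y = pi / real (K - 1)"
  have rK: "real (K - 1) = real K - 1" using K4 by (simp add: of_nat_diff)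
  have xy: "0 < x" "0 < y" "x \<le> pi / 4" "y \<le> 2 * x"
    using K4 by (auto simp: x_def y_def rK field_simps intro!: divide_left_mono)
  have "sin y \<le> sin (2 * x)" using xy by (intro sin_mono_le_eq[THEN iffD2]) auto
  also have "\<dots> = 2 * sin x * cos x" by (rule sin_double)
  also have "\<dots> \<le> 2 * sin x * 1"
    using xy sin_ge_zero[of x] by (intro mult_left_mono) auto
  finally have "(sin y)\<^sup>2 \<le> (2 * sin x)\<^sup>2" using xy sin_ge_zero[of y] by (intro power_mono) auto
  then have "1 - cos (2 * y) \<le> 4 * (1 - cos (2 * x))" unfolding half by (simp add: power_mult_distrib)
  then show ?thesis using K big by (intro that[of K]) (auto simp: P_def x_def y_def)
qed

text \<open>With \<open>u = 1 - cos \<theta>\<close>, \<open>X = (1 + \<beta>) u\<close> and \<open>Y = (1 - \<beta>) sin \<theta>\<close>, the right-hand side is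
  \<open>(L - X) (X - m) - Y\<^sup>2\<close>. Up to terms that are small because \<open>1 - \<beta>\<close> and \<open>m\<close> are small compared with
  \<open>L\<close>, the inequality says that \<open>2 u (L - 2 u)\<close> is positive; this concave function of \<open>u\<close> is at least
  \<open>4 / 25 L\<^sup>2\<close> between \<open>L / 10\<close> and \<open>2 L / 5\<close>, with equality at both ends.\<close>

lemma cycle_inequality:
  fixes \<beta> L m u :: real
  assumes "0 < \<beta>" "\<beta> < 1" "0 < m" "0 < L" "50 * m \<le> L" "25 * (1 - \<beta>) \<le> L"
    and u: "L / 10 \<le> u" "u \<le> 2 * L / 5"
  shows "(1 - \<beta>) * (2 - u) * (L - m) < (L - (1 + \<beta>) * u) * ((1 + \<beta>) * u - m) - (1 - \<beta>)\<^sup>2 * u * (2 - u)"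
proof -
  have "0 \<le> (u - L / 10) * (2 * L / 5 - u)" using u by simp
  moreover have "u * (L - 2 * u) - 8 / 100 * L * L = 2 * ((u - L / 10) * (2 * L / 5 - u))" by (simp add: field_simps)
  ultimately have 1: "8 / 100 * L * L \<le> u * (L - 2 * u)" by linarith
  have 2: "(1 - \<beta>)\<^sup>2 * u \<le> (1 - \<beta>) * (2 * L / 5)"
  proof -
    have "(1 - \<beta>)\<^sup>2 \<le> (1 - \<beta>)" using assms by (simp add: power2_eq_square mult_left_le)
    then show ?thesis using u assms by (intro mult_mono) auto
  qed
  have u0: "0 < u" using u assms by linarith
  have 3: "\<beta> * u\<^sup>2 \<le> u\<^sup>2" using assms by (simp add: mult_left_le_one_le)
  have 4: "25 * (1 - \<beta>) * L \<le> L * L" using assms by (intro mult_right_mono) auto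
  have 5: "50 * m * L \<le> L * L" using assms by (intro mult_right_mono) auto
  have 6: "0 \<le> \<beta> * m * u" "0 \<le> (1 - \<beta>) * m" using assms u0 by auto
  have 7: "0 < L * L" using assms by simp
  define U where "U = u\<^sup>2"
  define M where "M = m * L"
  define Z where "Z = L * L"
  define P where "P = (1 - \<beta>) * L"
  define V where "V = (1 - \<beta>)\<^sup>2 * u"
  define W where "W = u * L"
  have facts: "8 / 100 * Z \<le> W - 2 * U" "V \<le> 2 / 5 * P" "\<beta> * U \<le> U" "25 * P \<le> Z" "50 * M \<le> Z"
    "0 \<le> \<beta> * m * u" "0 \<le> (1 - \<beta>) * m" "0 < Z"
    using 1 2 3 4 5 6 7
    by (simp_all add: U_def M_def Z_def P_def V_def W_def power2_eq_square algebra_simps)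
  have "0 < 2 * (W - 2 * (\<beta> * U) + \<beta> * m * u - V - M / 2 - P + (1 - \<beta>) * m)"
  proof -
    have arith: "0 < 2 * (W - 2 * B + E - V - M / 2 - P + F)"
      if "8 / 100 * Z \<le> W - 2 * U" "V \<le> 2 / 5 * P" "B \<le> U" "25 * P \<le> Z" "50 * M \<le> Z"
        "0 \<le> E" "0 \<le> F" "0 < Z" for W U V P B Z M E F :: real
      using that by simp
    show ?thesis by (rule arith[OF facts])
  qed
  also have "\<dots> = (L - (1 + \<beta>) * u) * ((1 + \<beta>) * u - m) - (1 - \<beta>)\<^sup>2 * u * (2 - u)
      - (1 - \<beta>) * (2 - u) * (L - m)"
    by (simp add: U_def M_def Z_def P_def V_def W_def algebra_simps power2_eq_square)
  finally show ?thesis by simp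
qed

text \<open>The points \<open>x\<^sub>t = cis (\<theta> t)\<close> with \<open>\<theta> = 2 \<pi> / K\<close> are to form an orbit of the noiseless recursion for a
  potential whose gradient at \<open>x\<^sub>t\<close> is \<open>x\<^sub>t + (\<kappa> - 1) p\<^sub>t\<close>, where \<open>p\<^sub>t = c x\<^sub>t\<close>. By rotation invariance
  this is one linear equation for \<open>c\<close>, which is solved by the number chosen below. The last
  property says that \<open>x\<^sub>t\<close> lies in the interior of the normal cone at \<open>p\<^sub>t\<close> of the polygon with
  vertices \<open>p\<^sub>0, \<dots>, p\<^bsub>K-1\<^esub>\<close>, so that near \<open>x\<^sub>t\<close> the projection to the polygon is constantly \<open>p\<^sub>t\<close>.
  It is tightest for the neighbouring vertices, where it reduces to the preceding inequality.\<close>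

lemma exists_cycle:
  fixes \<beta> s \<kappa> :: real
  assumes b: "0 < \<beta>" "\<beta> < 1" and s: "0 < s" and k: "50 \<le> \<kappa>" and L: "s * \<kappa> < 4" "25 * (1 - \<beta>) \<le> s * \<kappa>"
  obtains K :: nat and c :: complex where "3 \<le> K"
    "cis (2 * pi / K) = of_real (1 + \<beta>) - of_real \<beta> * cis (- (2 * pi / K)) - of_real s * (1 + of_real (\<kappa> - 1) * c)"
    "\<And>j::nat. 0 < j \<Longrightarrow> j < K \<Longrightarrow> Re (cnj (1 - c) * (c * (cis (2 * pi / K * j) - 1))) < 0"
proof -
  define L where "L = s * \<kappa>"
  have L0: "0 < L" "50 * s \<le> L" "L < 4" "25 * (1 - \<beta>) \<le> L"
    using s k assms(5,6) by (auto simp: L_def mult.commute)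
  have sL: "s < L" using L0(2) s by linarith
  obtain K :: nat where K: "3 \<le> K" "L / 10 \<le> 1 - cos (2 * pi / K)" "1 - cos (2 * pi / K) \<le> 2 * L / 5"
    using exists_cycle_length[OF L0(1,3)] by blast
  define \<theta> where "\<theta> = 2 * pi / real K"
  define u where "u = 1 - cos \<theta>"
  define X where "X = (1 + \<beta>) * u"
  define Y where "Y = (1 - \<beta>) * sin \<theta>"
  define c where "c = Complex ((X - s) / (L - s)) (- Y / (L - s))"
  have Ls: "0 < L - s" "L - s \<noteq> 0" using sL by auto
  have key: "(1 - \<beta>) * (2 - u) * (L - s) < (L - X) * (X - s) - (1 - \<beta>)\<^sup>2 * u * (2 - u)"
    unfolding X_def using K L0 b s by (intro cycle_inequality) (auto simp: u_def \<theta>_def)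
  have sin2: "(sin \<theta>)\<^sup>2 = u * (2 - u)" by (simp add: u_def sin_squared_eq power2_eq_square algebra_simps)
  have \<theta>: "0 < \<theta>" "\<theta> \<le> 2 * pi / 3" "\<theta> < pi" using K(1)
    by (auto simp: \<theta>_def field_simps intro!: divide_left_mono)
  have sh: "0 < sin (\<theta> / 2)" "0 < cos (\<theta> / 2)" using \<theta> by (auto intro!: sin_gt_zero cos_gt_zero)
  have u_half: "2 - u = 2 * (cos (\<theta> / 2))\<^sup>2" using cos_double_cos[of "\<theta>/2"] by (simp add: u_def)
  have Yh: "Y = 2 * (1 - \<beta>) * sin (\<theta> / 2) * cos (\<theta> / 2)" using sin_double[of "\<theta>/2"] by (simp add: Y_def)
  have Y0: "0 \<le> Y" using b sh by (simp add: Yh)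
  \<comment> \<open>the cone condition for the neighbouring vertices, up to a positive factor\<close>
  have cone: "Y * (L - s) * cos (\<theta> / 2) < ((L - X) * (X - s) - Y\<^sup>2) * sin (\<theta> / 2)"
  proof -
    have "Y\<^sup>2 = (1 - \<beta>)\<^sup>2 * u * (2 - u)" by (simp add: Y_def power_mult_distrib sin2)
    moreover have "Y * (L - s) * cos (\<theta> / 2) = (1 - \<beta>) * (2 - u) * (L - s) * sin (\<theta> / 2)"
      by (simp add: Yh u_half power2_eq_square)
    ultimately show ?thesis using mult_strict_right_mono[OF key sh(1)] by presburger
  qed
  define p where "p = ((L - X) * (X - s) - Y\<^sup>2) / (L - s)\<^sup>2"
  have q: "cnj (1 - c) * c = Complex p (- Y / (L - s))"
  proof (rule complex_eqI)
    have e: "1 - (X - s) / (L - s) = (L - X) / (L - s)" using Ls by (simp add: field_simps)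
    have "Re (cnj (1 - c) * c) = (1 - (X - s) / (L - s)) * ((X - s) / (L - s)) - (Y / (L - s)) * (Y / (L - s))"
      by (simp add: c_def)
    also have "\<dots> = p" unfolding e p_def by (simp add: power2_eq_square diff_divide_distrib[of _ "Y * Y"])
    finally show "Re (cnj (1 - c) * c) = Re (Complex p (- Y / (L - s)))" by simp
    show "Im (cnj (1 - c) * c) = Im (Complex p (- Y / (L - s)))"
      by (simp add: c_def algebra_simps)
  qed
  have cone': "Y / (L - s) * cos (\<theta> / 2) < p * sin (\<theta> / 2)"
  proof -
    have "Y / (L - s) * cos (\<theta> / 2) = Y * (L - s) * cos (\<theta> / 2) / (L - s)\<^sup>2"
      using Ls by (simp add: power2_eq_square)
    also have "\<dots> < ((L - X) * (X - s) - Y\<^sup>2) * sin (\<theta> / 2) / (L - s)\<^sup>2"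
      using cone Ls by (intro divide_strict_right_mono) auto
    also have "\<dots> = p * sin (\<theta> / 2)" by (simp add: p_def)
    finally show ?thesis .
  qed
  have "0 \<le> Y / (L - s) * cos (\<theta> / 2)" using Y0 Ls sh by simp
  then have p0: "0 < p" using cone' sh by (smt (verit) mult_nonpos_nonneg)
  have neg: "Re (cnj (1 - c) * (c * (cis (\<theta> * j) - 1))) < 0" if j: "0 < j" "j < K" for j :: nat
  proof -
    define \<phi> where "\<phi> = \<theta> * j / 2"
    have \<phi>1: "\<theta> / 2 \<le> \<phi>" using j \<theta> by (simp add: \<phi>_def)
    have "real j + 1 \<le> real K" using j by linarith
    then have "\<theta> * real j \<le> \<theta> * (real K - 1)" using \<theta> by (intro mult_left_mono) auto
    also have "\<dots> = 2 * pi - \<theta>" using K(1) by (simp add: \<theta>_def field_simps)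
    finally have \<phi>2: "\<phi> \<le> pi - \<theta> / 2" by (simp add: \<phi>_def)
    have s1: "sin (\<theta> / 2) \<le> sin \<phi>"
    proof (cases "\<phi> \<le> pi / 2")
      case True then show ?thesis using \<phi>1 \<theta> by (intro sin_mono_le_eq[THEN iffD2]) auto
    next
      case False
      have "sin (\<theta> / 2) \<le> sin (pi - \<phi>)" using False \<phi>2 \<theta> \<phi>1 by (intro sin_mono_le_eq[THEN iffD2]) auto
      then show ?thesis by simp
    qed
    have c1: "cos \<phi> \<le> cos (\<theta> / 2)" using \<phi>1 \<phi>2 \<theta> by (intro cos_monotone_0_pi_le) auto
    have sp: "0 < sin \<phi>" using s1 sh by linarith
    have l2: "0 < p * sin \<phi> - Y / (L - s) * cos \<phi>"
    proof -
      have "Y / (L - s) * cos \<phi> \<le> Y / (L - s) * cos (\<theta> / 2)" using c1 Y0 Ls by (intro mult_left_mono) auto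
      also have "\<dots> < p * sin (\<theta> / 2)" by (rule cone')
      also have "\<dots> \<le> p * sin \<phi>" using s1 p0 by simp
      finally show ?thesis by simp
    qed
    have cc: "cos (\<theta> * j) - 1 = - 2 * (sin \<phi>)\<^sup>2" "sin (\<theta> * j) = 2 * sin \<phi> * cos \<phi>"
      using cos_double_sin[of \<phi>] sin_double[of \<phi>] by (simp_all add: \<phi>_def)
    have "Re (cnj (1 - c) * (c * (cis (\<theta> * j) - 1))) = Re ((cnj (1 - c) * c) * (cis (\<theta> * j) - 1))"
      by (simp add: mult.assoc)
    also have "\<dots> = p * (cos (\<theta> * j) - 1) + Y / (L - s) * sin (\<theta> * j)"
      unfolding q by simp
    also have "\<dots> = - (2 * sin \<phi> * (p * sin \<phi> - Y / (L - s) * cos \<phi>))"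
      unfolding cc by (simp add: algebra_simps power2_eq_square)
    also have "\<dots> < 0" using l2 sp by simp
    finally show ?thesis .
  qed
  have rec: "cis \<theta> = of_real (1 + \<beta>) - of_real \<beta> * cis (- \<theta>) - of_real s * (1 + of_real (\<kappa> - 1) * c)"
  proof -
    have sk: "s * (\<kappa> - 1) = L - s" by (simp add: L_def algebra_simps)
    have r: "s * ((\<kappa> - 1) * Re c) = X - s" using Ls sk by (simp add: c_def mult.assoc[symmetric])
    have i: "s * ((\<kappa> - 1) * Im c) = - Y" using Ls sk by (simp add: c_def mult.assoc[symmetric])
    show ?thesis
    proof (rule complex_eqI)
      show "Re (cis \<theta>) = Re (of_real (1 + \<beta>) - of_real \<beta> * cis (- \<theta>) - of_real s * (1 + of_real (\<kappa> - 1) * c))"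
        using r by (simp add: X_def u_def algebra_simps)
      show "Im (cis \<theta>) = Im (of_real (1 + \<beta>) - of_real \<beta> * cis (- \<theta>) - of_real s * (1 + of_real (\<kappa> - 1) * c))"
        using i by (simp add: Y_def algebra_simps)
    qed
  qed
  show ?thesis using that[of K c] K(1) rec neg by (simp add: \<theta>_def)
qed

section \<open>Smooth functions\<close>

lemma Ck_differentiableI:
  assumes "\<And>x. (f has_derivative f' x) (at x)" "\<And>v. Ck_differentiable k (\<lambda>x. f' x v)"
  shows "Ck_differentiable (Suc k) f"
proof -
  have "frechet_derivative f (at x) = f' x" for x
    using frechet_derivative_at[OF assms(1)] by simp
  then show ?thesis using assms(2)
    by (auto simp: differentiable_on_def intro!: differentiableI[OF assms(1)] differentiable_at_withinI)
qed

lemma Ck_differentiable_SucD: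
  assumes "Ck_differentiable (Suc k) f"
  shows "(f has_derivative frechet_derivative f (at x)) (at x)" "Ck_differentiable k (\<lambda>x. frechet_derivative f (at x) v)"
  using assms by (auto simp: differentiable_on_def frechet_derivative_works[symmetric])

lemma Ck_differentiable_Suc_imp: "Ck_differentiable (Suc k) f \<Longrightarrow> Ck_differentiable k f"
proof (induction k arbitrary: f)
  case 0 then show ?case by (auto intro: differentiable_imp_continuous_on)
next
  case (Suc k)
  show ?case
    by (rule Ck_differentiableI[OF Ck_differentiable_SucD(1)[OF Suc.prems] Suc.IH[OF Ck_differentiable_SucD(2)[OF Suc.prems]]])
qed

lemma Ck_differentiable_const: "Ck_differentiable k (\<lambda>x. c)"
proof (induction k arbitrary: c)
  case (Suc k) then show ?case by (intro Ck_differentiableI[where f'="\<lambda>_ _. 0"]) auto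
qed auto

lemma Ck_differentiable_linear: "bounded_linear f \<Longrightarrow> Ck_differentiable k f"
proof (induction k)
  case 0 then show ?case by (simp add: linear_continuous_on)
next
  case (Suc k) then show ?case
    by (intro Ck_differentiableI[where f'="\<lambda>_. f"] bounded_linear_imp_has_derivative Ck_differentiable_const)
qed

lemma Ck_differentiable_add:
  "Ck_differentiable k f \<Longrightarrow> Ck_differentiable k g \<Longrightarrow> Ck_differentiable k (\<lambda>x. f x + g x)"
proof (induction k arbitrary: f g)
  case 0 then show ?case by (auto intro: continuous_intros)
next
  case (Suc k)
  show ?case
    by (rule Ck_differentiableI[OF has_derivative_add[OF Ck_differentiable_SucD(1)[OF Suc.prems(1)] Ck_differentiable_SucD(1)[OF Suc.prems(2)]]])
      (intro Suc.IH Ck_differentiable_SucD(2)[OF Suc.prems(1)] Ck_differentiable_SucD(2)[OF Suc.prems(2)])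
qed

lemma Ck_differentiable_mult:
  fixes f g :: "'a::euclidean_space \<Rightarrow> real"
  shows "Ck_differentiable k f \<Longrightarrow> Ck_differentiable k g \<Longrightarrow> Ck_differentiable k (\<lambda>x. f x * g x)"
proof (induction k arbitrary: f g)
  case 0 then show ?case by (auto intro: continuous_intros)
next
  case (Suc k)
  note f = Ck_differentiable_SucD[OF Suc.prems(1)] and g = Ck_differentiable_SucD[OF Suc.prems(2)]
  show ?case
    by (rule Ck_differentiableI[OF has_derivative_mult[OF f(1) g(1)]])
      (intro Ck_differentiable_add Suc.IH f(2) g(2) Ck_differentiable_Suc_imp[OF Suc.prems(1)] Ck_differentiable_Suc_imp[OF Suc.prems(2)])
qed

lemma Ck_differentiable_scale_arg:
  fixes f :: "'a::euclidean_space \<Rightarrow> real"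
  shows "Ck_differentiable k f \<Longrightarrow> Ck_differentiable k (\<lambda>x. f (c *\<^sub>R x))"
proof (induction k arbitrary: f)
  case 0
  then have "continuous_on UNIV f" by simp
  then show ?case by (auto intro!: continuous_on_compose2[of UNIV f] continuous_intros)
next
  case (Suc k)
  note f = Ck_differentiable_SucD[OF Suc.prems(1)]
  have "((\<lambda>x. f (c *\<^sub>R x)) has_derivative (\<lambda>v. frechet_derivative f (at (c *\<^sub>R x)) (c *\<^sub>R v))) (at x)" for x
    by (rule has_derivative_compose[OF _ f(1)]) (auto intro!: derivative_eq_intros)
  then show ?case by (rule Ck_differentiableI) (rule Suc.IH[OF f(2)])
qed

lemma C_infinity_directional:
  "C_infinity f \<Longrightarrow> C_infinity (\<lambda>x. frechet_derivative f (at x) v)"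
  unfolding C_infinity_def using Ck_differentiable_SucD(2) by blast

lemma C_infinity_has_derivative:
  "C_infinity f \<Longrightarrow> (f has_derivative frechet_derivative f (at x)) (at x)"
  unfolding C_infinity_def using Ck_differentiable_SucD(1) by blast

lemma C_infinity_continuous: "C_infinity f \<Longrightarrow> continuous_on UNIV f"
  unfolding C_infinity_def by (metis Ck_differentiable.simps(1))

subsection \<open>A bump function\<close>

text \<open>The powers in the denominator make the family closed under differentiation, so one induction over
  the order of differentiation serves all members.\<close>

definition flat :: "nat \<Rightarrow> real \<Rightarrow> real" where
  "flat n t = (if t \<le> 0 then 0 else exp (- 1 / t) / t ^ n)"

lemma flat_tendsto_0: "(flat n \<longlongrightarrow> 0) (at 0)"
proof -
  have "((\<lambda>t. (inverse t) ^ n / exp (inverse t)) \<longlongrightarrow> 0) (at_right (0::real))"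
    by (rule filterlim_compose[OF tendsto_power_div_exp_0 filterlim_inverse_at_top_right])
  moreover have "eventually (\<lambda>t. (inverse t) ^ n / exp (inverse t) = flat n t) (at_right 0)"
    by (auto simp: eventually_at_filter flat_def exp_minus field_simps)
  ultimately have "(flat n \<longlongrightarrow> 0) (at_right 0)" by (rule Lim_transform_eventually)
  moreover have "(flat n \<longlongrightarrow> 0) (at_left 0)"
    by (rule tendsto_eventually) (auto simp: eventually_at_filter flat_def)
  ultimately show ?thesis by (simp add: filterlim_at_split)
qed

lemma flat_deriv: "DERIV (flat n) t :> flat (n + 2) t - n * flat (n + 1) t"
proof -
  consider "t < 0" | "t = 0" | "t > 0" by linarith
  then show ?thesis
  proof cases
    case 1
    have "DERIV (\<lambda>_. 0) t :> 0" by simp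
    then have "DERIV (flat n) t :> 0"
      by (rule has_field_derivative_transform_within_open[of _ _ _ "{..<0}"]) (use 1 in \<open>auto simp: flat_def\<close>)
    then show ?thesis using 1 by (simp add: flat_def)
  next
    case 2
    have "((\<lambda>h. flat n h / h) \<longlongrightarrow> 0) (at 0)"
    proof (rule Lim_transform_eventually[OF flat_tendsto_0[of "n + 1"]])
      show "eventually (\<lambda>h. flat (n + 1) h = flat n h / h) (at 0)"
        by (auto simp: flat_def eventually_at_filter)
    qed
    then show ?thesis using 2 by (simp add: DERIV_def flat_def)
  next
    case 3
    have "DERIV (\<lambda>t. exp (- 1 / t) / t ^ n) t :>
        (exp (- 1 / t) * (1 / (t * t)) * t ^ n - exp (- 1 / t) * (real n * t ^ (n - 1))) / (t ^ n * t ^ n)"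
      using 3 by (auto intro!: derivative_eq_intros)
    also have "(exp (- 1 / t) * (1 / (t * t)) * t ^ n - exp (- 1 / t) * (real n * t ^ (n - 1))) / (t ^ n * t ^ n)
       = flat (n + 2) t - n * flat (n + 1) t"
      using 3 by (cases n) (simp_all add: flat_def field_simps)
    finally have *: "DERIV (\<lambda>t. exp (- 1 / t) / t ^ n) t :> flat (n + 2) t - n * flat (n + 1) t" .
    show ?thesis
      by (rule has_field_derivative_transform_within_open[OF *, of "{0<..}"]) (use 3 in \<open>auto simp: flat_def\<close>)
  qed
qed

definition bump :: "real \<Rightarrow> nat \<Rightarrow> 'a::euclidean_space \<Rightarrow> real" where
  "bump \<delta> n x = flat n (\<delta>\<^sup>2 - (norm x)\<^sup>2)"

lemma C_infinity_bump: "C_infinity (bump \<delta> n :: 'a::euclidean_space \<Rightarrow> real)"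
proof -
  have der: "(bump \<delta> n has_derivative (\<lambda>v. (bump \<delta> (n + 2) x + - n * bump \<delta> (n + 1) x) * (- 2 * inner v x))) (at x)"
    for n and x :: 'a
  proof -
    have "((\<lambda>x::'a. \<delta>\<^sup>2 - (norm x)\<^sup>2) has_derivative (\<lambda>v. - 2 * inner v x)) (at x)"
      unfolding power2_norm_eq_inner by (auto intro!: derivative_eq_intros simp: inner_commute)
    from has_derivative_compose[OF this flat_deriv[of n, unfolded has_field_derivative_def]]
    show ?thesis unfolding bump_def by simp
  qed
  have "Ck_differentiable k (bump \<delta> n :: 'a \<Rightarrow> real)" for k n
  proof (induction k arbitrary: n)
    case 0
    show ?case using has_derivative_continuous[OF der] by (simp add: continuous_on_eq_continuous_at)
  next
    case (Suc k)
    show ?case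
      by (rule Ck_differentiableI[OF der])
        (intro Ck_differentiable_mult Ck_differentiable_add Ck_differentiable_const Suc.IH
          Ck_differentiable_linear bounded_linear_inner_right)
  qed
  then show ?thesis by (simp add: C_infinity_def)
qed

lemma bump_nonneg: "0 \<le> bump \<delta> n x"
  by (simp add: bump_def flat_def)

lemma bump_eq_0: "0 < \<delta> \<Longrightarrow> \<delta> \<le> norm x \<Longrightarrow> bump \<delta> n x = 0"
  by (simp add: bump_def flat_def)

lemma bump_pos: "norm x < \<delta> \<Longrightarrow> 0 < bump \<delta> n x"
  by (simp add: bump_def flat_def power_strict_mono not_le)

subsection \<open>Convolution with a smooth kernel of compact support\<close>

text \<open>Convolution, with the argument of the kernel \<open>g\<close> shifted so that derivatives act on \<open>g\<close>.\<close>

definition smear :: "('a::euclidean_space \<Rightarrow> real) \<Rightarrow> ('a \<Rightarrow> real) \<Rightarrow> 'a \<Rightarrow> real" where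
  "smear \<phi> g x = (\<integral>y. \<phi> y * g (x - y) \<partial>lborel)"

lemma integrable_compact_support:
  fixes f :: "'a::euclidean_space \<Rightarrow> 'b::{banach, second_countable_topology}"
  assumes "continuous_on UNIV f" "compact S" "\<And>y. y \<notin> S \<Longrightarrow> f y = 0"
  shows "integrable lborel f"
proof -
  have "integrable lborel (\<lambda>x. indicator S x *\<^sub>R f x)"
    using assms by (intro borel_integrable_compact continuous_on_subset[OF assms(1)]) auto
  moreover have "(\<lambda>x. indicator S x *\<^sub>R f x) = f" using assms(3) by (auto simp: indicator_def)
  ultimately show ?thesis by simp
qed

lemma norm_integral_le_integral:
  fixes f :: "'a \<Rightarrow> 'b::{banach, second_countable_topology}"
  assumes "integrable M f" "integrable M g" "\<And>x. norm (f x) \<le> g x"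
  shows "norm (integral\<^sup>L M f) \<le> integral\<^sup>L M g"
  by (rule order_trans[OF integral_norm_bound integral_mono]) (use assms in auto)

lemma smear_integrable:
  fixes \<phi> g :: "'a::euclidean_space \<Rightarrow> real"
  assumes "continuous_on UNIV \<phi>" "continuous_on UNIV g" "\<And>x. \<rho> < norm x \<Longrightarrow> g x = 0"
  shows "integrable lborel (\<lambda>y. \<phi> y * g (x - y))"
proof (rule integrable_compact_support)
  show "continuous_on UNIV (\<lambda>y. \<phi> y * g (x - y))"
    using assms by (intro continuous_intros continuous_on_compose2[OF assms(2)]) auto
  show "compact (cball x \<rho>)" by simp
  show "\<phi> y * g (x - y) = 0" if "y \<notin> cball x \<rho>" for y
    using that assms(3)[of "x - y"] by (auto simp: dist_norm)
qed

lemma directional_eq_sum: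
  fixes g :: "'a::euclidean_space \<Rightarrow> real"
  assumes "(g has_derivative D) (at x)"
  shows "D v = (\<Sum>b\<in>Basis. inner v b * D b)"
proof -
  have "linear D" using assms has_derivative_linear by blast
  then have "D (\<Sum>b\<in>Basis. inner v b *\<^sub>R b) = (\<Sum>b\<in>Basis. inner v b * D b)"
    by (simp add: linear_sum linear_scale)
  then show ?thesis by (simp add: euclidean_representation)
qed

lemma derivative_support:
  assumes "\<And>x. \<rho> < norm x \<Longrightarrow> g x = (0::real)" "\<rho> < norm x"
  shows "frechet_derivative g (at x) v = 0"
proof -
  have "((\<lambda>_. 0) has_derivative (\<lambda>_. 0)) (at x)" by simp
  then have "(g has_derivative (\<lambda>_. 0)) (at x)"
  proof (rule has_derivative_transform_within_open[of _ _ _ UNIV "{x. \<rho> < norm x}"])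
    show "open {x::'a. \<rho> < norm x}" by (intro open_Collect_less continuous_intros)
  qed (use assms in auto)
  then show ?thesis using frechet_derivative_at by metis
qed

lemma compact_support_Lipschitz:
  fixes g :: "'a::euclidean_space \<Rightarrow> real"
  assumes g: "C_infinity g" and supp: "\<And>x. \<rho> < norm x \<Longrightarrow> g x = 0"
  obtains M where "0 \<le> M" "\<And>x y. \<bar>g x - g y\<bar> \<le> M * norm (x - y)"
proof -
  have "\<exists>M. \<forall>x. \<bar>frechet_derivative g (at x) b\<bar> \<le> M" for b
  proof -
    have c: "continuous_on UNIV (\<lambda>x. frechet_derivative g (at x) b)"
      by (rule C_infinity_continuous[OF C_infinity_directional[OF g]])
    have "bounded ((\<lambda>x. frechet_derivative g (at x) b) ` cball 0 \<rho>)"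
      by (intro compact_imp_bounded compact_continuous_image continuous_on_subset[OF c]) auto
    then obtain M where "\<forall>x\<in>cball 0 \<rho>. \<bar>frechet_derivative g (at x) b\<bar> \<le> M"
      unfolding bounded_iff by auto
    then have "\<bar>frechet_derivative g (at x) b\<bar> \<le> max M 0" for x
      using derivative_support[of \<rho> g x b, OF supp] by (cases "norm x \<le> \<rho>") (fastforce simp: le_max_iff_disj)+
    then show ?thesis by blast
  qed
  then obtain m where m: "\<And>b x. \<bar>frechet_derivative g (at x) b\<bar> \<le> m b" by metis
  have m0: "0 \<le> m b" for b using m[of 0 b] by linarith
  define M where "M = (\<Sum>b\<in>(Basis::'a set). m b)"
  have "onorm (frechet_derivative g (at x)) \<le> M" for x
  proof (rule onorm_le)
    fix v :: 'a
    have "\<bar>frechet_derivative g (at x) v\<bar> \<le> (\<Sum>b\<in>Basis. \<bar>inner v b * frechet_derivative g (at x) b\<bar>)"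
      unfolding directional_eq_sum[OF C_infinity_has_derivative[OF g], of x v] by (rule sum_abs)
    also have "\<dots> \<le> (\<Sum>b\<in>Basis. norm v * m b)"
      using m Basis_le_norm by (intro sum_mono) (auto simp: abs_mult intro!: mult_mono)
    also have "\<dots> = M * norm v" by (simp add: M_def sum_distrib_left mult.commute)
    finally show "norm (frechet_derivative g (at x) v) \<le> M * norm v" by simp
  qed
  then have "\<bar>g x - g y\<bar> \<le> M * norm (x - y)" for x y
    using differentiable_bound[of UNIV g "\<lambda>x. frechet_derivative g (at x)" M x y] C_infinity_has_derivative[OF g] by auto
  moreover have "0 \<le> M" unfolding M_def using m0 by (intro sum_nonneg)
  ultimately show ?thesis using that by blast
qed

lemma compact_support_Taylor:
  fixes g :: "'a::euclidean_space \<Rightarrow> real"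
  assumes g: "C_infinity g" and supp: "\<And>x. \<rho> < norm x \<Longrightarrow> g x = 0"
  obtains M where "0 \<le> M" "\<And>x v. \<bar>g (x + v) - g x - frechet_derivative g (at x) v\<bar> \<le> M * (norm v)\<^sup>2"
proof -
  have "\<exists>M. 0 \<le> M \<and> (\<forall>x y. \<bar>frechet_derivative g (at x) b - frechet_derivative g (at y) b\<bar> \<le> M * norm (x - y))" for b
    using compact_support_Lipschitz[of "\<lambda>x. frechet_derivative g (at x) b" \<rho>, OF C_infinity_directional[OF g] derivative_support[of \<rho> g, OF supp]]
    by metis
  then obtain m where m: "\<And>b. 0 \<le> m b"
    "\<And>b x y. \<bar>frechet_derivative g (at x) b - frechet_derivative g (at y) b\<bar> \<le> m b * norm (x - y)" by metis
  define M where "M = (\<Sum>b\<in>(Basis::'a set). m b)"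
  have M0: "0 \<le> M" unfolding M_def using m by (intro sum_nonneg) auto
  have "\<bar>g (x + v) - g x - frechet_derivative g (at x) v\<bar> \<le> M * (norm v)\<^sup>2" for x v
  proof -
    have "onorm (\<lambda>w. frechet_derivative g (at y) w - frechet_derivative g (at x) w) \<le> M * norm v" if y: "y \<in> cball x (norm v)" for y
    proof (rule onorm_le)
      fix w :: 'a
      have "\<bar>frechet_derivative g (at y) w - frechet_derivative g (at x) w\<bar>
        = \<bar>\<Sum>b\<in>Basis. inner w b * (frechet_derivative g (at y) b - frechet_derivative g (at x) b)\<bar>"
        unfolding directional_eq_sum[OF C_infinity_has_derivative[OF g], of _ w]
        by (simp add: right_diff_distrib sum_subtractf)
      also have "\<dots> \<le> (\<Sum>b\<in>Basis. \<bar>inner w b * (frechet_derivative g (at y) b - frechet_derivative g (at x) b)\<bar>)"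
        by (rule sum_abs)
      also have "\<dots> \<le> (\<Sum>b\<in>Basis. norm w * (m b * norm v))"
      proof (intro sum_mono)
        fix b :: 'a assume b: "b \<in> Basis"
        have "\<bar>frechet_derivative g (at y) b - frechet_derivative g (at x) b\<bar> \<le> m b * norm v"
          using m(2)[of y b x] y m(1)[of b] by (smt (verit) dist_norm dist_commute mem_cball mult_left_mono)
        then show "\<bar>inner w b * (frechet_derivative g (at y) b - frechet_derivative g (at x) b)\<bar> \<le> norm w * (m b * norm v)"
          using Basis_le_norm[OF b, of w] by (auto simp: abs_mult intro!: mult_mono)
      qed
      also have "\<dots> = M * norm v * norm w" by (simp add: M_def sum_distrib_left sum_distrib_right algebra_simps)
      finally show "norm (frechet_derivative g (at y) w - frechet_derivative g (at x) w) \<le> M * norm v * norm w" by simp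
    qed
    then have "norm (g (x + v) - g x - frechet_derivative g (at x) (x + v - x)) \<le> norm (x + v - x) * (M * norm v)"
      by (intro differentiable_bound_linearization[where S="cball x (norm v)"])
        (auto intro!: has_derivative_at_withinI[OF C_infinity_has_derivative[OF g]] simp: dist_norm mult_left_le_one_le fun_diff_def)
    then show ?thesis by (simp add: power2_eq_square algebra_simps)
  qed
  then show ?thesis using that M0 by blast
qed

text \<open>The derivative falls on the smooth factor \<open>g\<close>; \<open>\<phi>\<close> need only be continuous. The second-order
  Taylor remainder of \<open>g\<close> is bounded uniformly, by compact support, and can be integrated against \<open>\<phi>\<close>.\<close>

lemma smear_has_derivative:
  fixes \<phi> g :: "'a::euclidean_space \<Rightarrow> real"
  assumes \<phi>: "continuous_on UNIV \<phi>" and g: "C_infinity g" and supp: "\<And>x. \<rho> < norm x \<Longrightarrow> g x = 0"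
  shows "(smear \<phi> g has_derivative (\<lambda>v. smear \<phi> (\<lambda>x. frechet_derivative g (at x) v) x)) (at x)"
proof -
  let ?D = "\<lambda>x. frechet_derivative g (at x)"
  obtain M where M: "0 \<le> M" "\<And>x v. \<bar>g (x + v) - g x - ?D x v\<bar> \<le> M * (norm v)\<^sup>2"
    using compact_support_Taylor[OF g supp] by blast
  have int: "integrable lborel (\<lambda>y. \<phi> y * g (x - y))" for x
    by (rule smear_integrable[OF \<phi> C_infinity_continuous[OF g] supp])
  have intD: "integrable lborel (\<lambda>y. \<phi> y * ?D (x - y) v)" for x v
    by (rule smear_integrable[OF \<phi> C_infinity_continuous[OF C_infinity_directional[OF g]]])
      (rule derivative_support[of \<rho> g, OF supp])
  have lin: "linear (?D y)" for y using C_infinity_has_derivative[OF g] has_derivative_linear by blast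
  define I where "I = (\<integral>y. indicator (cball x (\<rho> + 1)) y *\<^sub>R \<bar>\<phi> y\<bar> \<partial>lborel)"
  have intI: "integrable lborel (\<lambda>y. indicator (cball x (\<rho> + 1)) y *\<^sub>R \<bar>\<phi> y\<bar>)"
    by (intro borel_integrable_compact continuous_on_subset[OF \<phi>] continuous_intros) auto
  have bl: "bounded_linear (\<lambda>v. smear \<phi> (\<lambda>x. ?D x v) x)"
    unfolding linear_conv_bounded_linear[symmetric]
    by (rule linearI) (simp_all add: smear_def linear_add[OF lin] linear_scale[OF lin] distrib_left
        intD Bochner_Integration.integral_add mult.left_commute)
  have est: "\<bar>smear \<phi> g (x + v) - smear \<phi> g x - smear \<phi> (\<lambda>x. ?D x v) x\<bar> \<le> M * I * (norm v)\<^sup>2" if v: "norm v \<le> 1" for v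
  proof -
    have "smear \<phi> g (x + v) - smear \<phi> g x - smear \<phi> (\<lambda>x. ?D x v) x
       = (\<integral>y. \<phi> y * g (x + v - y) - \<phi> y * g (x - y) - \<phi> y * ?D (x - y) v \<partial>lborel)"
      unfolding smear_def using int intD by (simp add: Bochner_Integration.integral_diff)
    also have "norm \<dots> \<le> (\<integral>y. M * (norm v)\<^sup>2 * (indicator (cball x (\<rho> + 1)) y *\<^sub>R \<bar>\<phi> y\<bar>) \<partial>lborel)"
    proof (rule norm_integral_le_integral)
      show "integrable lborel (\<lambda>y. \<phi> y * g (x + v - y) - \<phi> y * g (x - y) - \<phi> y * ?D (x - y) v)"
        by (intro Bochner_Integration.integrable_diff int intD)
      show "integrable lborel (\<lambda>y. M * (norm v)\<^sup>2 * (indicator (cball x (\<rho> + 1)) y *\<^sub>R \<bar>\<phi> y\<bar>))"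
        by (intro integrable_mult_right intI)
      fix y
      show "norm (\<phi> y * g (x + v - y) - \<phi> y * g (x - y) - \<phi> y * ?D (x - y) v)
          \<le> M * (norm v)\<^sup>2 * (indicator (cball x (\<rho> + 1)) y *\<^sub>R \<bar>\<phi> y\<bar>)"
      proof (cases "y \<in> cball x (\<rho> + 1)")
        case True
        have "\<phi> y * g (x + v - y) - \<phi> y * g (x - y) - \<phi> y * ?D (x - y) v
          = \<phi> y * (g ((x - y) + v) - g (x - y) - ?D (x - y) v)" by (simp add: algebra_simps)
        also have "\<bar>\<dots>\<bar> \<le> \<bar>\<phi> y\<bar> * (M * (norm v)\<^sup>2)"
          unfolding abs_mult by (intro mult_left_mono M) auto
        finally show ?thesis using True by (simp add: mult_ac)
      next
        case False
        then have far: "\<rho> + 1 < norm (x - y)" by (simp add: dist_norm)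
        have "norm (x - y) \<le> norm (x + v - y) + norm v" using norm_triangle_ineq4[of "x + v - y" v] by (simp add: algebra_simps)
        then have "\<rho> < norm (x + v - y)" using far v by linarith
        then have "g (x + v - y) = 0" by (rule supp)
        moreover have "g (x - y) = 0" "?D (x - y) v = 0" using far derivative_support[of \<rho> g, OF supp] supp by auto
        ultimately show ?thesis using False by simp
      qed
    qed
    also have "\<dots> = M * I * (norm v)\<^sup>2" by (simp add: I_def)
    finally show ?thesis by simp
  qed
  show ?thesis
  proof (rule has_derivativeI_sandwich[where e=1 and H="\<lambda>y. M * I * norm (y - x)"])
    show "bounded_linear (\<lambda>v. smear \<phi> (\<lambda>x. ?D x v) x)" by (rule bl)
    show "((\<lambda>y. M * I * norm (y - x)) \<longlongrightarrow> 0) (at x)"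
      by (rule tendsto_eq_rhs, (rule tendsto_intros)+) simp
    fix y assume y: "y \<noteq> x" "dist y x < 1"
    then have "\<bar>smear \<phi> g (x + (y - x)) - smear \<phi> g x - smear \<phi> (\<lambda>a. ?D a (y - x)) x\<bar> \<le> M * I * (norm (y - x))\<^sup>2"
      using est[of "y - x"] by (simp add: dist_norm)
    then show "norm (smear \<phi> g y - smear \<phi> g x - smear \<phi> (\<lambda>a. ?D a (y - x)) x) / norm (y - x) \<le> M * I * norm (y - x)"
      using y by (simp add: field_simps power2_eq_square)
  qed simp
qed

lemma C_infinity_smear:
  fixes \<phi> g :: "'a::euclidean_space \<Rightarrow> real"
  assumes \<phi>: "continuous_on UNIV \<phi>" and g: "C_infinity g" and supp: "\<And>x. \<rho> < norm x \<Longrightarrow> g x = 0"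
  shows "C_infinity (smear \<phi> g)"
proof -
  have "Ck_differentiable k (smear \<phi> g)" if "C_infinity g" "\<And>x. \<rho> < norm x \<Longrightarrow> g x = 0" for k g
    using that
  proof (induction k arbitrary: g)
    case 0
    show ?case using has_derivative_continuous[OF smear_has_derivative[OF \<phi> 0(1) 0(2)]]
      by (auto simp: continuous_on_eq_continuous_at)
  next
    case (Suc k)
    show ?case
      by (rule Ck_differentiableI[OF smear_has_derivative[OF \<phi> Suc.prems(1) Suc.prems(2)]])
        (auto intro!: Suc.IH C_infinity_directional[OF Suc.prems(1)] derivative_support[of \<rho> g, OF Suc.prems(2)])
  qed
  then show ?thesis using g supp by (simp add: C_infinity_def)
qed

section \<open>Smoothed projection potentials\<close>

text \<open>This is \<open>\<bar>x\<bar>\<^sup>2 / 2 - dist (x, S)\<^sup>2 / 2\<close>, the conjugate of \<open>\<bar>y\<bar>\<^sup>2 / 2\<close> restricted to \<open>S\<close>. For closed convex \<open>S\<close> it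
  is convex and its gradient is the projection to \<open>S\<close>.\<close>

definition proj_potential :: "'a::euclidean_space set \<Rightarrow> 'a \<Rightarrow> real" where
  "proj_potential S x = inner x (closest_point S x) - (norm (closest_point S x))\<^sup>2 / 2"

text \<open>The value at \<open>x\<close> is the supremum of \<open>\<langle>x, y\<rangle> - \<bar>y\<bar>\<^sup>2 / 2\<close> over \<open>y \<in> S\<close>, attained at the nearest point.\<close>

lemma proj_potential_ge:
  assumes "closed S" "y \<in> S"
  shows "inner x y - (norm y)\<^sup>2 / 2 \<le> proj_potential S x"
proof -
  have "(dist x (closest_point S x))\<^sup>2 \<le> (dist x y)\<^sup>2"
    using closest_point_le[OF assms] by (intro power_mono) auto
  then show ?thesis
    by (simp add: proj_potential_def dist_norm power2_norm_eq_inner inner_diff inner_commute)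
qed

text \<open>Using the projection of one point as a competitor in the supremum for the other traps the remainder
  between \<open>0\<close> and \<open>\<langle>v, P (x + v) - P x\<rangle>\<close>, and the projection \<open>P\<close> is nonexpansive.\<close>

lemma proj_potential_Taylor:
  assumes S: "convex S" "closed S" "S \<noteq> {}"
  shows "\<bar>proj_potential S (x + v) - proj_potential S x - inner v (closest_point S x)\<bar> \<le> (norm v)\<^sup>2"
proof -
  let ?P = "closest_point S"
  have 1: "inner (x + v) (?P x) - (norm (?P x))\<^sup>2 / 2 \<le> proj_potential S (x + v)"
    by (intro proj_potential_ge S closest_point_in_set)
  have 2: "inner x (?P (x + v)) - (norm (?P (x + v)))\<^sup>2 / 2 \<le> proj_potential S x"
    by (intro proj_potential_ge S closest_point_in_set)
  have "proj_potential S (x + v) - proj_potential S x - inner v (?P x) \<le> inner v (?P (x + v) - ?P x)"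
    using 2 by (simp add: proj_potential_def inner_diff inner_add_left)
  also have "\<dots> \<le> norm v * norm (?P (x + v) - ?P x)" by (rule norm_cauchy_schwarz)
  also have "\<dots> \<le> norm v * norm v"
    using closest_point_lipschitz[OF S, of "x + v" x] by (intro mult_left_mono) (auto simp: dist_norm)
  finally show ?thesis using 1
    by (simp add: proj_potential_def inner_add_left power2_eq_square)
qed

lemma closest_point_monotone:
  assumes S: "convex S" "closed S" "S \<noteq> {}"
  shows "0 \<le> inner (closest_point S x - closest_point S y) (x - y)"
proof -
  let ?P = "closest_point S"
  have "inner (x - ?P x) (?P y - ?P x) \<le> 0" "inner (y - ?P y) (?P x - ?P y) \<le> 0"
    by (intro closest_point_dot S closest_point_in_set)+
  moreover have "0 \<le> inner (?P x - ?P y) (?P x - ?P y)" by simp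
  ultimately show ?thesis by (simp add: inner_diff inner_commute algebra_simps)
qed

lemma has_derivative_quadratic_remainder:
  fixes f :: "'a::real_inner \<Rightarrow> real"
  assumes "\<And>v. \<bar>f (x + v) - f x - inner v g\<bar> \<le> C * (norm v)\<^sup>2"
  shows "(f has_derivative (\<lambda>v. inner v g)) (at x)"
proof (rule has_derivativeI_sandwich[where e=1 and H="\<lambda>y. C * norm (y - x)"])
  show "((\<lambda>y. C * norm (y - x)) \<longlongrightarrow> 0) (at x)"
    by (rule tendsto_eq_rhs, (rule tendsto_intros)+) simp
  fix y assume "y \<noteq> x"
  then show "norm (f y - f x - inner (y - x) g) / norm (y - x) \<le> C * norm (y - x)"
    using assms[of "y - x"] by (simp add: field_simps power2_eq_square)
qed (auto intro: bounded_linear_inner_left)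

lemma lborel_reflect: "(lborel :: 'a::euclidean_space measure) = distr lborel borel (\<lambda>y. x - y)"
  using lborel_affine[of "-1" x] by (simp add: density_1)

text \<open>Averaging over translations by less than \<open>\<delta>\<close> makes the projection potential smooth. It preserves that
  the gradient is monotone, nonexpansive in the sense of \<open>\<langle>G x - G y, x - y\<rangle> \<le> \<bar>x - y\<bar>\<^sup>2\<close> and bounded by
  the size of \<open>S\<close>; and where the projection is constant on a ball of radius \<open>\<delta>\<close>, the gradient at the
  centre still has that exact value. This last property is what keeps the cycle exact.\<close>

lemma smooth_projection_potential:
  fixes S :: "'a::euclidean_space set"
  assumes S: "convex S" "closed S" "S \<noteq> {}" and \<delta>: "0 < \<delta>" and B: "\<And>y. y \<in> S \<Longrightarrow> norm y \<le> B"
  obtains \<Phi> G where "C_infinity \<Phi>" "\<And>x. GDERIV \<Phi> x :> G x" "\<And>x. norm (G x) \<le> B"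
    "\<And>x y. 0 \<le> inner (G x - G y) (x - y)" "\<And>x y. inner (G x - G y) (x - y) \<le> (norm (x - y))\<^sup>2"
    "\<And>x p. (\<And>y. norm (y - x) \<le> \<delta> \<Longrightarrow> closest_point S y = p) \<Longrightarrow> G x = p"
proof -
  let ?P = "closest_point S"
  define Z where "Z = (\<integral>y. bump \<delta> 0 (y::'a) \<partial>lborel)"
  have cb: "continuous_on UNIV (bump \<delta> 0 :: 'a \<Rightarrow> real)" by (rule C_infinity_continuous[OF C_infinity_bump])
  have ib: "integrable lborel (bump \<delta> 0 :: 'a \<Rightarrow> real)"
    by (rule integrable_compact_support[OF cb compact_cball[of 0 \<delta>]]) (auto intro!: bump_eq_0 \<delta>)
  have "Z \<noteq> 0"
  proof
    assume "Z = 0"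
    then have "AE y in lborel. bump \<delta> 0 (y::'a) = 0"
      unfolding Z_def using ib by (subst (asm) integral_nonneg_eq_0_iff_AE) (auto simp: bump_nonneg)
    then have "AE y in lborel. (y::'a) \<notin> ball 0 \<delta>"
      by eventually_elim (auto simp: dist_norm dest!: bump_pos[of _ \<delta> 0])
    then have "emeasure lborel (ball (0::'a) \<delta>) = 0"
      by (subst (asm) AE_iff_measurable[where N="ball 0 \<delta>"]) auto
    then show False using \<delta> content_ball_pos[of \<delta> "0::'a"]
      by (simp add: measure_def)
  qed
  moreover have "0 \<le> Z" unfolding Z_def by (intro integral_nonneg_AE) (auto simp: bump_nonneg)
  ultimately have Z: "0 < Z" by simp
  define k :: "'a \<Rightarrow> real" where "k = (\<lambda>x. 1 / Z * bump \<delta> 0 x)"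
  have k: "C_infinity k"
    using C_infinity_bump[of \<delta> 0, where 'a='a] unfolding C_infinity_def k_def
    by (intro allI Ck_differentiable_mult Ck_differentiable_const) blast
  have k0: "0 \<le> k x" for x using Z by (simp add: k_def bump_nonneg)
  have ksupp: "k x = 0" if "\<delta> \<le> norm x" for x using bump_eq_0[OF \<delta> that] by (simp add: k_def)
  have ck: "continuous_on UNIV k" by (rule C_infinity_continuous[OF k])
  have ik: "integrable lborel k" using ib by (simp add: k_def)
  have k1: "integral\<^sup>L lborel k = 1" using Z by (simp add: k_def Z_def[symmetric])
  have cP: "continuous_on UNIV ?P" by (rule continuous_on_closest_point[OF S])
  have c\<phi>: "continuous_on UNIV (proj_potential S)"
    unfolding proj_potential_def by (intro continuous_intros cP) auto
  define \<Phi> where "\<Phi> = smear (proj_potential S) k"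
  define G where "G = (\<lambda>x. \<integral>y. k y *\<^sub>R ?P (x - y) \<partial>lborel)"
  have \<Phi>_alt: "\<Phi> x = (\<integral>y. k y * proj_potential S (x - y) \<partial>lborel)" for x
  proof -
    have m: "(\<lambda>y. k y * proj_potential S (x - y)) \<in> borel_measurable borel"
      by (intro borel_measurable_continuous_onI continuous_intros ck continuous_on_compose2[OF c\<phi>]) auto
    have "(\<integral>y. k y * proj_potential S (x - y) \<partial>lborel)
      = (\<integral>y. k y * proj_potential S (x - y) \<partial>(distr lborel borel (\<lambda>y. x - y)))"
      by (subst lborel_reflect[of x]) simp
    also have "\<dots> = (\<integral>y. k (x - y) * proj_potential S (x - (x - y)) \<partial>lborel)"
      by (rule integral_distr) (use m in auto)
    finally show ?thesis by (simp add: \<Phi>_def smear_def mult.commute)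
  qed
  have i\<phi>: "integrable lborel (\<lambda>y. k y * proj_potential S (x - y))" for x
    by (rule integrable_compact_support[OF _ compact_cball[of 0 \<delta>]])
      (auto intro!: continuous_intros ck continuous_on_compose2[OF c\<phi>] simp: ksupp)
  have iG: "integrable lborel (\<lambda>y. k y *\<^sub>R ?P (x - y))" for x
    by (rule integrable_compact_support[OF _ compact_cball[of 0 \<delta>]])
      (auto intro!: continuous_intros ck continuous_on_compose2[OF cP] simp: ksupp)
  have inner_G: "inner v (G x) = (\<integral>y. k y * inner v (?P (x - y)) \<partial>lborel)" for v x
    unfolding G_def using iG by (subst integral_inner_right[symmetric]) auto
  have ivG: "integrable lborel (\<lambda>y. k y * inner v (?P (x - y)))" for v x
    using integrable_inner_right[of v lborel "\<lambda>y. k y *\<^sub>R ?P (x - y)"] iG by simp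
  show ?thesis
  proof (rule that[of \<Phi> G])
    show "C_infinity \<Phi>" unfolding \<Phi>_def by (rule C_infinity_smear[OF c\<phi> k, of \<delta>]) (simp add: ksupp)
    show "GDERIV \<Phi> x :> G x" for x unfolding gderiv_def
    proof (rule has_derivative_quadratic_remainder[where C=1])
      fix v
      have "\<Phi> (x + v) - \<Phi> x - inner v (G x)
        = (\<integral>y. k y * proj_potential S (x + v - y) - k y * proj_potential S (x - y) - k y * inner v (?P (x - y)) \<partial>lborel)"
        unfolding \<Phi>_alt inner_G using i\<phi> ivG by (simp add: Bochner_Integration.integral_diff)
      also have "norm \<dots> \<le> (\<integral>y. (norm v)\<^sup>2 * k y \<partial>lborel)"
      proof (rule norm_integral_le_integral)
        fix y
        have "k y * proj_potential S (x + v - y) - k y * proj_potential S (x - y) - k y * inner v (?P (x - y))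
          = k y * (proj_potential S ((x - y) + v) - proj_potential S (x - y) - inner v (?P (x - y)))"
          by (simp add: algebra_simps)
        also have "norm \<dots> \<le> k y * (norm v)\<^sup>2"
          using proj_potential_Taylor[OF S, of "x - y" v] k0[of y] by (simp add: abs_mult mult_left_mono)
        finally show "norm (k y * proj_potential S (x + v - y) - k y * proj_potential S (x - y) - k y * inner v (?P (x - y)))
          \<le> (norm v)\<^sup>2 * k y" by (simp add: mult.commute)
      qed (use i\<phi> ivG ik in auto)
      also have "\<dots> = (norm v)\<^sup>2" using k1 by simp
      finally show "\<bar>\<Phi> (x + v) - \<Phi> x - inner v (G x)\<bar> \<le> 1 * (norm v)\<^sup>2" by simp
    qed
    show "norm (G x) \<le> B" for x
    proof -
      have "norm (G x) \<le> (\<integral>y. B * k y \<partial>lborel)" unfolding G_def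
      proof (rule norm_integral_le_integral[OF iG])
        fix y
        have "norm (?P (x - y)) \<le> B" by (intro B closest_point_in_set S)
        then show "norm (k y *\<^sub>R ?P (x - y)) \<le> B * k y" using k0[of y] by (metis abs_of_nonneg mult.commute mult_left_mono norm_scaleR real_norm_def)
      qed (use ik in simp)
      then show ?thesis using k1 by simp
    qed
    have diff: "inner (G x - G y) (x - y) = (\<integral>z. k z * inner (x - y) (?P (x - z) - ?P (y - z)) \<partial>lborel)"
      and idiff: "integrable lborel (\<lambda>z. k z * inner (x - y) (?P (x - z) - ?P (y - z)))" for x y
    proof -
      have "inner (G x - G y) (x - y) = inner (x - y) (G x) - inner (x - y) (G y)"
        by (simp add: inner_commute inner_diff_right)
      then show "inner (G x - G y) (x - y) = (\<integral>z. k z * inner (x - y) (?P (x - z) - ?P (y - z)) \<partial>lborel)"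
        unfolding inner_G inner_diff_right[of "x - y"] right_diff_distrib using ivG by (simp add: Bochner_Integration.integral_diff)
      show "integrable lborel (\<lambda>z. k z * inner (x - y) (?P (x - z) - ?P (y - z)))"
        unfolding inner_diff_right[of "x - y"] right_diff_distrib using ivG by simp
    qed
    show "0 \<le> inner (G x - G y) (x - y)" for x y
      unfolding diff using k0 closest_point_monotone[OF S, of "x - z" "y - z" for z]
      by (intro integral_nonneg_AE) (auto simp: inner_commute)
    show "inner (G x - G y) (x - y) \<le> (norm (x - y))\<^sup>2" for x y
    proof -
      have "inner (G x - G y) (x - y) \<le> (\<integral>z. (norm (x - y))\<^sup>2 * k z \<partial>lborel)" unfolding diff
      proof (rule integral_mono[OF idiff])
        fix z
        have "inner (x - y) (?P (x - z) - ?P (y - z)) \<le> norm (x - y) * norm (?P (x - z) - ?P (y - z))"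
          by (rule norm_cauchy_schwarz)
        also have "\<dots> \<le> norm (x - y) * norm (x - y)"
          using closest_point_lipschitz[OF S, of "x - z" "y - z"] by (intro mult_left_mono) (auto simp: dist_norm)
        finally have "inner (x - y) (?P (x - z) - ?P (y - z)) \<le> (norm (x - y))\<^sup>2" by (simp add: power2_eq_square)
        then show "k z * inner (x - y) (?P (x - z) - ?P (y - z)) \<le> (norm (x - y))\<^sup>2 * k z"
          using mult_right_mono[OF _ k0[of z]] by (simp add: mult.commute[of "k z"])
      qed (use ik in simp)
      then show ?thesis using k1 by simp
    qed
    show "G x = p" if *: "\<And>y. norm (y - x) \<le> \<delta> \<Longrightarrow> ?P y = p" for x p
    proof -
      have "k y *\<^sub>R ?P (x - y) = k y *\<^sub>R p" for y
        using *[of "x - y"] ksupp[of y] by (cases "norm y \<le> \<delta>") auto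
      then have "G x = (\<integral>y. k y *\<^sub>R p \<partial>lborel)" unfolding G_def by (intro Bochner_Integration.integral_cong refl)
      also have "\<dots> = p" using k1 ik by simp
      finally show ?thesis .
    qed
  qed
qed

section \<open>Potentials with monotone gradient and their dilations\<close>

lemma gradient_eqI: "GDERIV U x :> D \<Longrightarrow> gradient U x = D"
  unfolding gradient_def
proof (rule the_equality)
  fix D' assume "GDERIV U x :> D" "GDERIV U x :> D'"
  then have "(\<lambda>h. inner h D) = (\<lambda>h. inner h D')" unfolding gderiv_def by (rule has_derivative_unique)
  then show "D' = D" by (metis vector_eq_ldot)
qed

text \<open>The Hessian form \<open>\<langle>H v, v\<rangle>\<close> is the limit of \<open>\<langle>g (x + t v) - g x, t v\<rangle> / t\<^sup>2\<close>, so bounds on difference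
  quotients of the gradient pass to the Hessian.\<close>

lemma potentialsI:
  fixes U :: "'a::euclidean_space \<Rightarrow> real"
  assumes U: "C_infinity U" and g: "\<And>x. GDERIV U x :> g x"
    and lo: "\<And>x y. (norm (x - y))\<^sup>2 \<le> inner (g x - g y) (x - y)"
    and hi: "\<And>x y. inner (g x - g y) (x - y) \<le> \<kappa> * (norm (x - y))\<^sup>2"
  shows "U \<in> potentials \<kappa>"
proof -
  have grad: "gradient U = g" using gradient_eqI[OF g] by auto
  have "g differentiable (at x)" for x
  proof -
    have "(\<lambda>x. inner (g x) b) differentiable (at x)" for b
    proof -
      have "C_infinity (\<lambda>x. frechet_derivative U (at x) b)" by (rule C_infinity_directional[OF U])
      moreover have "frechet_derivative U (at x) b = inner (g x) b" for x
        using frechet_derivative_at[OF g[of x, unfolded gderiv_def]] by (metis inner_commute)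
      ultimately have "C_infinity (\<lambda>x. inner (g x) b)" by simp
      from C_infinity_has_derivative[OF this] show ?thesis by (rule differentiableI)
    qed
    then show ?thesis by (subst differentiable_componentwise_within) auto
  qed
  then have H: "(g has_derivative hessian U x) (at x)" for x
    unfolding hessian_def grad by (simp add: frechet_derivative_works)
  have lim: "((\<lambda>t. inner (g (x + t *\<^sub>R v) - g x) (t *\<^sub>R v) / t\<^sup>2) \<longlongrightarrow> inner (hessian U x v) v) (at_right 0)" for x v
  proof -
    have "((\<lambda>t. g (x + t *\<^sub>R v)) has_derivative (\<lambda>t. hessian U x (t *\<^sub>R v))) (at 0)"
      by (rule has_derivative_compose[where g=g, of "\<lambda>t. x + t *\<^sub>R v" "\<lambda>t. t *\<^sub>R v"])
        (auto intro!: derivative_eq_intros H)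
    moreover have "(\<lambda>t. hessian U x (t *\<^sub>R v)) = (\<lambda>t. t *\<^sub>R hessian U x v)"
      using has_derivative_linear[OF H] by (simp add: linear_scale)
    ultimately have "((\<lambda>t. inner (g (x + t *\<^sub>R v)) v) has_derivative (\<lambda>t. inner (t *\<^sub>R hessian U x v) v)) (at 0)"
      by (metis bounded_linear.has_derivative[OF bounded_linear_inner_left])
    then have "DERIV (\<lambda>t. inner (g (x + t *\<^sub>R v)) v) 0 :> inner (hessian U x v) v"
      unfolding has_field_derivative_def by (rule has_derivative_eq_rhs) (auto simp: mult.commute)
    then have "((\<lambda>t. (inner (g (x + t *\<^sub>R v)) v - inner (g x) v) / t) \<longlongrightarrow> inner (hessian U x v) v) (at_right 0)"
      by (simp add: DERIV_def filterlim_at_split)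
    moreover have "eventually (\<lambda>t. (inner (g (x + t *\<^sub>R v)) v - inner (g x) v) / t
        = inner (g (x + t *\<^sub>R v) - g x) (t *\<^sub>R v) / t\<^sup>2) (at_right 0)"
      by (rule eventually_at_right_less[THEN eventually_mono]) (simp add: power2_eq_square inner_diff)
    ultimately show ?thesis by (rule Lim_transform_eventually)
  qed
  have n: "(norm (t *\<^sub>R v))\<^sup>2 / t\<^sup>2 = (norm v)\<^sup>2" if "t \<noteq> 0" for t and v :: 'a using that by (simp add: power_mult_distrib)
  have "inner v v \<le> inner (hessian U x v) v" for x v
  proof (rule tendsto_lowerbound[OF lim])
    have "inner v v \<le> inner (g (x + t *\<^sub>R v) - g x) (t *\<^sub>R v) / t\<^sup>2" if "0 < t" for t
      using divide_right_mono[OF lo[of "x + t *\<^sub>R v" x], of "t\<^sup>2"] n[of t v] that by (simp add: power2_norm_eq_inner)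
    then show "eventually (\<lambda>t. inner v v \<le> inner (g (x + t *\<^sub>R v) - g x) (t *\<^sub>R v) / t\<^sup>2) (at_right 0)"
      by (intro eventually_at_right_less[THEN eventually_mono])
  qed simp
  moreover have "inner (hessian U x v) v \<le> \<kappa> * inner v v" for x v
  proof (rule tendsto_upperbound[OF lim])
    have "inner (g (x + t *\<^sub>R v) - g x) (t *\<^sub>R v) / t\<^sup>2 \<le> \<kappa> * inner v v" if "0 < t" for t
      using divide_right_mono[OF hi[of "x + t *\<^sub>R v" x], of "t\<^sup>2"] n[of t v] that
      by (simp add: power2_norm_eq_inner del: times_divide_eq_right add: times_divide_eq_right[symmetric])
    then show "eventually (\<lambda>t. inner (g (x + t *\<^sub>R v) - g x) (t *\<^sub>R v) / t\<^sup>2 \<le> \<kappa> * inner v v) (at_right 0)"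
      by (intro eventually_at_right_less[THEN eventually_mono])
  qed simp
  ultimately show ?thesis using U by (simp add: potentials_def loewner_le_def)
qed

lemma dilated_gderiv:
  assumes "\<And>x. GDERIV U x :> g x" "R \<noteq> 0"
  shows "GDERIV (dilated_potential R U) x :> R *\<^sub>R g (x /\<^sub>R R)"
proof -
  have "((\<lambda>x. U (x /\<^sub>R R)) has_derivative (\<lambda>v. inner (v /\<^sub>R R) (g (x /\<^sub>R R)))) (at x)"
    by (rule has_derivative_compose[OF _ assms(1)[unfolded gderiv_def]]) (auto intro!: derivative_eq_intros)
  then have "((\<lambda>x. R\<^sup>2 * U (x /\<^sub>R R)) has_derivative (\<lambda>v. R\<^sup>2 * inner (v /\<^sub>R R) (g (x /\<^sub>R R)))) (at x)"
    by (rule has_derivative_mult_right)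
  moreover have "(\<lambda>v. R\<^sup>2 * inner (v /\<^sub>R R) (g (x /\<^sub>R R))) = (\<lambda>v. inner v (R *\<^sub>R g (x /\<^sub>R R)))"
    using assms(2) by (auto simp: power2_eq_square field_simps)
  ultimately show ?thesis by (simp add: gderiv_def dilated_potential_def[abs_def])
qed

lemma dilated_potentials:
  fixes U :: "'a::euclidean_space \<Rightarrow> real"
  assumes U: "C_infinity U" and g: "\<And>x. GDERIV U x :> g x"
    and lo: "\<And>x y. (norm (x - y))\<^sup>2 \<le> inner (g x - g y) (x - y)"
    and hi: "\<And>x y. inner (g x - g y) (x - y) \<le> \<kappa> * (norm (x - y))\<^sup>2"
    and R: "0 < R"
  shows "dilated_potential R U \<in> potentials \<kappa>"
proof (rule potentialsI)
  show "C_infinity (dilated_potential R U)"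
    using U unfolding C_infinity_def dilated_potential_def[abs_def]
    by (auto intro!: Ck_differentiable_mult Ck_differentiable_const Ck_differentiable_scale_arg)
  show "GDERIV (dilated_potential R U) x :> R *\<^sub>R g (x /\<^sub>R R)" for x using dilated_gderiv[OF g] R by simp
  fix x y :: 'a
  have xy: "x - y = R *\<^sub>R (x /\<^sub>R R - y /\<^sub>R R)" using R by (simp add: scaleR_diff_right)
  have e: "inner (R *\<^sub>R g (x /\<^sub>R R) - R *\<^sub>R g (y /\<^sub>R R)) (x - y) = R\<^sup>2 * inner (g (x /\<^sub>R R) - g (y /\<^sub>R R)) (x /\<^sub>R R - y /\<^sub>R R)"
    by (subst xy) (simp add: scaleR_diff_right[symmetric] power2_eq_square)
  have n: "(norm (x - y))\<^sup>2 = R\<^sup>2 * (norm (x /\<^sub>R R - y /\<^sub>R R))\<^sup>2"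
    by (subst xy) (simp add: power_mult_distrib)
  show "(norm (x - y))\<^sup>2 \<le> inner (R *\<^sub>R g (x /\<^sub>R R) - R *\<^sub>R g (y /\<^sub>R R)) (x - y)"
    unfolding e n by (intro mult_left_mono lo) simp
  show "inner (R *\<^sub>R g (x /\<^sub>R R) - R *\<^sub>R g (y /\<^sub>R R)) (x - y) \<le> \<kappa> * (norm (x - y))\<^sup>2"
    unfolding e n mult.left_commute[of \<kappa>] by (intro mult_left_mono hi) simp
qed

section \<open>Regeneration and drift\<close>

text \<open>Nummelin splitting. At \<open>z\<close> the chain regenerates with probability \<open>s z\<close>, that is, it draws its next
  state from the fixed density \<open>n\<close>; otherwise it moves by the defective density \<open>r\<close>. The occupation
  density of one excursion, \<open>p = n + n r + n r\<^sup>2 + \<dots>\<close>, has finite mass by the drift condition, and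
  mass balance gives \<open>\<integral> p s = 1\<close>, which makes \<open>p\<close> invariant; normalize it. Conversely, an
  invariant law \<open>\<pi>'\<close> with \<open>t = \<integral> s d\<pi>'\<close> dominates \<open>t p\<close>, by unrolling the invariance equation. Both
  sides have the same \<open>s\<close>-integral \<open>t\<close>, and \<open>s\<close> is positive everywhere, so they coincide.\<close>

lemma regeneration_invariant_law:
  fixes Q :: "'b::euclidean_space \<Rightarrow> 'b measure" and r :: "'b \<times> 'b \<Rightarrow> ennreal" and s n W :: "'b \<Rightarrow> ennreal"
  assumes Q: "Q \<in> measurable borel (subprob_algebra borel)" "\<And>z. prob_space (Q z)"
    and meas[measurable]: "r \<in> borel_measurable borel" "s \<in> borel_measurable borel"
      "n \<in> borel_measurable borel" "W \<in> borel_measurable borel"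
    and dens: "\<And>z A. A \<in> sets borel \<Longrightarrow> emeasure (Q z) A =
      (\<integral>\<^sup>+y. r (z, y) * indicator A y \<partial>lborel) + s z * (\<integral>\<^sup>+y. n y * indicator A y \<partial>lborel)"
    and n: "(\<integral>\<^sup>+y. n y \<partial>lborel) = 1" and s: "\<And>z. 0 < s z"
    and drift: "\<And>z. (\<integral>\<^sup>+y. r (z, y) * W y \<partial>lborel) + 1 \<le> W z"
    and fin: "(\<integral>\<^sup>+y. n y * W y \<partial>lborel) < \<infinity>"
  shows "\<exists>\<pi>. invariant_law Q \<pi> \<and> (\<forall>\<pi>'. invariant_law Q \<pi>' \<longrightarrow> \<pi>' = \<pi>)"
proof -
  have r2[measurable]: "r \<in> borel_measurable (borel \<Otimes>\<^sub>M borel)" using meas(1) by (simp add: borel_prod)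
  have setsQ[simp]: "sets (Q z) = sets borel" "space (Q z) = UNIV" for z
    using measurable_space[OF Q(1), of z] by (auto simp: space_subprob_algebra dest: sets_eq_imp_space_eq)
  have tot: "(\<integral>\<^sup>+y. r (z, y) \<partial>lborel) + s z = 1" for z
    using dens[of UNIV z] prob_space.emeasure_space_1[OF Q(2), of z] n by simp
  have s1: "s z \<le> 1" for z using tot[of z] by (metis add.commute le_iff_add)
  \<comment> \<open>\<open>T f\<close> is the density after one step without regeneration from the density \<open>f\<close>\<close>
  define T where "T = (\<lambda>(f::'b \<Rightarrow> ennreal) y. \<integral>\<^sup>+x. f x * r (x, y) \<partial>lborel)"
  have Tm[measurable]: "T f \<in> borel_measurable borel" if [measurable]: "f \<in> borel_measurable borel" for f
    unfolding T_def by measurable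
  have dual: "(\<integral>\<^sup>+y. T f y * g y \<partial>lborel) = (\<integral>\<^sup>+x. f x * (\<integral>\<^sup>+y. r (x, y) * g y \<partial>lborel) \<partial>lborel)"
    if [measurable]: "f \<in> borel_measurable borel" "g \<in> borel_measurable borel" for f g
  proof -
    have "(\<integral>\<^sup>+y. T f y * g y \<partial>lborel) = (\<integral>\<^sup>+y. (\<integral>\<^sup>+x. f x * r (x, y) * g y \<partial>lborel) \<partial>lborel)"
      unfolding T_def by (intro nn_integral_cong) (simp add: nn_integral_multc)
    also have "\<dots> = (\<integral>\<^sup>+x. (\<integral>\<^sup>+y. f x * r (x, y) * g y \<partial>lborel) \<partial>lborel)"
      by (rule lborel_pair.Fubini') measurable
    also have "\<dots> = (\<integral>\<^sup>+x. f x * (\<integral>\<^sup>+y. r (x, y) * g y \<partial>lborel) \<partial>lborel)"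
      by (intro nn_integral_cong) (simp add: nn_integral_cmult mult.assoc)
    finally show ?thesis .
  qed
  define u where "u = (\<lambda>k. (T ^^ k) n)"
  have u0: "u 0 = n" and uS: "u (Suc k) = T (u k)" for k by (simp_all add: u_def)
  have um[measurable]: "u k \<in> borel_measurable borel" for k
    by (induction k) (auto simp: u0 uS)
  have step: "(\<integral>\<^sup>+y. u (Suc k) y * W y \<partial>lborel) + (\<integral>\<^sup>+y. u k y \<partial>lborel) \<le> (\<integral>\<^sup>+y. u k y * W y \<partial>lborel)" for k
  proof -
    have "(\<integral>\<^sup>+y. u (Suc k) y * W y \<partial>lborel) + (\<integral>\<^sup>+y. u k y \<partial>lborel)
       = (\<integral>\<^sup>+x. u k x * ((\<integral>\<^sup>+y. r (x, y) * W y \<partial>lborel) + 1) \<partial>lborel)"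
      unfolding uS by (subst dual) (simp_all add: nn_integral_add distrib_left)
    also have "\<dots> \<le> (\<integral>\<^sup>+y. u k y * W y \<partial>lborel)" by (intro nn_integral_mono mult_left_mono drift) simp
    finally show ?thesis .
  qed
  have partial: "(\<Sum>k<N. \<integral>\<^sup>+y. u k y \<partial>lborel) + (\<integral>\<^sup>+y. u N y * W y \<partial>lborel) \<le> (\<integral>\<^sup>+y. n y * W y \<partial>lborel)" for N
  proof (induction N)
    case (Suc N)
    have "(\<Sum>k<Suc N. \<integral>\<^sup>+y. u k y \<partial>lborel) + (\<integral>\<^sup>+y. u (Suc N) y * W y \<partial>lborel)
      = (\<Sum>k<N. \<integral>\<^sup>+y. u k y \<partial>lborel) + ((\<integral>\<^sup>+y. u (Suc N) y * W y \<partial>lborel) + (\<integral>\<^sup>+y. u N y \<partial>lborel))"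
      by (simp add: ac_simps)
    also have "\<dots> \<le> (\<Sum>k<N. \<integral>\<^sup>+y. u k y \<partial>lborel) + (\<integral>\<^sup>+y. u N y * W y \<partial>lborel)" by (intro add_left_mono step)
    finally show ?case using Suc.IH by (rule order_trans)
  qed (simp add: u0)
  \<comment> \<open>the occupation density \<open>p\<close> of an excursion, and its mean length \<open>c\<close>\<close>
  define p where "p = (\<lambda>y. \<Sum>k. u k y)"
  have pm[measurable]: "p \<in> borel_measurable borel" unfolding p_def by measurable
  define c where "c = (\<integral>\<^sup>+y. p y \<partial>lborel)"
  have "c = (\<Sum>k. \<integral>\<^sup>+y. u k y \<partial>lborel)" unfolding c_def p_def by (rule nn_integral_suminf) measurable
  also have "\<dots> \<le> (\<integral>\<^sup>+y. n y * W y \<partial>lborel)"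
  proof (rule suminf_le_const)
    fix N show "(\<Sum>k<N. \<integral>\<^sup>+y. u k y \<partial>lborel) \<le> (\<integral>\<^sup>+y. n y * W y \<partial>lborel)"
      by (rule order_trans[OF _ partial[of N]]) simp
  qed simp
  finally have cfin: "c < \<infinity>" using fin by (rule le_less_trans)
  have Tp: "p y = n y + T p y" for y
  proof -
    have "T p y = (\<Sum>k. \<integral>\<^sup>+x. u k x * r (x, y) \<partial>lborel)"
      unfolding T_def p_def by (subst nn_integral_suminf[symmetric]) (auto simp: ennreal_suminf_multc intro!: nn_integral_cong)
    also have "\<dots> = (\<Sum>k. u (Suc k) y)" by (simp add: uS T_def)
    finally have "T p y = (\<Sum>k. u (Suc k) y)" .
    moreover have "p y = u 0 y + (\<Sum>k. u (Suc k) y)"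
    proof -
      have "(\<lambda>k. u (Suc k) y) sums (\<Sum>k. u (Suc k) y)" by (rule summable_sums) simp
      then have "(\<lambda>k. u k y) sums ((\<Sum>k. u (Suc k) y) + u 0 y)" by (rule sums_Suc)
      then show ?thesis unfolding p_def by (subst add.commute) (rule sums_unique[symmetric])
    qed
    ultimately show ?thesis by (simp add: u0)
  qed
  have c1: "c = 1 + (\<integral>\<^sup>+y. T p y \<partial>lborel)" 
  proof -
    have "c = (\<integral>\<^sup>+y. n y + T p y \<partial>lborel)" unfolding c_def by (intro nn_integral_cong Tp)
    then show ?thesis by (simp add: nn_integral_add n)
  qed
  have "c = (\<integral>\<^sup>+x. p x * ((\<integral>\<^sup>+y. r (x, y) * 1 \<partial>lborel) + s x) \<partial>lborel)" unfolding c_def by (simp add: tot)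
  also have "\<dots> = (\<integral>\<^sup>+y. T p y * 1 \<partial>lborel) + (\<integral>\<^sup>+x. p x * s x \<partial>lborel)"
    by (subst dual) (simp_all add: distrib_left nn_integral_add)
  finally have c2: "c = (\<integral>\<^sup>+y. T p y \<partial>lborel) + (\<integral>\<^sup>+x. p x * s x \<partial>lborel)" by simp
  have "(\<integral>\<^sup>+y. T p y \<partial>lborel) \<le> c" unfolding c1 by simp
  then have "(\<integral>\<^sup>+y. T p y \<partial>lborel) \<noteq> \<infinity>" using cfin by (auto simp: top_unique)
  then have ps: "(\<integral>\<^sup>+x. p x * s x \<partial>lborel) = 1"
    using c1 c2 by (simp add: add.commute[of 1] ennreal_add_left_cancel)
  have c0: "c \<noteq> 0" using c1 by simp
  have bindA: "emeasure (bind (density lborel f) Q) A = (\<integral>\<^sup>+y. T f y * indicator A y \<partial>lborel) + (\<integral>\<^sup>+x. f x * s x \<partial>lborel) * (\<integral>\<^sup>+y. n y * indicator A y \<partial>lborel)"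
    if A[measurable]: "A \<in> sets borel" and [measurable]: "f \<in> borel_measurable borel" for A f
  proof -
    have "emeasure (bind (density lborel f) Q) A = (\<integral>\<^sup>+x. emeasure (Q x) A \<partial>density lborel f)"
      by (rule emeasure_bind) (use Q(1) A in auto)
    also have "\<dots> = (\<integral>\<^sup>+x. f x * ((\<integral>\<^sup>+y. r (x, y) * indicator A y \<partial>lborel) + s x * (\<integral>\<^sup>+y. n y * indicator A y \<partial>lborel)) \<partial>lborel)"
      by (subst nn_integral_density) (auto simp: dens[OF A])
    also have "\<dots> = (\<integral>\<^sup>+x. f x * (\<integral>\<^sup>+y. r (x, y) * indicator A y \<partial>lborel) \<partial>lborel) + (\<integral>\<^sup>+x. f x * s x * (\<integral>\<^sup>+y. n y * indicator A y \<partial>lborel) \<partial>lborel)"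
      by (simp add: distrib_left nn_integral_add mult.assoc)
    finally show ?thesis by (simp add: dual nn_integral_multc)
  qed
  define f where "f = (\<lambda>y. p y / c)"
  have fm[measurable]: "f \<in> borel_measurable borel" unfolding f_def by measurable
  have f_int: "(\<integral>\<^sup>+y. f y * g y \<partial>lborel) = (\<integral>\<^sup>+y. p y * g y \<partial>lborel) / c" if [measurable]: "g \<in> borel_measurable borel" for g
    unfolding f_def divide_ennreal_def
    by (subst nn_integral_multc[symmetric]) (auto intro!: nn_integral_cong simp: mult_ac)
  have Tf: "T f y = T p y / c" for y
    unfolding T_def by (rule f_int) measurable
  have cc: "c / c = 1" using c0 cfin by (simp add: ennreal_divide_self)
  define \<pi> where "\<pi> = density lborel f"
  have inv: "invariant_law Q \<pi>" unfolding invariant_law_def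
  proof (intro conjI)
    show "prob_space \<pi>" using f_int[of "\<lambda>_. 1"] cc
      by (intro prob_spaceI) (simp add: \<pi>_def emeasure_density c_def)
    show "sets \<pi> = sets borel" by (simp add: \<pi>_def)
    show "bind \<pi> Q = \<pi>"
    proof (rule measure_eqI)
      show s: "sets (bind \<pi> Q) = sets \<pi>" by (subst sets_bind[where N=borel]) (auto simp: \<pi>_def)
      fix A assume "A \<in> sets (bind \<pi> Q)"
      then have A[measurable]: "A \<in> sets borel" using s by (simp add: \<pi>_def)
      have "emeasure (bind \<pi> Q) A = (\<integral>\<^sup>+y. T f y * indicator A y \<partial>lborel) + (\<integral>\<^sup>+x. f x * s x \<partial>lborel) * (\<integral>\<^sup>+y. n y * indicator A y \<partial>lborel)"
        unfolding \<pi>_def by (rule bindA) measurable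
      also have "\<dots> = (\<integral>\<^sup>+y. T p y * indicator A y / c \<partial>lborel) + (\<integral>\<^sup>+y. n y * indicator A y \<partial>lborel) / c"
        by (simp add: f_int ps Tf divide_ennreal_def mult_ac)
      also have "\<dots> = (\<integral>\<^sup>+y. (n y + T p y) * indicator A y / c \<partial>lborel)"
        by (simp add: divide_ennreal_def distrib_right nn_integral_add nn_integral_multc add.commute)
      also have "\<dots> = (\<integral>\<^sup>+y. f y * indicator A y \<partial>lborel)"
        unfolding Tp[symmetric] f_def by (simp add: divide_ennreal_def mult_ac)
      finally show "emeasure (bind \<pi> Q) A = emeasure \<pi> A" by (simp add: \<pi>_def emeasure_density)
    qed
  qed
  moreover have "\<pi>' = \<pi>" if inv': "invariant_law Q \<pi>'" for \<pi>'
  proof -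
    have P': "prob_space \<pi>'" and S'[measurable_cong, simp]: "sets \<pi>' = sets borel" and B': "bind \<pi>' Q = \<pi>'"
      using inv' by (auto simp: invariant_law_def)
    have [simp]: "space \<pi>' = UNIV" using sets_eq_imp_space_eq[OF S'] by simp
    define t where "t = (\<integral>\<^sup>+x. s x \<partial>\<pi>')"
    have A': "emeasure \<pi>' A = (\<integral>\<^sup>+x. (\<integral>\<^sup>+y. r (x, y) * indicator A y \<partial>lborel) \<partial>\<pi>') + t * (\<integral>\<^sup>+y. n y * indicator A y \<partial>lborel)"
      if A[measurable]: "A \<in> sets borel" for A
    proof -
      have "emeasure \<pi>' A = emeasure (bind \<pi>' Q) A" by (simp add: B')
      also have "\<dots> = (\<integral>\<^sup>+x. emeasure (Q x) A \<partial>\<pi>')"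
        by (rule emeasure_bind[where N=borel]) (use Q(1) A in \<open>auto simp: measurable_cong_sets[OF S' refl]\<close>)
      also have "\<dots> = (\<integral>\<^sup>+x. (\<integral>\<^sup>+y. r (x, y) * indicator A y \<partial>lborel) + s x * (\<integral>\<^sup>+y. n y * indicator A y \<partial>lborel) \<partial>\<pi>')"
        by (simp add: dens[OF A])
      also have "\<dots> = (\<integral>\<^sup>+x. (\<integral>\<^sup>+y. r (x, y) * indicator A y \<partial>lborel) \<partial>\<pi>') + t * (\<integral>\<^sup>+y. n y * indicator A y \<partial>lborel)"
        unfolding t_def by (simp add: nn_integral_add nn_integral_multc)
      finally show ?thesis .
    qed
    have "t \<le> (\<integral>\<^sup>+x. 1 \<partial>\<pi>')" unfolding t_def by (rule nn_integral_mono) (rule s1)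
    then have t_le: "t \<le> 1" using prob_space.emeasure_space_1[OF P'] by simp
    have lower: "t * (\<Sum>k<N. \<integral>\<^sup>+y. u k y * indicator A y \<partial>lborel) \<le> emeasure \<pi>' A" if [measurable]: "A \<in> sets borel" for A N
      using that
    proof (induction N arbitrary: A)
      case (Suc N)
      note [measurable] = Suc.prems
      define v where "v = (\<lambda>y. t * (\<Sum>k<N. u k y))"
      have [measurable]: "v \<in> borel_measurable borel" unfolding v_def by measurable
      have "density lborel v \<le> \<pi>'"
      proof (subst le_measure)
        show "sets (density lborel v) = sets \<pi>'" by simp
        show "\<forall>A\<in>sets (density lborel v). emeasure (density lborel v) A \<le> emeasure \<pi>' A"
        proof
          fix A assume "A \<in> sets (density lborel v)"
          then have A[measurable]: "A \<in> sets borel" by simp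
          have "emeasure (density lborel v) A = t * (\<integral>\<^sup>+y. (\<Sum>k<N. u k y) * indicator A y \<partial>lborel)"
            by (simp add: emeasure_density v_def mult.assoc nn_integral_cmult)
          also have "(\<integral>\<^sup>+y. (\<Sum>k<N. u k y) * indicator A y \<partial>lborel) = (\<Sum>k<N. \<integral>\<^sup>+y. u k y * indicator A y \<partial>lborel)"
            unfolding sum_distrib_right by (rule nn_integral_sum) measurable
          finally show "emeasure (density lborel v) A \<le> emeasure \<pi>' A" using Suc.IH[OF A] by simp
        qed
      qed
      then have "(\<integral>\<^sup>+x. (\<integral>\<^sup>+y. r (x, y) * indicator A y \<partial>lborel) \<partial>density lborel v) \<le> (\<integral>\<^sup>+x. (\<integral>\<^sup>+y. r (x, y) * indicator A y \<partial>lborel) \<partial>\<pi>')"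
        by (intro nn_integral_mono_measure) auto
      moreover have "(\<integral>\<^sup>+x. (\<integral>\<^sup>+y. r (x, y) * indicator A y \<partial>lborel) \<partial>density lborel v)
          = t * (\<Sum>k<N. \<integral>\<^sup>+y. u (Suc k) y * indicator A y \<partial>lborel)"
        by (simp add: nn_integral_density v_def mult.assoc nn_integral_cmult sum_distrib_right nn_integral_sum uS dual)
      ultimately have "t * (\<Sum>k<N. \<integral>\<^sup>+y. u (Suc k) y * indicator A y \<partial>lborel) + t * (\<integral>\<^sup>+y. u 0 y * indicator A y \<partial>lborel) \<le> emeasure \<pi>' A"
        unfolding A'[OF Suc.prems] u0 by (intro add_right_mono) simp
      then show ?case unfolding sum.lessThan_Suc_shift by (simp add: distrib_left add.commute)
    qed simp
    define v where "v = (\<lambda>y. t * p y)"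
    have [measurable]: "v \<in> borel_measurable borel" unfolding v_def by measurable
    have v_le: "density lborel v \<le> \<pi>'"
    proof (subst le_measure)
      show "sets (density lborel v) = sets \<pi>'" by simp
      show "\<forall>A\<in>sets (density lborel v). emeasure (density lborel v) A \<le> emeasure \<pi>' A"
      proof
        fix A assume "A \<in> sets (density lborel v)"
        then have A[measurable]: "A \<in> sets borel" by simp
        have "emeasure (density lborel v) A = t * (\<Sum>k. \<integral>\<^sup>+y. u k y * indicator A y \<partial>lborel)"
        proof -
          have "emeasure (density lborel v) A = t * (\<integral>\<^sup>+y. p y * indicator A y \<partial>lborel)"
            by (simp add: emeasure_density v_def mult.assoc nn_integral_cmult)
          also have "(\<integral>\<^sup>+y. p y * indicator A y \<partial>lborel) = (\<Sum>k. \<integral>\<^sup>+y. u k y * indicator A y \<partial>lborel)"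
            unfolding p_def ennreal_suminf_multc[symmetric] by (rule nn_integral_suminf) measurable
          finally show ?thesis .
        qed
        also have "\<dots> = (\<Sum>k. t * (\<integral>\<^sup>+y. u k y * indicator A y \<partial>lborel))" by (simp add: ennreal_suminf_cmult)
        also have "\<dots> \<le> emeasure \<pi>' A"
          using lower[OF A] by (intro suminf_le_const) (auto simp: sum_distrib_left)
        finally show "emeasure (density lborel v) A \<le> emeasure \<pi>' A" .
      qed
    qed
    have sA: "(\<integral>\<^sup>+x. s x * indicator A x \<partial>density lborel v) \<le> (\<integral>\<^sup>+x. s x * indicator A x \<partial>\<pi>')" for A
      by (rule nn_integral_mono_measure) (use v_le in auto)
    have split: "(\<integral>\<^sup>+x. s x \<partial>M) = (\<integral>\<^sup>+x. s x * indicator A x \<partial>M) + (\<integral>\<^sup>+x. s x * indicator (- A) x \<partial>M)"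
      if M: "sets M = sets borel" and A: "A \<in> sets borel" for A M
    proof -
      have m: "(\<lambda>x. s x * indicator B x) \<in> borel_measurable M" if [measurable]: "B \<in> sets borel" for B
        unfolding measurable_cong_sets[OF M refl] by measurable
      have "(\<integral>\<^sup>+x. s x \<partial>M) = (\<integral>\<^sup>+x. s x * indicator A x + s x * indicator (- A) x \<partial>M)"
        by (intro nn_integral_cong) (simp split: split_indicator)
      also have "\<dots> = (\<integral>\<^sup>+x. s x * indicator A x \<partial>M) + (\<integral>\<^sup>+x. s x * indicator (- A) x \<partial>M)"
        by (rule nn_integral_add) (use A m in auto)
      finally show ?thesis .
    qed
    have sv: "(\<integral>\<^sup>+x. s x \<partial>density lborel v) = t"
      by (simp add: nn_integral_density v_def mult.assoc nn_integral_cmult ps)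
    have s_eq: "(\<integral>\<^sup>+x. s x * indicator A x \<partial>density lborel v) = (\<integral>\<^sup>+x. s x * indicator A x \<partial>\<pi>')"
      if A[measurable]: "A \<in> sets borel" for A
    proof (rule antisym[OF sA])
      have e: "(\<integral>\<^sup>+x. s x * indicator A x \<partial>\<pi>') + (\<integral>\<^sup>+x. s x * indicator (- A) x \<partial>\<pi>')
        = (\<integral>\<^sup>+x. s x * indicator A x \<partial>density lborel v) + (\<integral>\<^sup>+x. s x * indicator (- A) x \<partial>density lborel v)"
      proof -
        have "(\<integral>\<^sup>+x. s x * indicator A x \<partial>\<pi>') + (\<integral>\<^sup>+x. s x * indicator (- A) x \<partial>\<pi>') = (\<integral>\<^sup>+x. s x \<partial>\<pi>')"
          by (rule split[OF S' A, symmetric])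
        also have "\<dots> = (\<integral>\<^sup>+x. s x \<partial>density lborel v)"
          by (simp only: sv t_def)
        also have "\<dots> = (\<integral>\<^sup>+x. s x * indicator A x \<partial>density lborel v) + (\<integral>\<^sup>+x. s x * indicator (- A) x \<partial>density lborel v)"
          by (rule split[OF _ A]) simp
        finally show ?thesis .
      qed
      have "(\<integral>\<^sup>+x. s x * indicator (- A) x \<partial>density lborel v) \<le> t"
      proof -
        have "(\<integral>\<^sup>+x. s x * indicator (- A) x \<partial>density lborel v) \<le> (\<integral>\<^sup>+x. s x \<partial>density lborel v)"
          by (intro nn_integral_mono) (simp split: split_indicator)
        then show ?thesis by (simp only: sv)
      qed
      then have "(\<integral>\<^sup>+x. s x * indicator (- A) x \<partial>density lborel v) \<le> 1" using t_le by (rule order_trans)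
      then have f: "(\<integral>\<^sup>+x. s x * indicator (- A) x \<partial>density lborel v) \<noteq> \<infinity>"
        by (rule neq_top_trans[OF ennreal_one_neq_top, folded infinity_ennreal_def])
      have "(\<integral>\<^sup>+x. s x * indicator A x \<partial>\<pi>') + (\<integral>\<^sup>+x. s x * indicator (- A) x \<partial>density lborel v)
         \<le> (\<integral>\<^sup>+x. s x * indicator A x \<partial>density lborel v) + (\<integral>\<^sup>+x. s x * indicator (- A) x \<partial>density lborel v)"
        unfolding e[symmetric] by (intro add_left_mono sA)
      then show "(\<integral>\<^sup>+x. s x * indicator A x \<partial>\<pi>') \<le> (\<integral>\<^sup>+x. s x * indicator A x \<partial>density lborel v)"
        using f by (simp add: add.commute ennreal_add_left_cancel_le)
    qed
    have "density (density lborel v) s = density \<pi>' s"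
    proof (rule measure_eqI)
      fix A assume "A \<in> sets (density (density lborel v) s)"
      then have [measurable]: "A \<in> sets borel" by simp
      show "emeasure (density (density lborel v) s) A = emeasure (density \<pi>' s) A"
        using s_eq[of A] by (simp add: emeasure_density)
    qed simp
    then have "density (density (density lborel v) s) (\<lambda>x. inverse (s x)) = density (density \<pi>' s) (\<lambda>x. inverse (s x))" by simp
    moreover have "s x * inverse (s x) = 1" for x
      using ennreal_divide_self[of "s x"] s[of x] le_less_trans[OF s1 ennreal_one_less_top] by (simp add: divide_ennreal_def)
    ultimately have "\<pi>' = density lborel v"
      by (simp add: density_density_eq density_1 mult.assoc)
    then have \<pi>': "\<pi>' = density lborel v" .
    have "1 = t * c"
      using prob_space.emeasure_space_1[OF P'] unfolding \<pi>'
      by (simp add: emeasure_density v_def nn_integral_cmult c_def)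
    moreover have "t = t * c / c" using cc by (simp add: ennreal_times_divide[symmetric])
    ultimately have "t = 1 / c" by simp
    then have "v = f" unfolding v_def f_def by (simp add: divide_ennreal_def mult.commute fun_eq_iff)
    then show ?thesis using \<pi>' by (simp add: \<pi>_def)
  qed
  ultimately show ?thesis by blast
qed

lemma ennreal_min: "0 \<le> a \<Longrightarrow> 0 \<le> b \<Longrightarrow> min (ennreal a) (ennreal b) = ennreal (min a b)"
  by (auto simp: min_def)

lemma dirac_iterate_0: "dirac_iterate Q 0 z = return borel z"
  by (simp add: dirac_iterate_def)

lemma dirac_iterate_Suc: "dirac_iterate Q (Suc n) z = bind (dirac_iterate Q n z) Q"
  by (simp add: dirac_iterate_def)

lemma dirac_iterate_prob:
  assumes Q: "Q \<in> measurable borel (subprob_algebra borel)" "\<And>z. prob_space (Q z)"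
  shows "sets (dirac_iterate Q n z) = sets borel \<and> prob_space (dirac_iterate Q n z)"
proof (induction n)
  case 0 then show ?case by (simp add: dirac_iterate_0 prob_space_return)
next
  case (Suc n)
  then have S: "sets (dirac_iterate Q n z) = sets borel" and P: "prob_space (dirac_iterate Q n z)" by auto
  have ne: "space (dirac_iterate Q n z) \<noteq> {}" using sets_eq_imp_space_eq[OF S] by simp
  have m: "Q \<in> measurable (dirac_iterate Q n z) (subprob_algebra borel)"
    using Q(1) by (simp add: measurable_cong_sets[OF S refl])
  have sQ: "sets (Q x) = sets borel" for x
    using measurable_space[OF Q(1), of x] by (simp add: space_subprob_algebra)
  show ?case unfolding dirac_iterate_Suc
  proof
    show "sets (bind (dirac_iterate Q n z) Q) = sets borel" by (rule sets_bind[OF sQ ne])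
    show "prob_space (bind (dirac_iterate Q n z) Q)"
      by (rule prob_space.prob_space_bind[OF P _ m]) (simp add: Q(2))
  qed
qed

lemma nn_integral_bind_kernel:
  assumes Q: "Q \<in> measurable borel (subprob_algebra borel)" and S: "sets \<mu> = sets borel"
    and f: "f \<in> borel_measurable borel"
  shows "(\<integral>\<^sup>+y. f y \<partial>(bind \<mu> Q)) = (\<integral>\<^sup>+x. (\<integral>\<^sup>+y. f y \<partial>Q x) \<partial>\<mu>)"
  by (rule nn_integral_bind[OF f]) (simp add: measurable_cong_sets[OF S refl] Q)

lemma drift_bound_iterates:
  fixes V :: "'b::topological_space \<Rightarrow> real"
  assumes Q: "Q \<in> measurable borel (subprob_algebra borel)" "\<And>z. prob_space (Q z)"
    and V: "V \<in> borel_measurable borel" "\<And>z. 0 \<le> V z" and \<theta>: "0 \<le> \<theta>" "\<theta> < 1" and b: "0 \<le> b"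
    and drift: "\<And>z. (\<integral>\<^sup>+y. ennreal (V y) \<partial>Q z) \<le> ennreal (\<theta> * V z + b)"
  shows "(\<integral>\<^sup>+y. ennreal (V y) \<partial>dirac_iterate Q n z) \<le> ennreal (V z + b / (1 - \<theta>))"
proof -
  have Vm: "(\<lambda>y. ennreal (V y)) \<in> borel_measurable borel" using V(1) by measurable
  have "(\<integral>\<^sup>+y. ennreal (V y) \<partial>dirac_iterate Q n z) \<le> ennreal (\<theta> ^ n * V z + b / (1 - \<theta>))"
  proof (induction n)
    case 0
    have "(\<integral>\<^sup>+y. ennreal (V y) \<partial>return borel z) = ennreal (V z)" by (rule nn_integral_return) (use Vm in auto)
    then show ?case using V(2)[of z] b \<theta> by (simp add: dirac_iterate_0 ennreal_leI)
  next
    case (Suc n)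
    note P = dirac_iterate_prob[OF Q, of n z]
    have S: "sets (dirac_iterate Q n z) = sets borel" using P by simp
    have "(\<integral>\<^sup>+y. ennreal (V y) \<partial>dirac_iterate Q (Suc n) z) = (\<integral>\<^sup>+x. (\<integral>\<^sup>+y. ennreal (V y) \<partial>Q x) \<partial>dirac_iterate Q n z)"
      unfolding dirac_iterate_Suc by (rule nn_integral_bind_kernel[OF Q(1) S Vm])
    also have "\<dots> \<le> (\<integral>\<^sup>+x. ennreal \<theta> * ennreal (V x) + ennreal b \<partial>dirac_iterate Q n z)"
      by (intro nn_integral_mono order_trans[OF drift]) (use V(2) \<theta> b in \<open>simp add: ennreal_mult'[symmetric] ennreal_plus[symmetric] del: ennreal_plus\<close>)
    also have "\<dots> = ennreal \<theta> * (\<integral>\<^sup>+x. ennreal (V x) \<partial>dirac_iterate Q n z) + ennreal b"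
      using Vm prob_space.emeasure_space_1[of "dirac_iterate Q n z"] P
      by (simp add: nn_integral_add nn_integral_cmult measurable_cong_sets[OF S refl])
    also have "\<dots> \<le> ennreal \<theta> * ennreal (\<theta> ^ n * V z + b / (1 - \<theta>)) + ennreal b"
      by (intro add_right_mono mult_left_mono Suc.IH) simp
    also have "\<dots> = ennreal (\<theta> * (\<theta> ^ n * V z + b / (1 - \<theta>)) + b)"
      using V(2)[of z] b \<theta> by (simp add: ennreal_mult'[symmetric] ennreal_plus[symmetric] del: ennreal_plus)
    also have "\<theta> * (\<theta> ^ n * V z + b / (1 - \<theta>)) + b = \<theta> ^ Suc n * V z + b / (1 - \<theta>)"
      using \<theta> by (simp add: field_simps)
    finally show ?case .
  qed
  also have "\<dots> \<le> ennreal (V z + b / (1 - \<theta>))"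
    using V(2)[of z] \<theta> by (intro ennreal_leI add_right_mono mult_left_le_one_le) (auto simp: power_le_one)
  finally show ?thesis .
qed

text \<open>The moment is not known to be finite in advance, so the drift inequality cannot be integrated
  directly. Instead, with \<open>c = b / (1 - \<theta>)\<close>, the kernel \<open>Q\<close> maps \<open>min M (\<theta>\<^sup>n V + c (1 - \<theta>\<^sup>n))\<close> below the same function with \<open>n + 1\<close>
  (Jensen for \<open>min M\<close>), so the integral of \<open>min M V\<close> is bounded by the limit \<open>min M c\<close>, and then
  \<open>M\<close> tends to infinity.\<close>

lemma drift_bound_invariant:
  fixes V :: "'b::topological_space \<Rightarrow> real"
  assumes Q: "Q \<in> measurable borel (subprob_algebra borel)" "\<And>z. prob_space (Q z)"
    and V: "V \<in> borel_measurable borel" "\<And>z. 0 \<le> V z" and \<theta>: "0 \<le> \<theta>" "\<theta> < 1" and b: "0 \<le> b"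
    and drift: "\<And>z. (\<integral>\<^sup>+y. ennreal (V y) \<partial>Q z) \<le> ennreal (\<theta> * V z + b)"
    and inv: "invariant_law Q \<pi>"
  shows "(\<integral>\<^sup>+y. ennreal (V y) \<partial>\<pi>) \<le> ennreal (b / (1 - \<theta>))"
proof -
  have P: "prob_space \<pi>" and S: "sets \<pi> = sets borel" and B: "bind \<pi> Q = \<pi>" using inv by (auto simp: invariant_law_def)
  interpret prob_space \<pi> by fact
  define c where "c = b / (1 - \<theta>)"
  have c: "0 \<le> c" "b = c * (1 - \<theta>)" using b \<theta> by (auto simp: c_def)
  have trunc: "(\<integral>\<^sup>+y. ennreal (min M (V y)) \<partial>\<pi>) \<le> ennreal c" if M: "0 \<le> M" for M
  proof -
    define F where "F = (\<lambda>n y. min M (\<theta> ^ n * V y + c * (1 - \<theta> ^ n)))"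
    have Fm[measurable]: "F n \<in> borel_measurable borel" for n unfolding F_def using V(1) by measurable
    have pw: "0 \<le> \<theta> ^ n" "\<theta> ^ n \<le> 1" for n using \<theta> by (auto simp: power_le_one)
    have F0: "0 \<le> F n y" "F n y \<le> M" for n y using M V(2)[of y] c pw[of n] by (auto simp: F_def)
    have QF: "(\<integral>\<^sup>+y. ennreal (F n y) \<partial>Q z) \<le> ennreal (F (Suc n) z)" for n z
    proof -
      interpret Q: prob_space "Q z" by (rule Q(2))
      have sQ: "sets (Q z) = sets borel" using measurable_space[OF Q(1), of z] by (simp add: space_subprob_algebra)
      have "(\<integral>\<^sup>+y. ennreal (F n y) \<partial>Q z) \<le> (\<integral>\<^sup>+y. ennreal M \<partial>Q z)" by (intro nn_integral_mono ennreal_leI F0)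
      then have 1: "(\<integral>\<^sup>+y. ennreal (F n y) \<partial>Q z) \<le> ennreal M" by (simp add: Q.emeasure_space_1)
      have "(\<integral>\<^sup>+y. ennreal (F n y) \<partial>Q z) \<le> (\<integral>\<^sup>+y. ennreal (\<theta> ^ n) * ennreal (V y) + ennreal (c * (1 - \<theta> ^ n)) \<partial>Q z)"
        using V(2) c pw[of n] by (intro nn_integral_mono) (simp add: F_def ennreal_mult'[symmetric] ennreal_plus[symmetric] ennreal_leI del: ennreal_plus)
      also have "\<dots> = ennreal (\<theta> ^ n) * (\<integral>\<^sup>+y. ennreal (V y) \<partial>Q z) + ennreal (c * (1 - \<theta> ^ n))"
        using V(1) by (simp add: nn_integral_add nn_integral_cmult measurable_cong_sets[OF sQ refl] Q.emeasure_space_1)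
      also have "\<dots> \<le> ennreal (\<theta> ^ n) * ennreal (\<theta> * V z + b) + ennreal (c * (1 - \<theta> ^ n))"
        by (intro add_right_mono mult_left_mono drift) simp
      also have "\<dots> = ennreal (\<theta> ^ n * (\<theta> * V z + b) + c * (1 - \<theta> ^ n))"
        using V(2)[of z] b c \<theta> pw[of n] by (simp add: ennreal_mult'[symmetric] ennreal_plus[symmetric] del: ennreal_plus)
      also have "\<theta> ^ n * (\<theta> * V z + b) + c * (1 - \<theta> ^ n) = \<theta> ^ Suc n * V z + c * (1 - \<theta> ^ Suc n)"
        by (simp add: c(2) algebra_simps)
      finally have "(\<integral>\<^sup>+y. ennreal (F n y) \<partial>Q z) \<le> min (ennreal M) (ennreal (\<theta> ^ Suc n * V z + c * (1 - \<theta> ^ Suc n)))"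
        using 1 by simp
      also have "\<dots> = ennreal (F (Suc n) z)" unfolding F_def
        by (rule ennreal_min) (use M V(2)[of z] \<theta> c pw[of "Suc n"] in auto)
      finally show ?thesis .
    qed
    have mono: "(\<integral>\<^sup>+y. ennreal (F 0 y) \<partial>\<pi>) \<le> (\<integral>\<^sup>+y. ennreal (F n y) \<partial>\<pi>)" for n
    proof (induction n)
      case (Suc n)
      have "(\<integral>\<^sup>+y. ennreal (F n y) \<partial>\<pi>) = (\<integral>\<^sup>+y. ennreal (F n y) \<partial>(bind \<pi> Q))" by (simp add: B)
      also have "\<dots> = (\<integral>\<^sup>+x. (\<integral>\<^sup>+y. ennreal (F n y) \<partial>Q x) \<partial>\<pi>)"
        by (rule nn_integral_bind_kernel[OF Q(1) S]) measurable
      also have "\<dots> \<le> (\<integral>\<^sup>+y. ennreal (F (Suc n) y) \<partial>\<pi>)" by (intro nn_integral_mono QF)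
      finally show ?case using Suc.IH by simp
    qed simp
    have "(\<lambda>n. \<integral>\<^sup>+y. ennreal (F n y) \<partial>\<pi>) \<longlonglongrightarrow> (\<integral>\<^sup>+y. ennreal (min M c) \<partial>\<pi>)"
    proof (rule nn_integral_dominated_convergence[where w="\<lambda>_. ennreal M"])
      have "(\<lambda>n. F n y) \<longlonglongrightarrow> min M (0 * V y + c * (1 - 0))" for y
        unfolding F_def using \<theta> by (intro tendsto_intros LIMSEQ_realpow_zero) auto
      then show "AE y in \<pi>. (\<lambda>n. ennreal (F n y)) \<longlonglongrightarrow> ennreal (min M c)"
        by (intro AE_I2 tendsto_ennrealI) simp
      show "(\<lambda>y. ennreal (F n y)) \<in> borel_measurable \<pi>" for n
        unfolding measurable_cong_sets[OF S refl] by measurable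
    qed (use F0 in \<open>auto intro!: ennreal_leI simp: emeasure_space_1\<close>)
    then have "(\<integral>\<^sup>+y. ennreal (F 0 y) \<partial>\<pi>) \<le> (\<integral>\<^sup>+y. ennreal (min M c) \<partial>\<pi>)"
      using mono by (intro LIMSEQ_le_const) auto
    also have "\<dots> \<le> ennreal c" by (simp add: emeasure_space_1 ennreal_leI)
    finally show ?thesis by (simp add: F_def)
  qed
  have "(\<integral>\<^sup>+y. ennreal (V y) \<partial>\<pi>) = (SUP n. \<integral>\<^sup>+y. ennreal (min (real n) (V y)) \<partial>\<pi>)"
  proof -
    have "ennreal (V y) = (SUP n. ennreal (min (real n) (V y)))" for y
    proof (rule antisym)
      obtain n where n: "V y \<le> real n" using real_arch_simple by blast
      show "ennreal (V y) \<le> (SUP n. ennreal (min (real n) (V y)))"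
        by (rule SUP_upper2[of n]) (use n in auto)
      show "(SUP n. ennreal (min (real n) (V y))) \<le> ennreal (V y)"
        by (intro SUP_least ennreal_leI) simp
    qed
    then have "(\<integral>\<^sup>+y. ennreal (V y) \<partial>\<pi>) = (\<integral>\<^sup>+y. (SUP n. ennreal (min (real n) (V y))) \<partial>\<pi>)" by simp
    also have "\<dots> = (SUP n. \<integral>\<^sup>+y. ennreal (min (real n) (V y)) \<partial>\<pi>)"
    proof (rule nn_integral_monotone_convergence_SUP)
      show "incseq (\<lambda>n y. ennreal (min (real n) (V y)))"
        by (intro incseq_SucI le_funI ennreal_leI min.mono) auto
      show "(\<lambda>y. ennreal (min (real n) (V y))) \<in> borel_measurable \<pi>" for n
        unfolding measurable_cong_sets[OF S refl] using V(1) by measurable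
    qed
    finally show ?thesis .
  qed
  also have "\<dots> \<le> ennreal c" by (intro SUP_least trunc) simp
  finally show ?thesis by (simp add: c_def)
qed

section \<open>Standard Gaussian noise\<close>

definition gaussian_density :: "'a::euclidean_space \<Rightarrow> real" where
  "gaussian_density x = (\<Prod>b\<in>Basis. std_normal_density (inner x b))"

lemma std_gaussian_eq: "std_gaussian = density lborel (\<lambda>x. ennreal (gaussian_density x))"
  by (simp add: std_gaussian_def gaussian_density_def)

lemma norm_power2_eq_sum: "(norm (x::'a::euclidean_space))\<^sup>2 = (\<Sum>b\<in>Basis. (inner x b)\<^sup>2)"
  unfolding power2_norm_eq_inner by (subst euclidean_inner) (simp add: power2_eq_square)

lemma gaussian_density_eq:
  "gaussian_density (x::'a::euclidean_space) = (1 / sqrt (2 * pi)) ^ DIM('a) * exp (- (norm x)\<^sup>2 / 2)"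
  unfolding gaussian_density_def std_normal_density_def norm_power2_eq_sum
  by (simp only: prod.distrib prod_constant) (simp add: exp_sum[symmetric] sum_negf sum_divide_distrib)

lemma gaussian_density_pos: "0 < gaussian_density x"
  by (simp add: gaussian_density_eq)

lemma gaussian_density_measurable[measurable]: "gaussian_density \<in> borel_measurable borel"
  unfolding gaussian_density_eq[abs_def] by measurable

lemma sets_std_gaussian[simp, measurable_cong]: "sets std_gaussian = sets borel"
  by (simp add: std_gaussian_eq)

lemma space_std_gaussian[simp]: "space std_gaussian = UNIV"
  by (simp add: std_gaussian_eq)

lemma nn_integral_std_gaussian:
  "f \<in> borel_measurable borel \<Longrightarrow> (\<integral>\<^sup>+x. f x \<partial>std_gaussian) = (\<integral>\<^sup>+x. ennreal (gaussian_density x) * f x \<partial>lborel)"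
  unfolding std_gaussian_eq by (rule nn_integral_density) measurable

lemma nn_integral_normal_density: "0 < \<tau> \<Longrightarrow> (\<integral>\<^sup>+x. ennreal (normal_density m \<tau> x) \<partial>lborel) = 1"
  using prob_space.emeasure_space_1[OF prob_space_normal_density[of \<tau> m]] by (simp add: emeasure_density)

lemma prob_space_std_gaussian: "prob_space (std_gaussian :: 'a::euclidean_space measure)"
proof (rule prob_spaceI)
  have "emeasure std_gaussian (space (std_gaussian :: 'a measure)) = (\<integral>\<^sup>+x. (\<Prod>b\<in>Basis. ennreal (std_normal_density (inner x b))) \<partial>(lborel :: 'a measure))"
    by (simp add: std_gaussian_eq emeasure_density gaussian_density_def prod_ennreal)
  also have "\<dots> = 1" by (subst nn_integral_lborel_prod) (auto simp: nn_integral_normal_density)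
  finally show "emeasure std_gaussian (space (std_gaussian :: 'a measure)) = 1" .
qed

text \<open>The factor \<open>exp (t\<^sup>2 / 4)\<close> turns the one-dimensional standard normal density into \<open>sqrt 2\<close> times the
  normal density of variance \<open>2\<close>. This exponential moment yields the second moment and the tail.\<close>

lemma gaussian_exp_moment:
  "(\<integral>\<^sup>+x. ennreal (exp ((norm x)\<^sup>2 / 4)) \<partial>(std_gaussian :: 'a::euclidean_space measure)) = ennreal (sqrt 2 ^ DIM('a))"
proof -
  have 1: "(\<integral>\<^sup>+t. ennreal (std_normal_density t * exp (t\<^sup>2 / 4)) \<partial>lborel) = ennreal (sqrt 2)"
  proof -
    have "std_normal_density t * exp (t\<^sup>2 / 4) = sqrt 2 * normal_density 0 (sqrt 2) t" for t :: real
    proof -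
      have "sqrt (pi * 4) = sqrt (pi * 2) * sqrt 2" unfolding real_sqrt_mult[symmetric] by simp
      then show ?thesis
        by (simp add: normal_density_def std_normal_density_def exp_add[symmetric] field_simps real_sqrt_mult)
    qed
    then have "(\<integral>\<^sup>+t. ennreal (std_normal_density t * exp (t\<^sup>2 / 4)) \<partial>lborel)
      = (\<integral>\<^sup>+t. ennreal (sqrt 2) * ennreal (normal_density 0 (sqrt 2) t) \<partial>lborel)"
      by (simp add: ennreal_mult)
    also have "\<dots> = ennreal (sqrt 2)" by (subst nn_integral_cmult) (auto simp: nn_integral_normal_density)
    finally show ?thesis .
  qed
  have "(\<integral>\<^sup>+x. ennreal (exp ((norm x)\<^sup>2 / 4)) \<partial>(std_gaussian :: 'a measure))
    = (\<integral>\<^sup>+x. ennreal (gaussian_density x) * ennreal (exp ((norm x)\<^sup>2 / 4)) \<partial>(lborel :: 'a measure))"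
    by (rule nn_integral_std_gaussian) measurable
  also have "\<dots> = (\<integral>\<^sup>+x. (\<Prod>b\<in>Basis. ennreal (std_normal_density (inner x b) * exp ((inner x b)\<^sup>2 / 4))) \<partial>(lborel :: 'a measure))"
    by (intro nn_integral_cong)
      (simp add: gaussian_density_def norm_power2_eq_sum prod_ennreal ennreal_mult[symmetric] prod_nonneg
        prod.distrib exp_sum[symmetric] sum_divide_distrib)
  also have "\<dots> = ennreal (sqrt 2 ^ DIM('a))"
    by (subst nn_integral_lborel_prod) (auto simp: 1 ennreal_power)
  finally show ?thesis .
qed

lemma gaussian_second_moment:
  "(\<integral>\<^sup>+x. ennreal ((norm x)\<^sup>2) \<partial>(std_gaussian :: 'a::euclidean_space measure)) \<le> ennreal (4 * sqrt 2 ^ DIM('a))"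
proof -
  have "(\<integral>\<^sup>+x. ennreal ((norm x)\<^sup>2) \<partial>(std_gaussian :: 'a measure))
    \<le> (\<integral>\<^sup>+x. ennreal 4 * ennreal (exp ((norm x)\<^sup>2 / 4)) \<partial>(std_gaussian :: 'a measure))"
  proof (intro nn_integral_mono)
    fix x :: 'a
    have "(norm x)\<^sup>2 \<le> 4 * exp ((norm x)\<^sup>2 / 4)" using exp_ge_add_one_self[of "(norm x)\<^sup>2 / 4"] by linarith
    then show "ennreal ((norm x)\<^sup>2) \<le> ennreal 4 * ennreal (exp ((norm x)\<^sup>2 / 4))"
      by (simp add: ennreal_mult[symmetric] ennreal_leI del: ennreal_numeral)
  qed
  also have "\<dots> = ennreal 4 * (\<integral>\<^sup>+x. ennreal (exp ((norm x)\<^sup>2 / 4)) \<partial>(std_gaussian :: 'a measure))"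
    by (rule nn_integral_cmult) measurable
  also have "\<dots> = ennreal (4 * sqrt 2 ^ DIM('a))"
    unfolding gaussian_exp_moment by (simp add: ennreal_mult[symmetric] del: ennreal_numeral)
  finally show ?thesis .
qed

lemma gaussian_tail:
  assumes "0 \<le> t"
  shows "emeasure (std_gaussian :: 'a::euclidean_space measure) {x. t < norm x} \<le> ennreal (sqrt 2 ^ DIM('a) * exp (- t\<^sup>2 / 4))"
proof -
  have "emeasure (std_gaussian :: 'a measure) {x. t < norm x} = (\<integral>\<^sup>+x. indicator {x. t < norm x} x \<partial>(std_gaussian :: 'a measure))"
    by (rule nn_integral_indicator[symmetric]) simp
  also have "\<dots> \<le> (\<integral>\<^sup>+x. ennreal (exp (- t\<^sup>2 / 4)) * ennreal (exp ((norm x)\<^sup>2 / 4)) \<partial>(std_gaussian :: 'a measure))"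
  proof (intro nn_integral_mono)
    fix x :: 'a
    have "1 \<le> exp (- t\<^sup>2 / 4) * exp ((norm x)\<^sup>2 / 4)" if "t < norm x"
    proof -
      have "t\<^sup>2 \<le> (norm x)\<^sup>2" using that assms by (intro power_mono) auto
      then show ?thesis unfolding exp_add[symmetric] by simp
    qed
    then show "indicator {x. t < norm x} x \<le> ennreal (exp (- t\<^sup>2 / 4)) * ennreal (exp ((norm x)\<^sup>2 / 4))"
      by (auto simp: ennreal_mult[symmetric] split: split_indicator)
  qed
  also have "\<dots> = ennreal (exp (- t\<^sup>2 / 4)) * (\<integral>\<^sup>+x. ennreal (exp ((norm x)\<^sup>2 / 4)) \<partial>(std_gaussian :: 'a measure))"
    by (rule nn_integral_cmult) measurable
  also have "\<dots> = ennreal (sqrt 2 ^ DIM('a) * exp (- t\<^sup>2 / 4))"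
    unfolding gaussian_exp_moment by (simp add: ennreal_mult[symmetric] mult.commute)
  finally show ?thesis .
qed

lemma nn_integral_gaussian_affine:
  fixes F :: "'a::euclidean_space \<Rightarrow> ennreal"
  assumes c: "0 < c" and F[measurable]: "F \<in> borel_measurable borel"
  shows "(\<integral>\<^sup>+\<xi>. F (m + c *\<^sub>R \<xi>) \<partial>std_gaussian)
    = (\<integral>\<^sup>+y. ennreal (gaussian_density ((y - m) /\<^sub>R c) / c ^ DIM('a)) * F y \<partial>lborel)"
proof -
  have "(\<integral>\<^sup>+y. ennreal (gaussian_density ((y - m) /\<^sub>R c) / c ^ DIM('a)) * F y \<partial>lborel)
    = (\<integral>\<^sup>+y. ennreal (gaussian_density ((y - m) /\<^sub>R c) / c ^ DIM('a)) * F y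
        \<partial>density (distr lborel borel (\<lambda>x. m + c *\<^sub>R x)) (\<lambda>_. ennreal (\<bar>c\<bar> ^ DIM('a))))"
    by (subst lborel_affine[of c m]) (use c in auto)
  also have "\<dots> = (\<integral>\<^sup>+x. ennreal (c ^ DIM('a)) * (ennreal (gaussian_density x / c ^ DIM('a)) * F (m + c *\<^sub>R x)) \<partial>lborel)"
    using c by (subst nn_integral_density) (auto simp: nn_integral_distr)
  also have "\<dots> = (\<integral>\<^sup>+x. ennreal (gaussian_density x) * F (m + c *\<^sub>R x) \<partial>lborel)"
    using c by (intro nn_integral_cong)
      (simp add: mult.assoc[symmetric] ennreal_mult[symmetric] less_imp_le[OF gaussian_density_pos])
  also have "\<dots> = (\<integral>\<^sup>+\<xi>. F (m + c *\<^sub>R \<xi>) \<partial>std_gaussian)"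
    by (rule nn_integral_std_gaussian[symmetric]) measurable
  finally show ?thesis ..
qed

section \<open>OBABO in heavy-ball coordinates\<close>

locale obabo =
  fixes h \<gamma> :: real
  assumes h_pos: "0 < h" and \<gamma>_pos: "0 < \<gamma>"
begin

definition r where "r = exp (- \<gamma> * h / 2)"
definition \<beta> where "\<beta> = exp (- \<gamma> * h)"
definition \<sigma> where "\<sigma> = sqrt (1 - \<beta>)"
definition s where "s = h\<^sup>2 / 2 * (1 + \<beta>)"

lemma r_pos: "0 < r" by (simp add: r_def)
lemma r_sq: "r\<^sup>2 = \<beta>" by (simp add: r_def \<beta>_def exp_double[symmetric])
lemma \<beta>: "0 < \<beta>" "\<beta> < 1" using h_pos \<gamma>_pos by (simp_all add: \<beta>_def)
lemma \<sigma>_pos: "0 < \<sigma>" using \<beta> by (simp add: \<sigma>_def)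
lemma s_pos: "0 < s" using h_pos \<beta> by (simp add: s_def)

text \<open>The next position would be \<open>lookahead U z\<close> without noise. The pair of look-ahead point and
  position carries the same information as \<open>z\<close>, and it evolves by the heavy-ball recursion.\<close>

definition lookahead :: "('a::euclidean_space \<Rightarrow> real) \<Rightarrow> 'a \<times> 'a \<Rightarrow> 'a" where
  "lookahead U z = fst z + h *\<^sub>R (r *\<^sub>R snd z - (h / 2) *\<^sub>R gradient U (fst z))"

text \<open>The mean of the new velocity when the position moves from \<open>x\<close> to \<open>x'\<close>: the intermediate velocity
  is then known to be \<open>(x' - x) / h\<close>.\<close>

definition mean_velocity :: "('a::euclidean_space \<Rightarrow> real) \<Rightarrow> 'a \<Rightarrow> 'a \<Rightarrow> 'a" where
  "mean_velocity U x x' = r *\<^sub>R ((1 / h) *\<^sub>R (x' - x) - (h / 2) *\<^sub>R gradient U x')"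

lemma obabo_step_eq:
  "obabo_step h \<gamma> U z \<xi> = (let x' = lookahead U z + (h * \<sigma>) *\<^sub>R fst \<xi>
     in (x', mean_velocity U (fst z) x' + \<sigma> *\<^sub>R snd \<xi>))"
proof (cases z, cases \<xi>)
  fix x v \<xi>1 \<xi>2 assume z: "z = (x, v)" "\<xi> = (\<xi>1, \<xi>2)"
  have e: "sqrt (1 - r\<^sup>2) = \<sigma>" using r_sq by (simp add: \<sigma>_def)
  define x' where "x' = x + h *\<^sub>R (r *\<^sub>R v + \<sigma> *\<^sub>R \<xi>1 - (h / 2) *\<^sub>R gradient U x)"
  have 1: "lookahead U z + (h * \<sigma>) *\<^sub>R \<xi>1 = x'" by (simp add: z lookahead_def x'_def algebra_simps)
  have 2: "(1 / h) *\<^sub>R (x' - x) = r *\<^sub>R v + \<sigma> *\<^sub>R \<xi>1 - (h / 2) *\<^sub>R gradient U x"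
    using h_pos by (simp add: x'_def)
  show ?thesis
    unfolding obabo_step_def Let_def z(2) fst_conv snd_conv 1
    unfolding z case_prod_conv r_def[symmetric] e mean_velocity_def fst_conv 2 x'_def[symmetric] ..
qed

lemma fst_obabo_step: "fst (obabo_step h \<gamma> U z \<xi>) = lookahead U z + (h * \<sigma>) *\<^sub>R fst \<xi>"
  by (simp add: obabo_step_eq Let_def)

text \<open>Two gradient half-kicks, one damped by \<open>r\<^sup>2 = \<beta>\<close>, meet at the intermediate position and add up to
  the step size \<open>s\<close>; the damped velocity becomes the momentum term \<open>\<beta>\<close>.\<close>

lemma lookahead_obabo_step:
  fixes U :: "'a::euclidean_space \<Rightarrow> real"
  defines "x' z \<xi> \<equiv> fst (obabo_step h \<gamma> U z \<xi>)"
  shows "lookahead U (obabo_step h \<gamma> U z \<xi>) = x' z \<xi> + \<beta> *\<^sub>R (x' z \<xi> - fst z) - s *\<^sub>R gradient U (x' z \<xi>) + (h * r * \<sigma>) *\<^sub>R snd \<xi>"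
proof -
  define X where "X = x' z \<xi>"
  have sv: "snd (obabo_step h \<gamma> U z \<xi>) = mean_velocity U (fst z) X + \<sigma> *\<^sub>R snd \<xi>"
    by (simp add: obabo_step_eq Let_def X_def x'_def)
  have rb: "\<beta> = r * r" using r_sq by (simp add: power2_eq_square)
  have "lookahead U (obabo_step h \<gamma> U z \<xi>) = X + h *\<^sub>R (r *\<^sub>R (mean_velocity U (fst z) X + \<sigma> *\<^sub>R snd \<xi>) - (h / 2) *\<^sub>R gradient U X)"
    unfolding lookahead_def sv by (simp add: X_def x'_def)
  also have "\<dots> = X + (h * r * r * (1 / h)) *\<^sub>R (X - fst z) - (h * r * r * (h / 2) + h * (h / 2)) *\<^sub>R gradient U X + (h * r * \<sigma>) *\<^sub>R snd \<xi>"
    by (simp add: mean_velocity_def algebra_simps)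
  also have "h * r * r * (1 / h) = \<beta>" using h_pos rb by simp
  also have "h * r * r * (h / 2) + h * (h / 2) = s" unfolding s_def rb by (simp add: power2_eq_square algebra_simps)
  finally show ?thesis by (simp add: X_def)
qed

text \<open>Recentring at three consecutive points of a reference orbit, for the affine gradient \<open>\<mu> x + c0\<close>: the
  deviation obeys the linear recursion with coefficients \<open>a\<close> and \<open>\<beta>\<close>, driven by the noise and by the
  difference between the true and the affine gradient.\<close>

lemma heavy_ball_step:
  fixes U :: "'a::euclidean_space \<Rightarrow> real"
  assumes p2: "p2 = (1 + \<beta>) *\<^sub>R p1 - \<beta> *\<^sub>R p0 - s *\<^sub>R (\<mu> *\<^sub>R p1 + c0)" and a: "a = 1 + \<beta> - s * \<mu>"
  shows "(lookahead U (obabo_step h \<gamma> U z \<xi>) - p2, fst (obabo_step h \<gamma> U z \<xi>) - p1)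
    = (a *\<^sub>R (lookahead U z - p1) - \<beta> *\<^sub>R (fst z - p0), lookahead U z - p1)
      + ((a * h * \<sigma>) *\<^sub>R fst \<xi> + (h * r * \<sigma>) *\<^sub>R snd \<xi>
         - s *\<^sub>R (gradient U (fst (obabo_step h \<gamma> U z \<xi>)) - \<mu> *\<^sub>R fst (obabo_step h \<gamma> U z \<xi>) - c0), (h * \<sigma>) *\<^sub>R fst \<xi>)"
proof -
  define g where "g = gradient U (fst (obabo_step h \<gamma> U z \<xi>))"
  show ?thesis unfolding lookahead_obabo_step g_def[symmetric] unfolding fst_obabo_step p2 a
    by (simp add: algebra_simps)
qed

text \<open>The norm and all constants depend only on \<open>h\<close>, \<open>\<gamma>\<close> and \<open>\<mu>\<close>, not on the potential, the orbit or
  the error \<open>E\<close>. This uniformity is what allows the dilation parameter to vary later.\<close>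

lemma heavy_ball_contraction:
  assumes a: "\<bar>1 + \<beta> - s * \<mu>\<bar> < 1 + \<beta>"
  obtains N :: "'a::euclidean_space \<times> 'a \<Rightarrow> real" and c C \<theta> where
    "0 < \<theta>" "\<theta> < 1" "0 < c" "0 < C"
    "\<And>p. c * norm p \<le> N p" "\<And>p. N p \<le> C * norm p" "continuous_on UNIV N"
    "\<And>U z \<xi> p0 p1 p2 c0 E. p2 = (1 + \<beta>) *\<^sub>R p1 - \<beta> *\<^sub>R p0 - s *\<^sub>R (\<mu> *\<^sub>R p1 + c0) \<Longrightarrow>
      norm (gradient U (fst (obabo_step h \<gamma> U z \<xi>)) - \<mu> *\<^sub>R fst (obabo_step h \<gamma> U z \<xi>) - c0) \<le> E \<Longrightarrow>
      N (lookahead U (obabo_step h \<gamma> U z \<xi>) - p2, fst (obabo_step h \<gamma> U z \<xi>) - p1)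
        \<le> \<theta> * N (lookahead U z - p1, fst z - p0) + C * (norm (fst \<xi>) + norm (snd \<xi>) + E)"
proof -
  define a where "a = 1 + \<beta> - s * \<mu>"
  obtain \<theta> c C and N :: "'a \<times> 'a \<Rightarrow> real" where N: "0 < \<theta>" "\<theta> < 1" "0 < c" "0 < C"
    "\<And>p q. N (p + q) \<le> N p + N q" "\<And>p. c * norm p \<le> N p" "\<And>p. N p \<le> C * norm p"
    "\<And>u w. N (a *\<^sub>R u - \<beta> *\<^sub>R w, u) \<le> \<theta> * N (u, w)"
    by (rule heavy_ball_norm[OF \<beta> a[folded a_def]]) (rule that, assumption+)
  have cont: "continuous_on UNIV N"
  proof (rule continuous_on_iff[THEN iffD2])
    show "\<forall>x\<in>UNIV. \<forall>e>0. \<exists>d>0. \<forall>x'\<in>UNIV. dist x' x < d \<longrightarrow> dist (N x') (N x) < e"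
    proof (intro ballI allI impI)
      fix x and e :: real assume e: "0 < e"
      have "dist (N x') (N x) < e" if "dist x' x < e / C" for x'
      proof -
        have "N x' \<le> N x + N (x' - x)" "N x \<le> N x' + N (x - x')" using N(5)[of x "x' - x"] N(5)[of x' "x - x'"] by simp_all
        moreover have "N (x' - x) \<le> C * dist x' x" "N (x - x') \<le> C * dist x' x"
          using N(7)[of "x' - x"] N(7)[of "x - x'"] by (simp_all add: dist_norm norm_minus_commute)
        moreover have "C * dist x' x < e" using that N(4) by (simp add: field_simps)
        ultimately show ?thesis by (simp add: dist_real_def)
      qed
      then show "\<exists>d>0. \<forall>x'\<in>UNIV. dist x' x < d \<longrightarrow> dist (N x') (N x) < e"
        using e N(4) by (intro exI[of _ "e / C"]) auto
    qed
  qed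
  define C1 where "C1 = C * (1 + \<bar>a * h * \<sigma>\<bar> + \<bar>h * r * \<sigma>\<bar> + s + \<bar>h * \<sigma>\<bar>)"
  have C1: "C \<le> C1" unfolding C1_def using N(4) s_pos by (intro mult_left_mono[of 1 _ C, simplified]) auto
  show ?thesis
  proof (rule that[of \<theta> c C1 N])
    show "N p \<le> C1 * norm p" for p using N(7)[of p] C1 by (meson mult_right_mono norm_ge_zero order_trans)
    fix U :: "'a \<Rightarrow> real" and z \<xi> p0 p1 p2 c0 E
    assume p2: "p2 = (1 + \<beta>) *\<^sub>R p1 - \<beta> *\<^sub>R p0 - s *\<^sub>R (\<mu> *\<^sub>R p1 + c0)"
      and E: "norm (gradient U (fst (obabo_step h \<gamma> U z \<xi>)) - \<mu> *\<^sub>R fst (obabo_step h \<gamma> U z \<xi>) - c0) \<le> E"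
    define d where "d = gradient U (fst (obabo_step h \<gamma> U z \<xi>)) - \<mu> *\<^sub>R fst (obabo_step h \<gamma> U z \<xi>) - c0"
    define w where "w = (a * h * \<sigma>) *\<^sub>R fst \<xi> + (h * r * \<sigma>) *\<^sub>R snd \<xi> - s *\<^sub>R d"
    have dE: "norm d \<le> E" using E by (simp add: d_def)
    have "norm w \<le> norm ((a * h * \<sigma>) *\<^sub>R fst \<xi>) + norm ((h * r * \<sigma>) *\<^sub>R snd \<xi>) + norm (s *\<^sub>R d)"
      unfolding w_def by (meson norm_triangle_ineq norm_triangle_ineq4 order_trans add_right_mono)
    also have "\<dots> = \<bar>a * h * \<sigma>\<bar> * norm (fst \<xi>) + \<bar>h * r * \<sigma>\<bar> * norm (snd \<xi>) + s * norm d"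
      using s_pos by simp
    also have "\<dots> \<le> \<bar>a * h * \<sigma>\<bar> * norm (fst \<xi>) + \<bar>h * r * \<sigma>\<bar> * norm (snd \<xi>) + s * E"
      using s_pos by (intro add_left_mono mult_left_mono dE) simp
    finally have nw: "norm w \<le> \<bar>a * h * \<sigma>\<bar> * norm (fst \<xi>) + \<bar>h * r * \<sigma>\<bar> * norm (snd \<xi>) + s * E" .
    have E0: "0 \<le> E" using dE norm_ge_zero[of d] by linarith
    have "norm (w, (h * \<sigma>) *\<^sub>R fst \<xi>) \<le> norm w + norm ((h * \<sigma>) *\<^sub>R fst \<xi>)"
      using norm_Pair_le[of w "(h * \<sigma>) *\<^sub>R fst \<xi>"] by simp
    also have "\<dots> \<le> (\<bar>a * h * \<sigma>\<bar> * norm (fst \<xi>) + \<bar>h * r * \<sigma>\<bar> * norm (snd \<xi>) + s * E) + \<bar>h * \<sigma>\<bar> * norm (fst \<xi>)"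
      using nw by simp
    also have "\<dots> \<le> (1 + \<bar>a * h * \<sigma>\<bar> + \<bar>h * r * \<sigma>\<bar> + s + \<bar>h * \<sigma>\<bar>) * (norm (fst \<xi>) + norm (snd \<xi>) + E)"
    proof -
      have "0 \<le> (1 + \<bar>h * r * \<sigma>\<bar> + s) * norm (fst \<xi>) + (1 + \<bar>a * h * \<sigma>\<bar> + s + \<bar>h * \<sigma>\<bar>) * norm (snd \<xi>) + (1 + \<bar>a * h * \<sigma>\<bar> + \<bar>h * r * \<sigma>\<bar> + \<bar>h * \<sigma>\<bar>) * E"
        using E0 s_pos by (intro add_nonneg_nonneg mult_nonneg_nonneg) auto
      then show ?thesis by (simp add: algebra_simps)
    qed
    finally have "C * norm (w, (h * \<sigma>) *\<^sub>R fst \<xi>) \<le> C1 * (norm (fst \<xi>) + norm (snd \<xi>) + E)"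
      unfolding C1_def mult.assoc using N(4) by (intro mult_left_mono) auto
    then have noise: "N (w, (h * \<sigma>) *\<^sub>R fst \<xi>) \<le> C1 * (norm (fst \<xi>) + norm (snd \<xi>) + E)"
      using N(7) order_trans by blast
    have "N (lookahead U (obabo_step h \<gamma> U z \<xi>) - p2, fst (obabo_step h \<gamma> U z \<xi>) - p1)
      = N ((a *\<^sub>R (lookahead U z - p1) - \<beta> *\<^sub>R (fst z - p0), lookahead U z - p1) + (w, (h * \<sigma>) *\<^sub>R fst \<xi>))"
      unfolding heavy_ball_step[OF p2 a_def, of U z \<xi>] w_def d_def ..
    also have "\<dots> \<le> N (a *\<^sub>R (lookahead U z - p1) - \<beta> *\<^sub>R (fst z - p0), lookahead U z - p1) + N (w, (h * \<sigma>) *\<^sub>R fst \<xi>)"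
      by (rule N(5))
    also have "\<dots> \<le> \<theta> * N (lookahead U z - p1, fst z - p0) + C1 * (norm (fst \<xi>) + norm (snd \<xi>) + E)"
      by (intro add_mono N(8) noise)
    finally show "N (lookahead U (obabo_step h \<gamma> U z \<xi>) - p2, fst (obabo_step h \<gamma> U z \<xi>) - p1)
        \<le> \<theta> * N (lookahead U z - p1, fst z - p0) + C1 * (norm (fst \<xi>) + norm (snd \<xi>) + E)" .
  qed (use N C1 cont in auto)
qed

subsection \<open>The transition kernel and its density\<close>

lemma measurable_lookahead[measurable]:
  assumes g[measurable]: "gradient U \<in> borel_measurable borel"
  shows "lookahead U \<in> borel_measurable borel"
proof -
  have [measurable]: "fst \<in> borel_measurable (borel :: ('a \<times> 'a) measure)" "snd \<in> borel_measurable (borel :: ('a \<times> 'a) measure)"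
    by (intro borel_measurable_continuous_onI continuous_intros)+
  show ?thesis unfolding lookahead_def[abs_def] by measurable
qed

lemma measurable_mean_velocity[measurable (raw)]:
  assumes g[measurable]: "gradient U \<in> borel_measurable borel" and [measurable]: "f \<in> borel_measurable M" "k \<in> borel_measurable M"
  shows "(\<lambda>p. mean_velocity U (f p) (k p)) \<in> borel_measurable M"
  unfolding mean_velocity_def by measurable

lemma step_measurable:
  fixes U :: "'a::euclidean_space \<Rightarrow> real"
  assumes [measurable]: "gradient U \<in> borel_measurable borel"
  shows "(\<lambda>(z, \<xi>). obabo_step h \<gamma> U z \<xi>) \<in> measurable (borel \<Otimes>\<^sub>M (std_gaussian \<Otimes>\<^sub>M std_gaussian)) borel"
proof -
  note [measurable] = measurable_lookahead[OF assms]
  have [measurable]: "fst \<in> borel_measurable (borel :: ('a \<times> 'a) measure)"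
    by (intro borel_measurable_continuous_onI continuous_intros)
  have "(\<lambda>p :: ('a \<times> 'a) \<times> ('a \<times> 'a). (lookahead U (fst p) + (h * \<sigma>) *\<^sub>R fst (snd p),
      mean_velocity U (fst (fst p)) (lookahead U (fst p) + (h * \<sigma>) *\<^sub>R fst (snd p)) + \<sigma> *\<^sub>R snd (snd p)))
    \<in> measurable (borel \<Otimes>\<^sub>M (std_gaussian \<Otimes>\<^sub>M std_gaussian)) (borel \<Otimes>\<^sub>M borel)"
    by measurable
  then show ?thesis by (simp add: borel_prod obabo_step_eq Let_def case_prod_beta')
qed

lemma noise_prob: "prob_space (std_gaussian \<Otimes>\<^sub>M std_gaussian :: ('a::euclidean_space \<times> 'a) measure)"
proof -
  interpret pair_prob_space "std_gaussian :: 'a measure" "std_gaussian :: 'a measure"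
    by (simp add: pair_prob_space_def pair_sigma_finite_def prob_space_std_gaussian prob_space_imp_sigma_finite)
  show ?thesis by unfold_locales
qed

lemma step_measurable':
  assumes "gradient U \<in> borel_measurable borel"
  shows "obabo_step h \<gamma> U z \<in> measurable (std_gaussian \<Otimes>\<^sub>M std_gaussian) borel"
  using measurable_compose[OF measurable_Pair1' step_measurable[OF assms], of z] by simp

lemma kernel_measurable:
  fixes U :: "'a::euclidean_space \<Rightarrow> real"
  assumes g: "gradient U \<in> borel_measurable borel"
  shows "obabo_kernel h \<gamma> U \<in> measurable borel (subprob_algebra borel)"
  unfolding obabo_kernel_def[abs_def]
proof (rule measurable_distr2)
  show "(\<lambda>z. std_gaussian \<Otimes>\<^sub>M std_gaussian :: ('a \<times> 'a) measure) \<in> borel \<rightarrow>\<^sub>M subprob_algebra (std_gaussian \<Otimes>\<^sub>M std_gaussian)"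
    by (intro measurable_const) (simp add: space_subprob_algebra prob_space_imp_subprob_space noise_prob)
qed (rule step_measurable[OF g])

lemma kernel_prob:
  assumes g: "gradient U \<in> borel_measurable borel"
  shows "prob_space (obabo_kernel h \<gamma> U z)"
  unfolding obabo_kernel_def by (rule prob_space.prob_space_distr[OF noise_prob step_measurable'[OF g]])

lemma sets_kernel[simp]: "sets (obabo_kernel h \<gamma> U z) = sets borel"
  by (simp add: obabo_kernel_def)

lemma nn_integral_kernel:
  fixes U :: "'a::euclidean_space \<Rightarrow> real"
  assumes g: "gradient U \<in> borel_measurable borel" and f: "f \<in> borel_measurable borel"
  shows "(\<integral>\<^sup>+y. f y \<partial>obabo_kernel h \<gamma> U z) = (\<integral>\<^sup>+\<xi>1. (\<integral>\<^sup>+\<xi>2. f (obabo_step h \<gamma> U z (\<xi>1, \<xi>2)) \<partial>std_gaussian) \<partial>std_gaussian)"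
proof -
  interpret G: prob_space "std_gaussian :: 'a measure" by (rule prob_space_std_gaussian)
  have "(\<integral>\<^sup>+y. f y \<partial>obabo_kernel h \<gamma> U z) = (\<integral>\<^sup>+\<xi>. f (obabo_step h \<gamma> U z \<xi>) \<partial>(std_gaussian \<Otimes>\<^sub>M std_gaussian))"
    unfolding obabo_kernel_def by (rule nn_integral_distr[OF step_measurable'[OF g]]) (simp add: f)
  also have "\<dots> = (\<integral>\<^sup>+\<xi>1. (\<integral>\<^sup>+\<xi>2. f (obabo_step h \<gamma> U z (\<xi>1, \<xi>2)) \<partial>std_gaussian) \<partial>std_gaussian)"
    by (rule G.nn_integral_fst[symmetric]) (rule measurable_compose[OF step_measurable'[OF g] f])
  finally show ?thesis .
qed

text \<open>The two noises enter one after the other: the first determines the new position, and given that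
  position the second determines the new velocity. So the density is a product.\<close>

definition transition_density :: "('a::euclidean_space \<Rightarrow> real) \<Rightarrow> 'a \<times> 'a \<Rightarrow> 'a \<times> 'a \<Rightarrow> real" where
  "transition_density U z y =
     gaussian_density ((fst y - lookahead U z) /\<^sub>R (h * \<sigma>)) / (h * \<sigma>) ^ DIM('a)
     * (gaussian_density ((snd y - mean_velocity U (fst z) (fst y)) /\<^sub>R \<sigma>) / \<sigma> ^ DIM('a))"

lemma transition_density_measurable:
  fixes U :: "'a::euclidean_space \<Rightarrow> real"
  assumes g[measurable]: "gradient U \<in> borel_measurable borel"
  shows "(\<lambda>(z, y). transition_density U z y) \<in> borel_measurable borel"
proof -
  note [measurable] = measurable_lookahead[OF assms]
  have [measurable]: "fst \<in> borel_measurable (borel :: ('a \<times> 'a) measure)" "snd \<in> borel_measurable (borel :: ('a \<times> 'a) measure)"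
    by (intro borel_measurable_continuous_onI continuous_intros)+
  have "(\<lambda>(z, y). transition_density U z y) \<in> borel_measurable (borel \<Otimes>\<^sub>M borel)"
    unfolding transition_density_def by measurable
  then show ?thesis by (simp add: borel_prod)
qed

lemma kernel_density:
  fixes U :: "'a::euclidean_space \<Rightarrow> real"
  assumes g[measurable]: "gradient U \<in> borel_measurable borel" and f: "f \<in> borel_measurable borel"
  shows "(\<integral>\<^sup>+y. f y \<partial>obabo_kernel h \<gamma> U z) = (\<integral>\<^sup>+y. ennreal (transition_density U z y) * f y \<partial>lborel)"
proof -
  have hs: "0 < h * \<sigma>" using h_pos \<sigma>_pos by simp
  have f2[measurable]: "f \<in> borel_measurable (borel \<Otimes>\<^sub>M borel)" using f by (simp add: borel_prod)
  let ?d2 = "\<lambda>x' v'. gaussian_density ((v' - mean_velocity U (fst z) x') /\<^sub>R \<sigma>) / \<sigma> ^ DIM('a)"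
  let ?d1 = "\<lambda>x'. gaussian_density ((x' - lookahead U z) /\<^sub>R (h * \<sigma>)) / (h * \<sigma>) ^ DIM('a)"
  have "(\<integral>\<^sup>+y. f y \<partial>obabo_kernel h \<gamma> U z)
    = (\<integral>\<^sup>+\<xi>1. (\<integral>\<^sup>+\<xi>2. f (lookahead U z + (h * \<sigma>) *\<^sub>R \<xi>1, mean_velocity U (fst z) (lookahead U z + (h * \<sigma>) *\<^sub>R \<xi>1) + \<sigma> *\<^sub>R \<xi>2) \<partial>std_gaussian) \<partial>std_gaussian)"
    unfolding nn_integral_kernel[OF g f] by (simp add: obabo_step_eq Let_def)
  also have "\<dots> = (\<integral>\<^sup>+\<xi>1. (\<integral>\<^sup>+v'. ennreal (?d2 (lookahead U z + (h * \<sigma>) *\<^sub>R \<xi>1) v') * f (lookahead U z + (h * \<sigma>) *\<^sub>R \<xi>1, v') \<partial>lborel) \<partial>std_gaussian)"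
    by (intro nn_integral_cong nn_integral_gaussian_affine \<sigma>_pos) measurable
  also have "\<dots> = (\<integral>\<^sup>+x'. ennreal (?d1 x') * (\<integral>\<^sup>+v'. ennreal (?d2 x' v') * f (x', v') \<partial>lborel) \<partial>lborel)"
    by (rule nn_integral_gaussian_affine[OF hs]) measurable
  also have "\<dots> = (\<integral>\<^sup>+x'. (\<integral>\<^sup>+v'. ennreal (transition_density U z (x', v')) * f (x', v') \<partial>lborel) \<partial>lborel)"
  proof (intro nn_integral_cong)
    fix x' :: 'a
    have "ennreal (?d1 x') * (\<integral>\<^sup>+v'. ennreal (?d2 x' v') * f (x', v') \<partial>lborel) = (\<integral>\<^sup>+v'. ennreal (?d1 x') * (ennreal (?d2 x' v') * f (x', v')) \<partial>lborel)"
      by (rule nn_integral_cmult[symmetric]) measurable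
    also have "\<dots> = (\<integral>\<^sup>+v'. ennreal (transition_density U z (x', v')) * f (x', v') \<partial>lborel)"
    proof (intro nn_integral_cong)
      fix v' :: 'a
      have "ennreal (transition_density U z (x', v')) = ennreal (?d1 x') * ennreal (?d2 x' v')"
        unfolding transition_density_def fst_conv snd_conv
        by (rule ennreal_mult) (use hs \<sigma>_pos in \<open>auto intro!: divide_nonneg_pos less_imp_le[OF gaussian_density_pos] simp del: inverse_mult_distrib\<close>)
      then show "ennreal (?d1 x') * (ennreal (?d2 x' v') * f (x', v')) = ennreal (transition_density U z (x', v')) * f (x', v')"
        by (simp only: mult.assoc)
    qed
    finally show "ennreal (?d1 x') * (\<integral>\<^sup>+v'. ennreal (?d2 x' v') * f (x', v') \<partial>lborel) = (\<integral>\<^sup>+v'. ennreal (transition_density U z (x', v')) * f (x', v') \<partial>lborel)" .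
  qed
  also have "\<dots> = (\<integral>\<^sup>+y. ennreal (transition_density U z y) * f y \<partial>(lborel \<Otimes>\<^sub>M lborel))"
  proof (rule lborel.nn_integral_fst)
    have [measurable]: "transition_density U z \<in> borel_measurable (borel \<Otimes>\<^sub>M borel)"
      unfolding transition_density_def[abs_def] by measurable
    show "(\<lambda>y. ennreal (transition_density U z y) * f y) \<in> borel_measurable (lborel \<Otimes>\<^sub>M lborel)" by measurable
  qed
  finally show ?thesis by (simp add: lborel_prod)
qed

end

section \<open>Moments and the invariant law\<close>

context obabo begin

text \<open>The velocity is recovered from the look-ahead point, the position and the gradient there.\<close>

lemma position_velocity_bound:
  fixes U :: "'a::euclidean_space \<Rightarrow> real"
  assumes E: "norm (gradient U (fst z) - \<mu> *\<^sub>R fst z) \<le> E"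
  shows "norm z \<le> (1 + (2 / h + h / 2 * \<bar>\<mu>\<bar>) / r) * norm (lookahead U z, fst z) + (h / 2 / r) * E"
proof -
  obtain x v where z: "z = (x, v)" by (cases z)
  define u where "u = lookahead U z"
  define g where "g = gradient U x"
  have "h *\<^sub>R (r *\<^sub>R v) = u - x + (h * (h / 2)) *\<^sub>R g"
    by (simp add: u_def lookahead_def z g_def algebra_simps)
  then have "(1 / (h * r)) *\<^sub>R (h *\<^sub>R (r *\<^sub>R v)) = (1 / (h * r)) *\<^sub>R (u - x + (h * (h / 2)) *\<^sub>R g)" by simp
  then have v: "v = (1 / (h * r)) *\<^sub>R (u - x) + (h / 2 / r) *\<^sub>R g"
    using h_pos r_pos by (simp add: scaleR_add_right)
  have gn: "norm g \<le> \<bar>\<mu>\<bar> * norm x + E"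
    using norm_triangle_ineq[of "g - \<mu> *\<^sub>R x" "\<mu> *\<^sub>R x"] E by (simp add: g_def z)
  define n where "n = norm (u, x)"
  have un: "norm u \<le> n" "norm x \<le> n" using norm_fst_le[of u x] norm_snd_le[of x u] by (auto simp: n_def)
  have "norm v \<le> (1 / (h * r)) * norm (u - x) + (h / 2 / r) * norm g"
    unfolding v using h_pos r_pos by (intro order_trans[OF norm_triangle_ineq]) simp
  also have "\<dots> \<le> (1 / (h * r)) * (2 * n) + (h / 2 / r) * (\<bar>\<mu>\<bar> * n + E)"
  proof (intro add_mono mult_left_mono)
    show "norm (u - x) \<le> 2 * n" using norm_triangle_ineq4[of u x] un by linarith
    show "norm g \<le> \<bar>\<mu>\<bar> * n + E" using gn mult_left_mono[OF un(2), of "\<bar>\<mu>\<bar>"] by simp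
  qed (use h_pos r_pos in auto)
  also have "\<dots> = ((2 / h + h / 2 * \<bar>\<mu>\<bar>) / r) * n + (h / 2 / r) * E"
    using h_pos r_pos by (simp add: field_simps)
  finally have "norm v \<le> ((2 / h + h / 2 * \<bar>\<mu>\<bar>) / r) * n + (h / 2 / r) * E" .
  moreover have "norm z \<le> norm x + norm v" unfolding z by (rule norm_Pair_le)
  ultimately show ?thesis using un unfolding n_def[symmetric] u_def[symmetric] by (simp add: z distrib_right n_def u_def)
qed

text \<open>If the gradient differs from \<open>\<mu> x\<close> by at most \<open>E\<close>, the noiseless step is a bounded perturbation of a contraction. Squaring
  keeps a factor \<open>\<theta> < 1\<close> by convexity: \<open>(\<theta> n + e)\<^sup>2 \<le> \<theta> n\<^sup>2 + e\<^sup>2 / (1 - \<theta>)\<close>.\<close>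

lemma quadratic_drift:
  assumes a: "\<bar>1 + \<beta> - s * \<mu>\<bar> < 1 + \<beta>"
  obtains N :: "'a::euclidean_space \<times> 'a \<Rightarrow> real" and c C \<theta> b where
    "0 < \<theta>" "\<theta> < 1" "0 < c" "0 < C" "0 < b" "\<And>p. c * norm p \<le> N p" "\<And>p. N p \<le> C * norm p" "continuous_on UNIV N"
    "\<And>U E z. gradient U \<in> borel_measurable borel \<Longrightarrow> (\<And>x. norm (gradient U x - \<mu> *\<^sub>R x) \<le> E) \<Longrightarrow>
      (\<integral>\<^sup>+y. ennreal ((N (lookahead U y, fst y))\<^sup>2) \<partial>obabo_kernel h \<gamma> U z)
        \<le> ennreal (\<theta> * (N (lookahead U z, fst z))\<^sup>2 + b * (1 + E\<^sup>2))"
proof -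
  obtain \<theta> c C and N :: "'a \<times> 'a \<Rightarrow> real" where N: "0 < \<theta>" "\<theta> < 1" "0 < c" "0 < C"
    "\<And>p. c * norm p \<le> N p" "\<And>p. N p \<le> C * norm p" "continuous_on UNIV N" and
    con: "\<And>U z \<xi> p0 p1 p2 c0 E. p2 = (1 + \<beta>) *\<^sub>R p1 - \<beta> *\<^sub>R p0 - s *\<^sub>R (\<mu> *\<^sub>R p1 + c0) \<Longrightarrow>
      norm (gradient U (fst (obabo_step h \<gamma> U z \<xi>)) - \<mu> *\<^sub>R fst (obabo_step h \<gamma> U z \<xi>) - c0) \<le> E \<Longrightarrow>
      N (lookahead U (obabo_step h \<gamma> U z \<xi>) - p2, fst (obabo_step h \<gamma> U z \<xi>) - p1)
        \<le> \<theta> * N (lookahead U z - p1, fst z - p0) + C * (norm (fst \<xi>) + norm (snd \<xi>) + E)"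
    by (rule heavy_ball_contraction[OF a]) (rule that, assumption+)
  define m2 where "m2 = 4 * sqrt 2 ^ DIM('a)"
  have m2: "0 < m2" by (simp add: m2_def)
  define b0 where "b0 = 3 * C\<^sup>2 / (1 - \<theta>)"
  have b0: "0 < b0" using N by (simp add: b0_def)
  define b where "b = b0 * (2 * m2 + 1)"
  have b: "0 < b" using b0 m2 by (simp add: b_def)
  show ?thesis
  proof (rule that[of \<theta> c C b N])
    fix U :: "'a \<Rightarrow> real" and E z
    assume g: "gradient U \<in> borel_measurable borel" and E: "\<And>x. norm (gradient U x - \<mu> *\<^sub>R x) \<le> E"
    define V where "V = (\<lambda>y. (N (lookahead U y, fst y))\<^sup>2)"
    have N0: "0 \<le> N p" for p using N(5)[of p] N(3) by (smt (verit) mult_nonneg_nonneg norm_ge_zero)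
    have step: "V (obabo_step h \<gamma> U z \<xi>) \<le> (\<theta> * V z + b0 * E\<^sup>2) + b0 * (norm (fst \<xi>))\<^sup>2 + b0 * (norm (snd \<xi>))\<^sup>2" for \<xi>
    proof -
      define w where "w = norm (fst \<xi>) + norm (snd \<xi>) + E"
      have E0: "0 \<le> E" using E[of 0] by (meson norm_ge_zero order_trans)
      have w2: "w\<^sup>2 \<le> 3 * ((norm (fst \<xi>))\<^sup>2 + (norm (snd \<xi>))\<^sup>2 + E\<^sup>2)"
      proof -
        have "0 \<le> (norm (fst \<xi>) - norm (snd \<xi>))\<^sup>2 + (norm (fst \<xi>) - E)\<^sup>2 + (norm (snd \<xi>) - E)\<^sup>2" by simp
        then show ?thesis by (simp add: w_def power2_eq_square algebra_simps)
      qed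
      have "N (lookahead U (obabo_step h \<gamma> U z \<xi>), fst (obabo_step h \<gamma> U z \<xi>)) \<le> \<theta> * N (lookahead U z, fst z) + C * w"
        using con[of 0 0 0 0 U z \<xi> E] E by (simp add: w_def)
      then have "V (obabo_step h \<gamma> U z \<xi>) \<le> (\<theta> * N (lookahead U z, fst z) + C * w)\<^sup>2"
        unfolding V_def by (intro power_mono N0)
      also have "\<dots> \<le> \<theta> * V z + (C * w)\<^sup>2 / (1 - \<theta>)"
      proof -
        define n where "n = N (lookahead U z, fst z)"
        define e where "e = C * w"
        define f where "f = e / (1 - \<theta>)"
        have e: "e = (1 - \<theta>) * f" "e\<^sup>2 / (1 - \<theta>) = (1 - \<theta>) * f\<^sup>2"
          using N(2) by (simp_all add: f_def power2_eq_square)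
        have "0 \<le> \<theta> * (1 - \<theta>) * (n - f)\<^sup>2" using N by simp
        also have "\<dots> = \<theta> * n\<^sup>2 + (1 - \<theta>) * f\<^sup>2 - (\<theta> * n + (1 - \<theta>) * f)\<^sup>2"
          by (simp add: power2_eq_square algebra_simps)
        also have "\<dots> = \<theta> * n\<^sup>2 + e\<^sup>2 / (1 - \<theta>) - (\<theta> * n + e)\<^sup>2"
          by (simp only: e(2)) (simp only: e(1))
        finally show ?thesis by (simp add: V_def n_def e_def)
      qed
      also have "(C * w)\<^sup>2 / (1 - \<theta>) = C\<^sup>2 / (1 - \<theta>) * w\<^sup>2" by (simp add: power_mult_distrib)
      also have "\<theta> * V z + C\<^sup>2 / (1 - \<theta>) * w\<^sup>2 \<le> \<theta> * V z + C\<^sup>2 / (1 - \<theta>) * (3 * ((norm (fst \<xi>))\<^sup>2 + (norm (snd \<xi>))\<^sup>2 + E\<^sup>2))"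
        using N(2) by (intro add_left_mono mult_left_mono w2) auto
      also have "\<dots> = (\<theta> * V z + b0 * E\<^sup>2) + b0 * (norm (fst \<xi>))\<^sup>2 + b0 * (norm (snd \<xi>))\<^sup>2"
        by (simp add: b0_def algebra_simps)
      finally show ?thesis .
    qed
    note [measurable] = measurable_lookahead[OF g]
    have [measurable]: "fst \<in> borel_measurable (borel :: ('a \<times> 'a) measure)"
      by (intro borel_measurable_continuous_onI continuous_intros)
    have [measurable]: "N \<in> borel_measurable (borel \<Otimes>\<^sub>M borel)"
      using borel_measurable_continuous_onI[OF N(7)] by (simp add: borel_prod)
    have Vm: "V \<in> borel_measurable borel" unfolding V_def by measurable
    define K where "K = \<theta> * V z + b0 * E\<^sup>2"
    have K0: "0 \<le> K" using N b0 by (simp add: K_def V_def)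
    interpret G: prob_space "std_gaussian :: 'a measure" by (rule prob_space_std_gaussian)
    have GU: "emeasure (std_gaussian :: 'a measure) UNIV = 1" using G.emeasure_space_1 by simp
    have G2: "(\<integral>\<^sup>+\<xi>. c + ennreal b0 * ennreal ((norm \<xi>)\<^sup>2) \<partial>(std_gaussian :: 'a measure)) \<le> c + ennreal (b0 * m2)" for c :: ennreal
    proof -
      have "(\<integral>\<^sup>+\<xi>. c + ennreal b0 * ennreal ((norm \<xi>)\<^sup>2) \<partial>(std_gaussian :: 'a measure))
        = c + ennreal b0 * (\<integral>\<^sup>+\<xi>. ennreal ((norm \<xi>)\<^sup>2) \<partial>(std_gaussian :: 'a measure))"
        by (subst nn_integral_add) (simp_all add: nn_integral_cmult GU)
      also have "\<dots> \<le> c + ennreal b0 * ennreal m2"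
        unfolding m2_def by (intro add_left_mono mult_left_mono gaussian_second_moment) simp
      finally show ?thesis using b0 m2 by (simp add: ennreal_mult)
    qed
    have "(\<integral>\<^sup>+y. ennreal (V y) \<partial>obabo_kernel h \<gamma> U z)
      = (\<integral>\<^sup>+\<xi>1. (\<integral>\<^sup>+\<xi>2. ennreal (V (obabo_step h \<gamma> U z (\<xi>1, \<xi>2))) \<partial>std_gaussian) \<partial>std_gaussian)"
      by (rule nn_integral_kernel[OF g]) (use Vm in measurable)
    also have "\<dots> \<le> (\<integral>\<^sup>+\<xi>1. (\<integral>\<^sup>+\<xi>2. (ennreal K + ennreal b0 * ennreal ((norm \<xi>1)\<^sup>2)) + ennreal b0 * ennreal ((norm \<xi>2)\<^sup>2) \<partial>(std_gaussian :: 'a measure)) \<partial>(std_gaussian :: 'a measure))"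
    proof (intro nn_integral_mono)
      fix \<xi>1 \<xi>2 :: 'a
      have "ennreal (V (obabo_step h \<gamma> U z (\<xi>1, \<xi>2))) \<le> ennreal (K + b0 * (norm \<xi>1)\<^sup>2 + b0 * (norm \<xi>2)\<^sup>2)"
        using step[of "(\<xi>1, \<xi>2)"] by (intro ennreal_leI) (simp add: K_def)
      then show "ennreal (V (obabo_step h \<gamma> U z (\<xi>1, \<xi>2))) \<le> (ennreal K + ennreal b0 * ennreal ((norm \<xi>1)\<^sup>2)) + ennreal b0 * ennreal ((norm \<xi>2)\<^sup>2)"
        using K0 b0 by (simp add: ennreal_mult)
    qed
    also have "\<dots> \<le> (\<integral>\<^sup>+\<xi>1. (ennreal K + ennreal b0 * ennreal ((norm \<xi>1)\<^sup>2)) + ennreal (b0 * m2) \<partial>(std_gaussian :: 'a measure))"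
      by (intro nn_integral_mono G2)
    also have "\<dots> = (\<integral>\<^sup>+\<xi>1. (ennreal K + ennreal (b0 * m2)) + ennreal b0 * ennreal ((norm \<xi>1)\<^sup>2) \<partial>(std_gaussian :: 'a measure))"
      by (simp add: ac_simps)
    also have "\<dots> \<le> (ennreal K + ennreal (b0 * m2)) + ennreal (b0 * m2)" by (rule G2)
    also have "\<dots> = ennreal (K + 2 * (b0 * m2))" using K0 b0 m2 by (simp add: ennreal_plus[symmetric] del: ennreal_plus)
    also have "\<dots> \<le> ennreal (\<theta> * V z + b * (1 + E\<^sup>2))"
    proof (rule ennreal_leI)
      have "0 \<le> b0 * 1 + b0 * (2 * m2) * E\<^sup>2" using b0 m2 by (intro add_nonneg_nonneg mult_nonneg_nonneg) auto
      then show "K + 2 * (b0 * m2) \<le> \<theta> * V z + b * (1 + E\<^sup>2)" by (simp add: K_def b_def algebra_simps)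
    qed
    finally show "(\<integral>\<^sup>+y. ennreal ((N (lookahead U y, fst y))\<^sup>2) \<partial>obabo_kernel h \<gamma> U z)
        \<le> ennreal (\<theta> * (N (lookahead U z, fst z))\<^sup>2 + b * (1 + E\<^sup>2))" by (simp add: V_def)
  qed (use N b in auto)
qed

text \<open>To reach the unit ball from \<open>z\<close>, the Gaussian noises must have norms bounded in terms of the
  look-ahead point and the position. The bound \<open>L\<close> decreases in both, hence is bounded
  below on each sublevel set of the Lyapunov function.\<close>

lemma transition_density_minorization:
  fixes U :: "'a::euclidean_space \<Rightarrow> real"
  assumes g: "continuous_on UNIV (gradient U)"
  obtains L :: "real \<Rightarrow> real \<Rightarrow> real" where "\<And>p q. 0 < L p q"
    "\<And>p q p' q'. 0 \<le> p \<Longrightarrow> p \<le> p' \<Longrightarrow> 0 \<le> q \<Longrightarrow> q \<le> q' \<Longrightarrow> L p' q' \<le> L p q"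
    "continuous_on UNIV (\<lambda>z. L (fst z) (snd z))"
    "\<And>z y. norm y \<le> 1 \<Longrightarrow> L (norm (lookahead U z)) (norm (fst z)) \<le> transition_density U z y"
proof -
  obtain G where G: "\<And>x. norm x \<le> 1 \<Longrightarrow> norm (gradient U x) \<le> G" and G0: "0 \<le> G"
  proof -
    have "bounded (gradient U ` cball 0 1)"
      by (intro compact_imp_bounded compact_continuous_image continuous_on_subset[OF g]) auto
    then obtain G where "0 < G" "\<forall>y\<in>gradient U ` cball 0 1. norm y \<le> G" unfolding bounded_pos by auto
    then show ?thesis using that[of G] by auto
  qed
  define \<kappa>0 where "\<kappa>0 = ((1 / sqrt (2 * pi)) ^ DIM('a) / (h * \<sigma>) ^ DIM('a)) * ((1 / sqrt (2 * pi)) ^ DIM('a) / \<sigma> ^ DIM('a))"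
  have hs: "0 < h * \<sigma>" using h_pos \<sigma>_pos by simp
  have \<kappa>0: "0 < \<kappa>0" using hs \<sigma>_pos by (simp add: \<kappa>0_def del: zero_less_mult_iff)
  define L where "L = (\<lambda>p q. \<kappa>0 * exp (- ((1 + p) / (h * \<sigma>))\<^sup>2 / 2) * exp (- ((1 + r * ((1 + q) / h + h / 2 * G)) / \<sigma>)\<^sup>2 / 2))"
  show ?thesis
  proof (rule that[of L])
    show "0 < L p q" for p q using \<kappa>0 by (simp add: L_def)
    show "continuous_on UNIV (\<lambda>z. L (fst z) (snd z))" unfolding L_def using hs h_pos \<sigma>_pos by (intro continuous_intros) auto
    show "L p' q' \<le> L p q" if "0 \<le> p" "p \<le> p'" "0 \<le> q" "q \<le> q'" for p q p' q'
    proof -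
      have "((1 + p) / (h * \<sigma>))\<^sup>2 \<le> ((1 + p') / (h * \<sigma>))\<^sup>2"
        using that hs by (intro power_mono divide_right_mono) auto
      moreover have "((1 + r * ((1 + q) / h + h / 2 * G)) / \<sigma>)\<^sup>2 \<le> ((1 + r * ((1 + q') / h + h / 2 * G)) / \<sigma>)\<^sup>2"
        using that h_pos \<sigma>_pos r_pos G0
        by (intro power_mono divide_right_mono add_left_mono mult_left_mono add_right_mono divide_nonneg_pos add_nonneg_nonneg mult_nonneg_nonneg) auto
      ultimately show ?thesis unfolding L_def using \<kappa>0 by (intro mult_mono) auto
    qed
    fix z y :: "'a \<times> 'a" assume y: "norm y \<le> 1"
    define x' v' where "x' = fst y" and "v' = snd y"
    have xv: "norm x' \<le> 1" "norm v' \<le> 1" using y norm_fst_le[of x' v'] norm_snd_le[of v' x'] by (auto simp: x'_def v'_def)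
    define u where "u = lookahead U z"
    define x where "x = fst z"
    have 1: "norm ((x' - u) /\<^sub>R (h * \<sigma>)) \<le> (1 + norm u) / (h * \<sigma>)"
    proof -
      have "norm ((x' - u) /\<^sub>R (h * \<sigma>)) = norm (x' - u) / (h * \<sigma>)" using hs by (simp add: divide_inverse mult.commute del: inverse_mult_distrib)
      also have "\<dots> \<le> (1 + norm u) / (h * \<sigma>)"
        using norm_triangle_ineq4[of x' u] xv hs by (intro divide_right_mono) auto
      finally show ?thesis .
    qed
    have mv: "norm (mean_velocity U x x') \<le> r * ((1 + norm x) / h + h / 2 * G)"
    proof -
      have "norm ((1 / h) *\<^sub>R (x' - x) - (h / 2) *\<^sub>R gradient U x') \<le> (1 / h) * norm (x' - x) + h / 2 * norm (gradient U x')"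
        using h_pos by (intro order_trans[OF norm_triangle_ineq4]) simp
      also have "\<dots> \<le> (1 / h) * (1 + norm x) + h / 2 * G"
        using norm_triangle_ineq4[of x' x] xv h_pos G[OF xv(1)] by (intro add_mono mult_left_mono) auto
      finally show ?thesis using r_pos unfolding mean_velocity_def by (simp add: mult_left_mono)
    qed
    have 2: "norm ((v' - mean_velocity U x x') /\<^sub>R \<sigma>) \<le> (1 + r * ((1 + norm x) / h + h / 2 * G)) / \<sigma>"
    proof -
      have "norm ((v' - mean_velocity U x x') /\<^sub>R \<sigma>) = norm (v' - mean_velocity U x x') / \<sigma>" using \<sigma>_pos by (simp add: divide_inverse mult.commute)
      also have "\<dots> \<le> (1 + r * ((1 + norm x) / h + h / 2 * G)) / \<sigma>"
        using norm_triangle_ineq4[of v' "mean_velocity U x x'"] xv mv \<sigma>_pos by (intro divide_right_mono) auto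
      finally show ?thesis .
    qed
    have "L (norm u) (norm x) \<le> \<kappa>0 * exp (- (norm ((x' - u) /\<^sub>R (h * \<sigma>)))\<^sup>2 / 2) * exp (- (norm ((v' - mean_velocity U x x') /\<^sub>R \<sigma>))\<^sup>2 / 2)"
      unfolding L_def using \<kappa>0 power_mono[OF 1, of 2] power_mono[OF 2, of 2] by (intro mult_mono) auto
    also have "\<dots> = transition_density U z y"
      unfolding transition_density_def gaussian_density_eq \<kappa>0_def x_def u_def x'_def v'_def by (simp add: field_simps)
    finally show "L (norm (lookahead U z)) (norm (fst z)) \<le> transition_density U z y" by (simp add: u_def x_def)
  qed
qed

text \<open>The regenerating part is the uniform law on the unit ball, with probability \<open>s0 z\<close>. Where the Lyapunov
  function \<open>V\<close> is large, its own drift pays for the extra \<open>1\<close> in the excursion condition; where it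
  is small, \<open>s0\<close> is bounded below and adding a large constant \<open>M0\<close> to \<open>V\<close> pays for it.\<close>

lemma unique_invariant_law:
  fixes U :: "'a::euclidean_space \<Rightarrow> real" and N :: "'a \<times> 'a \<Rightarrow> real"
  assumes g: "continuous_on UNIV (gradient U)"
    and N: "continuous_on UNIV N" "0 < c" "\<And>p. c * norm p \<le> N p" and \<theta>: "0 < \<theta>" "\<theta> < 1" and b: "0 \<le> b"
    and drift: "\<And>z. (\<integral>\<^sup>+y. ennreal ((N (lookahead U y, fst y))\<^sup>2) \<partial>obabo_kernel h \<gamma> U z)
        \<le> ennreal (\<theta> * (N (lookahead U z, fst z))\<^sup>2 + b)"
  shows "\<exists>\<pi>. invariant_law (obabo_kernel h \<gamma> U) \<pi> \<and> (\<forall>\<pi>'. invariant_law (obabo_kernel h \<gamma> U) \<pi>' \<longrightarrow> \<pi>' = \<pi>)"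
proof -
  have gm: "gradient U \<in> borel_measurable borel" by (rule borel_measurable_continuous_onI[OF g])
  obtain L where L: "\<And>p q. 0 < L p q"
    "\<And>p q p' q'. 0 \<le> p \<Longrightarrow> p \<le> p' \<Longrightarrow> 0 \<le> q \<Longrightarrow> q \<le> q' \<Longrightarrow> L p' q' \<le> L p q"
    "continuous_on UNIV (\<lambda>z. L (fst z) (snd z))"
    "\<And>z y. norm y \<le> 1 \<Longrightarrow> L (norm (lookahead U z)) (norm (fst z)) \<le> transition_density U z y"
    using transition_density_minorization[OF g] by blast
  define V where "V = (\<lambda>y. (N (lookahead U y, fst y))\<^sup>2)"
  note [measurable] = measurable_lookahead[OF gm]
  have [measurable]: "fst \<in> borel_measurable (borel :: ('a \<times> 'a) measure)"
    by (intro borel_measurable_continuous_onI continuous_intros)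
  have [measurable]: "N \<in> borel_measurable (borel \<Otimes>\<^sub>M borel)"
    using borel_measurable_continuous_onI[OF N(1)] by (simp add: borel_prod)
  have Lm[measurable]: "(\<lambda>z. L (fst z) (snd z)) \<in> borel_measurable (borel \<Otimes>\<^sub>M borel)"
    using borel_measurable_continuous_onI[OF L(3)] by (simp add: borel_prod)
  have Vm[measurable]: "V \<in> borel_measurable borel" unfolding V_def by measurable
  have V0: "0 \<le> V y" for y by (simp add: V_def)
  have dr: "(\<integral>\<^sup>+y. ennreal (V y) \<partial>obabo_kernel h \<gamma> U z) \<le> ennreal (\<theta> * V z + b)" for z
    unfolding V_def by (rule drift)
  define vol where "vol = measure lborel (cball (0::'a \<times> 'a) 1)"
  have vol: "0 < vol" using content_cball_pos[of 1 "0::'a \<times> 'a"] by (simp add: vol_def)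
  have emv: "emeasure lborel (cball (0::'a \<times> 'a) 1) = ennreal vol"
    using emeasure_compact_finite[of "cball (0::'a \<times> 'a) 1"] unfolding vol_def by (simp add: emeasure_eq_ennreal_measure)
  define n0 :: "'a \<times> 'a \<Rightarrow> real" where "n0 = (\<lambda>y. indicator (cball 0 1) y / vol)"
  define s0 where "s0 = (\<lambda>z :: 'a \<times> 'a. vol * L (norm (lookahead U z)) (norm (fst z)))"
  define q where "q = transition_density U"
  have q_nonneg: "0 \<le> q z y" for z y
    unfolding q_def transition_density_def using h_pos \<sigma>_pos by (intro mult_nonneg_nonneg divide_nonneg_pos less_imp_le[OF gaussian_density_pos]) auto
  have sn: "s0 z * n0 y \<le> q z y" for z y
    using L(4)[of y z] vol q_nonneg[of z y] by (auto simp: s0_def n0_def q_def split: split_indicator)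
  have s0: "0 < s0 z" for z using vol L(1) by (simp add: s0_def)
  have n0: "0 \<le> n0 y" for y using vol by (simp add: n0_def)
  have [measurable]: "n0 \<in> borel_measurable borel"
    unfolding n0_def by (intro borel_measurable_divide borel_measurable_indicator borel_measurable_const) simp
  have [measurable]: "s0 \<in> borel_measurable borel"
  proof -
    have "(\<lambda>z. (\<lambda>z. L (fst z) (snd z)) (norm (lookahead U z), norm (fst z))) \<in> borel_measurable (borel :: ('a \<times> 'a) measure)"
      by measurable
    then show ?thesis unfolding s0_def by simp
  qed
  have qm[measurable]: "(\<lambda>(z, y). q z y) \<in> borel_measurable borel" unfolding q_def by (rule transition_density_measurable[OF gm])
  have qm2[measurable]: "(\<lambda>p. q (fst p) (snd p)) \<in> borel_measurable borel" using qm by (simp add: case_prod_beta')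
  have qm3[measurable]: "q z \<in> borel_measurable borel" for z
  proof -
    have "(\<lambda>(z, y). q z y) \<in> borel_measurable (borel \<Otimes>\<^sub>M borel)" using qm by (simp add: borel_prod)
    from measurable_compose[OF measurable_Pair1' this, of z] show ?thesis by simp
  qed
  have fs: "fst \<in> borel_measurable (borel :: (('a \<times> 'a) \<times> ('a \<times> 'a)) measure)" "snd \<in> borel_measurable (borel :: (('a \<times> 'a) \<times> ('a \<times> 'a)) measure)"
    by (intro borel_measurable_continuous_onI continuous_intros)+
  define rr where "rr = (\<lambda>p. ennreal (q (fst p) (snd p) - s0 (fst p) * n0 (snd p)))"
  have rm[measurable]: "rr \<in> borel_measurable borel"
    unfolding rr_def using measurable_compose[OF fs(1) \<open>s0 \<in> borel_measurable borel\<close>] measurable_compose[OF fs(2) \<open>n0 \<in> borel_measurable borel\<close>] by measurable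
  have rm3[measurable]: "(\<lambda>y. rr (z, y)) \<in> borel_measurable borel" for z unfolding rr_def by simp
  have split: "ennreal (q z y) = rr (z, y) + ennreal (s0 z) * ennreal (n0 y)" for z y
    using sn[of z y] s0[of z] n0[of y] by (simp add: rr_def ennreal_mult[symmetric] ennreal_plus[symmetric] less_imp_le del: ennreal_plus)
  have qf: "(\<integral>\<^sup>+y. ennreal (q z y) * f y \<partial>lborel) = (\<integral>\<^sup>+y. rr (z, y) * f y \<partial>lborel) + ennreal (s0 z) * (\<integral>\<^sup>+y. ennreal (n0 y) * f y \<partial>lborel)"
    if [measurable]: "f \<in> borel_measurable borel" for z f
    unfolding split by (simp add: distrib_right nn_integral_add nn_integral_cmult mult.assoc)
  have Kq: "(\<integral>\<^sup>+y. f y \<partial>obabo_kernel h \<gamma> U z) = (\<integral>\<^sup>+y. ennreal (q z y) * f y \<partial>lborel)" if "f \<in> borel_measurable borel" for f z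
    unfolding q_def by (rule kernel_density[OF gm that])
  have n1: "(\<integral>\<^sup>+y. ennreal (n0 y) \<partial>lborel) = 1"
  proof -
    have "(\<integral>\<^sup>+y. ennreal (n0 y) \<partial>lborel) = (\<integral>\<^sup>+y. ennreal (1 / vol) * indicator (cball (0::'a \<times> 'a) 1) y \<partial>lborel)"
      by (intro nn_integral_cong) (auto simp: n0_def split: split_indicator)
    also have "\<dots> = ennreal (1 / vol) * ennreal vol" by (simp add: nn_integral_cmult_indicator emv)
    finally show ?thesis using vol by (simp add: ennreal_mult[symmetric])
  qed
  interpret K: prob_space "obabo_kernel h \<gamma> U z" for z by (rule kernel_prob[OF gm])
  have r1: "(\<integral>\<^sup>+y. rr (z, y) \<partial>lborel) + ennreal (s0 z) = 1" for z
    using qf[of "\<lambda>_. 1" z] Kq[of "\<lambda>_. 1" z] n1 K.emeasure_space_1[of z] by simp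
  have s01: "s0 z \<le> 1" for z
  proof -
    have "ennreal (s0 z) \<le> ennreal 1" using r1[of z] by (metis add.commute ennreal_1 le_iff_add)
    then show ?thesis by simp
  qed
  have r1': "(\<integral>\<^sup>+y. rr (z, y) \<partial>lborel) = ennreal (1 - s0 z)" for z
  proof -
    have "(\<integral>\<^sup>+y. rr (z, y) \<partial>lborel) + ennreal (s0 z) = ennreal (1 - s0 z) + ennreal (s0 z)"
      using s01[of z] s0[of z] by (simp add: r1 ennreal_plus[symmetric] del: ennreal_plus)
    then show ?thesis by simp
  qed
  define T where "T = (1 + b) / (1 - \<theta>)"
  define D where "D = sqrt T / c"
  have T: "0 < T" using b \<theta> by (simp add: T_def)
  define smin where "smin = vol * L D D"
  have smin: "0 < smin" using vol L(1) by (simp add: smin_def)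
  define M0 where "M0 = (1 + b) / smin"
  have M0: "0 \<le> M0" using b smin by (simp add: M0_def)
  have key: "1 + b \<le> (1 - \<theta>) * V z + M0 * s0 z" for z
  proof (cases "T \<le> V z")
    case True
    then have "(1 - \<theta>) * T \<le> (1 - \<theta>) * V z" using \<theta> by (intro mult_left_mono) auto
    then have "1 + b \<le> (1 - \<theta>) * V z" using \<theta> by (simp add: T_def)
    moreover have "0 \<le> M0 * s0 z" using M0 s0[of z] by simp
    ultimately show ?thesis by linarith
  next
    case False
    have "N (lookahead U z, fst z) \<le> sqrt T" using False by (intro real_le_rsqrt) (simp add: V_def)
    then have "c * norm (lookahead U z, fst z) \<le> sqrt T" using N(3) order_trans by blast
    then have n: "norm (lookahead U z, fst z) \<le> D" using N(2) by (simp add: D_def field_simps)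
    then have "L D D \<le> L (norm (lookahead U z)) (norm (fst z))"
      using norm_fst_le[of "lookahead U z" "fst z"] norm_snd_le[of "fst z" "lookahead U z"] by (intro L(2)) auto
    then have "smin \<le> s0 z" using vol by (simp add: smin_def s0_def)
    then have "M0 * smin \<le> M0 * s0 z" using M0 by (rule mult_left_mono)
    then have "1 + b \<le> M0 * s0 z" using smin by (simp add: M0_def)
    moreover have "0 \<le> (1 - \<theta>) * V z" using \<theta> V0[of z] by simp
    ultimately show ?thesis by linarith
  qed
  show ?thesis
  proof (rule regeneration_invariant_law[where r=rr and s="\<lambda>z. ennreal (s0 z)" and n="\<lambda>y. ennreal (n0 y)" and W="\<lambda>y. ennreal (V y + M0)"])
    show "obabo_kernel h \<gamma> U \<in> borel \<rightarrow>\<^sub>M subprob_algebra borel" by (rule kernel_measurable[OF gm])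
    show "emeasure (obabo_kernel h \<gamma> U z) A = (\<integral>\<^sup>+y. rr (z, y) * indicator A y \<partial>lborel) + ennreal (s0 z) * (\<integral>\<^sup>+y. ennreal (n0 y) * indicator A y \<partial>lborel)"
      if A[measurable]: "A \<in> sets borel" for z A
    proof -
      have im: "(\<lambda>y. indicator A y :: ennreal) \<in> borel_measurable borel" by measurable
      have "emeasure (obabo_kernel h \<gamma> U z) A = (\<integral>\<^sup>+y. indicator A y \<partial>obabo_kernel h \<gamma> U z)"
        by (rule nn_integral_indicator[symmetric]) (simp add: A)
      then show ?thesis unfolding Kq[OF im] qf[OF im] .
    qed
    show "(\<integral>\<^sup>+y. rr (z, y) * ennreal (V y + M0) \<partial>lborel) + 1 \<le> ennreal (V z + M0)" for z
    proof -
      have "(\<integral>\<^sup>+y. rr (z, y) * ennreal (V y) \<partial>lborel) \<le> (\<integral>\<^sup>+y. ennreal (q z y) * ennreal (V y) \<partial>lborel)"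
        by (intro nn_integral_mono mult_right_mono) (simp_all add: split)
      also have "\<dots> \<le> ennreal (\<theta> * V z + b)" using dr[of z] Kq[of "\<lambda>y. ennreal (V y)" z] by simp
      finally have 1: "(\<integral>\<^sup>+y. rr (z, y) * ennreal (V y) \<partial>lborel) \<le> ennreal (\<theta> * V z + b)" .
      have "(\<integral>\<^sup>+y. rr (z, y) * ennreal (V y + M0) \<partial>lborel) = (\<integral>\<^sup>+y. rr (z, y) * ennreal (V y) \<partial>lborel) + (\<integral>\<^sup>+y. rr (z, y) \<partial>lborel) * ennreal M0"
        using V0 M0 by (simp add: distrib_left nn_integral_add nn_integral_multc)
      also have "\<dots> + 1 \<le> ennreal (\<theta> * V z + b) + ennreal (1 - s0 z) * ennreal M0 + 1"
        unfolding r1' by (intro add_right_mono 1)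
      also have "\<dots> = ennreal (\<theta> * V z + b + (1 - s0 z) * M0 + 1)"
        using V0[of z] \<theta> b M0 s01[of z] by (simp add: ennreal_mult[symmetric] ennreal_plus[symmetric] ennreal_1[symmetric] del: ennreal_plus ennreal_1)
      also have "\<dots> \<le> ennreal (V z + M0)" using key[of z] by (intro ennreal_leI) (simp add: algebra_simps)
      finally show ?thesis .
    qed
    show "(\<integral>\<^sup>+y. ennreal (n0 y) * ennreal (V y + M0) \<partial>lborel) < \<infinity>"
    proof -
      have "ennreal (s0 0) * (\<integral>\<^sup>+y. ennreal (n0 y) * ennreal (V y) \<partial>lborel) \<le> (\<integral>\<^sup>+y. ennreal (q 0 y) * ennreal (V y) \<partial>lborel)"
        by (simp add: qf)
      also have "\<dots> \<le> ennreal (\<theta> * V 0 + b)" using dr[of 0] Kq[of "\<lambda>y. ennreal (V y)" 0] by simp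
      finally have "ennreal (s0 0) * (\<integral>\<^sup>+y. ennreal (n0 y) * ennreal (V y) \<partial>lborel) < \<infinity>" by (simp add: le_less_trans)
      then have "(\<integral>\<^sup>+y. ennreal (n0 y) * ennreal (V y) \<partial>lborel) < \<infinity>"
        using s0[of 0] by (auto simp: ennreal_mult_less_top top.not_eq_extremum)
      moreover have "(\<integral>\<^sup>+y. ennreal (n0 y) * ennreal (V y + M0) \<partial>lborel) = (\<integral>\<^sup>+y. ennreal (n0 y) * ennreal (V y) \<partial>lborel) + ennreal M0"
        using V0 M0 n1 by (simp add: distrib_left nn_integral_add nn_integral_multc)
      ultimately show ?thesis by (simp add: top.not_eq_extremum)
    qed
  qed (use n1 s0 in \<open>auto intro: kernel_prob[OF gm]\<close>)
qed

text \<open>The same constant \<open>B\<close> serves all potentials and all \<open>E\<close>; for a dilated potential \<open>E\<close> grows linearly in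
  the dilation, which gives the linear bound on the Wasserstein distance.\<close>

lemma uniform_second_moments:
  assumes a: "\<bar>1 + \<beta> - s * \<mu>\<bar> < 1 + \<beta>"
  obtains B where "0 < B"
    "\<And>(U :: 'a::euclidean_space \<Rightarrow> real) E. continuous_on UNIV (gradient U) \<Longrightarrow> (\<And>x. norm (gradient U x - \<mu> *\<^sub>R x) \<le> E) \<Longrightarrow>
      \<exists>\<pi>. invariant_law (obabo_kernel h \<gamma> U) \<pi> \<and> (\<forall>\<pi>'. invariant_law (obabo_kernel h \<gamma> U) \<pi>' \<longrightarrow> \<pi>' = \<pi>) \<and>
        (\<integral>\<^sup>+y. ennreal ((norm y)\<^sup>2) \<partial>\<pi>) \<le> ennreal (B * (1 + E\<^sup>2))"
    "\<And>(U :: 'a::euclidean_space \<Rightarrow> real) E n. continuous_on UNIV (gradient U) \<Longrightarrow> (\<And>x. norm (gradient U x - \<mu> *\<^sub>R x) \<le> E) \<Longrightarrow>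
      (\<integral>\<^sup>+y. ennreal ((norm y)\<^sup>2) \<partial>dirac_iterate (obabo_kernel h \<gamma> U) n 0) \<le> ennreal (B * (1 + E\<^sup>2))"
proof -
  obtain \<theta> c C b and N :: "'a \<times> 'a \<Rightarrow> real" where \<theta>: "0 < \<theta>" "\<theta> < 1" and c: "0 < c" and C: "0 < C" and b: "0 < b"
    and N: "\<And>p. c * norm p \<le> N p" "\<And>p. N p \<le> C * norm p" "continuous_on UNIV N"
    and drift: "\<And>U E z. gradient U \<in> borel_measurable borel \<Longrightarrow> (\<And>x. norm (gradient U x - \<mu> *\<^sub>R x) \<le> E) \<Longrightarrow>
      (\<integral>\<^sup>+y. ennreal ((N (lookahead U y, fst y))\<^sup>2) \<partial>obabo_kernel h \<gamma> U z)
        \<le> ennreal (\<theta> * (N (lookahead U z, fst z))\<^sup>2 + b * (1 + E\<^sup>2))"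
    apply (rule quadratic_drift[where 'a='a, OF a])
    subgoal premises p for N c C \<theta> b by (rule that[of \<theta> c C b N, OF p(2-10)])
    done
  define A1 where "A1 = (1 + (2 / h + h / 2 * \<bar>\<mu>\<bar>) / r) / c"
  define A2 where "A2 = h / 2 / r"
  have A: "0 < A1" "0 < A2" using h_pos r_pos c by (auto simp: A1_def A2_def intro!: divide_pos_pos add_pos_nonneg)
  define A where "A = 2 * A1\<^sup>2 + 2 * A2\<^sup>2"
  have A0: "0 < A" using A by (simp add: A_def add_pos_pos)
  define B0 where "B0 = C\<^sup>2 * (h\<^sup>2 / 2)\<^sup>2 + b / (1 - \<theta>)"
  have B0: "0 < B0" using C b \<theta> by (simp add: B0_def add_nonneg_pos)
  define B where "B = A * (B0 + 1)"
  have B: "0 < B" using A0 B0 by (simp add: B_def)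
  have main: "(\<integral>\<^sup>+y. ennreal ((norm y)\<^sup>2) \<partial>\<nu>) \<le> ennreal (B * (1 + E\<^sup>2))"
    if E: "\<And>x. norm (gradient U x - \<mu> *\<^sub>R x) \<le> E" and gm: "gradient U \<in> borel_measurable borel"
      and S: "sets \<nu> = sets borel" and P: "prob_space \<nu>"
      and V: "(\<integral>\<^sup>+y. ennreal ((N (lookahead U y, fst y))\<^sup>2) \<partial>\<nu>) \<le> ennreal (B0 * (1 + E\<^sup>2))" for U :: "'a \<Rightarrow> real" and E \<nu>
  proof -
    interpret prob_space \<nu> by (rule P)
    have E0: "0 \<le> E" using E[of 0] by (meson norm_ge_zero order_trans)
    have pw: "(norm y)\<^sup>2 \<le> A * (N (lookahead U y, fst y))\<^sup>2 + A * E\<^sup>2" for y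
    proof -
      define n where "n = N (lookahead U y, fst y)"
      have "norm (lookahead U y, fst y) \<le> n / c" using N(1)[of "(lookahead U y, fst y)"] c by (simp add: n_def field_simps)
      moreover have "0 \<le> 1 + (2 / h + h / 2 * \<bar>\<mu>\<bar>) / r" using h_pos r_pos by simp
      ultimately have "(1 + (2 / h + h / 2 * \<bar>\<mu>\<bar>) / r) * norm (lookahead U y, fst y) \<le> (1 + (2 / h + h / 2 * \<bar>\<mu>\<bar>) / r) * (n / c)"
        by (rule mult_left_mono)
      then have "norm y \<le> (1 + (2 / h + h / 2 * \<bar>\<mu>\<bar>) / r) * (n / c) + A2 * E"
        using position_velocity_bound[OF E[of "fst y"]] unfolding A2_def by linarith
      then have "norm y \<le> A1 * n + A2 * E" by (simp add: A1_def)
      then have "(norm y)\<^sup>2 \<le> (A1 * n + A2 * E)\<^sup>2" by (intro power_mono) auto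
      also have "\<dots> \<le> 2 * (A1 * n)\<^sup>2 + 2 * (A2 * E)\<^sup>2"
      proof -
        have "0 \<le> (A1 * n - A2 * E)\<^sup>2" by simp
        then show ?thesis by (simp add: power2_eq_square algebra_simps)
      qed
      also have "\<dots> \<le> A * n\<^sup>2 + A * E\<^sup>2"
        unfolding A_def power_mult_distrib mult.assoc[symmetric] by (intro add_mono mult_right_mono) auto
      finally show ?thesis by (simp add: n_def)
    qed
    note [measurable] = measurable_lookahead[OF gm]
    have [measurable]: "fst \<in> borel_measurable (borel :: ('a \<times> 'a) measure)"
      by (intro borel_measurable_continuous_onI continuous_intros)
    have [measurable]: "N \<in> borel_measurable (borel \<Otimes>\<^sub>M borel)"
      using borel_measurable_continuous_onI[OF N(3)] by (simp add: borel_prod)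
    have Vm: "(\<lambda>y. ennreal ((N (lookahead U y, fst y))\<^sup>2)) \<in> borel_measurable \<nu>"
      unfolding measurable_cong_sets[OF S refl] by measurable
    have "(\<integral>\<^sup>+y. ennreal ((norm y)\<^sup>2) \<partial>\<nu>) \<le> (\<integral>\<^sup>+y. ennreal A * ennreal ((N (lookahead U y, fst y))\<^sup>2) + ennreal (A * E\<^sup>2) \<partial>\<nu>)"
      using pw A0 by (intro nn_integral_mono) (simp add: ennreal_mult[symmetric] ennreal_plus[symmetric] ennreal_leI del: ennreal_plus)
    also have "\<dots> = ennreal A * (\<integral>\<^sup>+y. ennreal ((N (lookahead U y, fst y))\<^sup>2) \<partial>\<nu>) + ennreal (A * E\<^sup>2)"
      using Vm by (simp add: nn_integral_add nn_integral_cmult emeasure_space_1)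
    also have "\<dots> \<le> ennreal A * ennreal (B0 * (1 + E\<^sup>2)) + ennreal (A * E\<^sup>2)"
      by (intro add_right_mono mult_left_mono V) simp
    also have "\<dots> = ennreal (A * (B0 * (1 + E\<^sup>2)) + A * E\<^sup>2)"
      using A0 B0 by (simp add: ennreal_mult[symmetric] ennreal_plus[symmetric] del: ennreal_plus)
    also have "\<dots> \<le> ennreal (B * (1 + E\<^sup>2))" using A0 by (intro ennreal_leI) (simp add: B_def algebra_simps)
    finally show ?thesis .
  qed
  show ?thesis
  proof (rule that[OF B])
    fix U :: "'a \<Rightarrow> real" and E
    assume g: "continuous_on UNIV (gradient U)" and E: "\<And>x. norm (gradient U x - \<mu> *\<^sub>R x) \<le> E"
    have gm: "gradient U \<in> borel_measurable borel" by (rule borel_measurable_continuous_onI[OF g])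
    define V where "V = (\<lambda>y. (N (lookahead U y, fst y))\<^sup>2)"
    note [measurable] = measurable_lookahead[OF gm]
    have [measurable]: "fst \<in> borel_measurable (borel :: ('a \<times> 'a) measure)"
      by (intro borel_measurable_continuous_onI continuous_intros)
    have [measurable]: "N \<in> borel_measurable (borel \<Otimes>\<^sub>M borel)"
      using borel_measurable_continuous_onI[OF N(3)] by (simp add: borel_prod)
    have Vm: "V \<in> borel_measurable borel" unfolding V_def by measurable
    have V0: "0 \<le> V y" for y by (simp add: V_def)
    have b': "0 \<le> b * (1 + E\<^sup>2)" using b by (intro mult_nonneg_nonneg) auto
    have dr: "(\<integral>\<^sup>+y. ennreal (V y) \<partial>obabo_kernel h \<gamma> U z) \<le> ennreal (\<theta> * V z + b * (1 + E\<^sup>2))" for z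
      unfolding V_def by (rule drift[OF gm E])
    have bB: "b * (1 + E\<^sup>2) / (1 - \<theta>) \<le> B0 * (1 + E\<^sup>2)"
      unfolding B0_def by (simp add: distrib_right)
    obtain \<pi> where \<pi>: "invariant_law (obabo_kernel h \<gamma> U) \<pi>" "\<And>\<pi>'. invariant_law (obabo_kernel h \<gamma> U) \<pi>' \<Longrightarrow> \<pi>' = \<pi>"
      using unique_invariant_law[OF g N(3) c N(1) \<theta> b' dr[unfolded V_def]] by blast
    have "(\<integral>\<^sup>+y. ennreal (V y) \<partial>\<pi>) \<le> ennreal (b * (1 + E\<^sup>2) / (1 - \<theta>))"
      by (rule drift_bound_invariant[OF kernel_measurable[OF gm] kernel_prob[OF gm] Vm V0 less_imp_le[OF \<theta>(1)] \<theta>(2) b' dr \<pi>(1)])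
    also have "\<dots> \<le> ennreal (B0 * (1 + E\<^sup>2))" by (rule ennreal_leI[OF bB])
    finally have "(\<integral>\<^sup>+y. ennreal ((norm y)\<^sup>2) \<partial>\<pi>) \<le> ennreal (B * (1 + E\<^sup>2))"
      using \<pi>(1) unfolding V_def invariant_law_def by (intro main[OF E gm]) simp_all
    then show "\<exists>\<pi>. invariant_law (obabo_kernel h \<gamma> U) \<pi> \<and> (\<forall>\<pi>'. invariant_law (obabo_kernel h \<gamma> U) \<pi>' \<longrightarrow> \<pi>' = \<pi>) \<and>
        (\<integral>\<^sup>+y. ennreal ((norm y)\<^sup>2) \<partial>\<pi>) \<le> ennreal (B * (1 + E\<^sup>2))" using \<pi> by blast
    fix n
    have Vz: "V 0 \<le> C\<^sup>2 * (h\<^sup>2 / 2)\<^sup>2 * E\<^sup>2"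
    proof -
      have l: "lookahead U 0 = - ((h\<^sup>2 / 2) *\<^sub>R gradient U 0)" by (simp add: lookahead_def power2_eq_square)
      have "norm (lookahead U 0, fst (0 :: 'a \<times> 'a)) = h\<^sup>2 / 2 * norm (gradient U 0)" unfolding l by (simp add: norm_Pair)
      also have "\<dots> \<le> h\<^sup>2 / 2 * E" using E[of 0] by (intro mult_left_mono) auto
      finally have "N (lookahead U 0, fst (0 :: 'a \<times> 'a)) \<le> C * (h\<^sup>2 / 2 * E)"
        using N(2)[of "(lookahead U 0, fst (0 :: 'a \<times> 'a))"] C by (meson mult_left_mono less_imp_le order_trans)
      moreover have "0 \<le> N (lookahead U 0, fst (0 :: 'a \<times> 'a))"
        using N(1)[of "(lookahead U 0, fst (0 :: 'a \<times> 'a))"] c by (meson mult_nonneg_nonneg less_imp_le norm_ge_zero order_trans)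
      ultimately have "V 0 \<le> (C * (h\<^sup>2 / 2 * E))\<^sup>2" unfolding V_def by (intro power_mono)
      then show ?thesis by (simp only: power_mult_distrib mult.assoc)
    qed
    have "(\<integral>\<^sup>+y. ennreal (V y) \<partial>dirac_iterate (obabo_kernel h \<gamma> U) n 0) \<le> ennreal (V 0 + b * (1 + E\<^sup>2) / (1 - \<theta>))"
      by (rule drift_bound_iterates[OF kernel_measurable[OF gm] kernel_prob[OF gm] Vm V0 less_imp_le[OF \<theta>(1)] \<theta>(2) b' dr])
    also have "\<dots> \<le> ennreal (B0 * (1 + E\<^sup>2))"
    proof (rule ennreal_leI)
      have "0 \<le> C\<^sup>2 * (h\<^sup>2 / 2)\<^sup>2" by (intro mult_nonneg_nonneg) auto
      then have "V 0 \<le> C\<^sup>2 * (h\<^sup>2 / 2)\<^sup>2 * (1 + E\<^sup>2)" using Vz unfolding distrib_left mult_1_right by linarith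
      then show "V 0 + b * (1 + E\<^sup>2) / (1 - \<theta>) \<le> B0 * (1 + E\<^sup>2)"
        unfolding B0_def distrib_right[of _ _ "1 + E\<^sup>2"] times_divide_eq_left by linarith
    qed
    finally show "(\<integral>\<^sup>+y. ennreal ((norm y)\<^sup>2) \<partial>dirac_iterate (obabo_kernel h \<gamma> U) n 0) \<le> ennreal (B * (1 + E\<^sup>2))"
      using dirac_iterate_prob[OF kernel_measurable[OF gm] kernel_prob[OF gm], of n 0] unfolding V_def
      by (intro main[OF E gm]) simp_all
  qed
qed

end

section \<open>Total variation and translations\<close>

lemma tv_dist_le:
  assumes "\<And>A. A \<in> sets borel \<Longrightarrow> \<bar>measure \<mu> A - measure \<nu> A\<bar> \<le> c"
  shows "tv_dist \<mu> \<nu> \<le> c"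
  unfolding tv_dist_def using assms by (intro cSUP_least) auto

lemma tv_dist_ge:
  assumes "prob_space \<mu>" "prob_space \<nu>" "A \<in> sets borel"
  shows "\<bar>measure \<mu> A - measure \<nu> A\<bar> \<le> tv_dist \<mu> \<nu>"
proof -
  have "\<bar>measure \<mu> A - measure \<nu> A\<bar> \<le> 1" for A
    using prob_space.prob_le_1[OF assms(1), of A] prob_space.prob_le_1[OF assms(2), of A]
      measure_nonneg[of \<mu> A] measure_nonneg[of \<nu> A] by linarith
  then show ?thesis unfolding tv_dist_def by (intro cSUP_upper assms bdd_aboveI2[where M=1])
qed

text \<open>The density ratio under a shift by \<open>e\<close> is \<open>exp (\<langle>x, e\<rangle> - \<bar>e\<bar>\<^sup>2 / 2) \<ge> 1 + \<langle>x, e\<rangle> - \<bar>e\<bar>\<^sup>2 / 2\<close>, so the loss is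
  linear in \<open>\<bar>e\<bar>\<close> for small \<open>e\<close>.\<close>

lemma gaussian_shift:
  fixes f :: "'a::euclidean_space \<Rightarrow> ennreal"
  assumes f[measurable]: "f \<in> borel_measurable borel" and f1: "\<And>x. f x \<le> 1"
  shows "(\<integral>\<^sup>+\<xi>. f \<xi> \<partial>std_gaussian) \<le> (\<integral>\<^sup>+\<xi>. f (e + \<xi>) \<partial>std_gaussian)
    + ennreal ((norm e)\<^sup>2 / 2 + norm e * (1 + 4 * sqrt 2 ^ DIM('a)))"
proof -
  interpret G: prob_space "std_gaussian :: 'a measure" by (rule prob_space_std_gaussian)
  have GU: "emeasure (std_gaussian :: 'a measure) UNIV = 1" using G.emeasure_space_1 by simp
  define B where "B = (\<lambda>x::'a. (norm e)\<^sup>2 / 2 + norm e * (1 + (norm x)\<^sup>2))"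
  have B0: "0 \<le> B x" for x :: 'a by (auto simp: B_def intro!: add_nonneg_nonneg mult_nonneg_nonneg)
  have pw: "gaussian_density x \<le> gaussian_density (x - e) + gaussian_density x * B x" for x :: 'a
  proof -
    have "- (norm (x - e))\<^sup>2 / 2 = - (norm x)\<^sup>2 / 2 + (inner x e - (norm e)\<^sup>2 / 2)"
      by (simp add: power2_norm_eq_inner inner_diff inner_commute field_simps)
    then have "gaussian_density (x - e) = gaussian_density x * exp (inner x e - (norm e)\<^sup>2 / 2)"
      by (simp only: gaussian_density_eq exp_add mult.assoc)
    also have "\<dots> \<ge> gaussian_density x * (1 + (inner x e - (norm e)\<^sup>2 / 2))"
      by (intro mult_left_mono exp_ge_add_one_self less_imp_le[OF gaussian_density_pos])
    finally have 1: "gaussian_density x * (1 + (inner x e - (norm e)\<^sup>2 / 2)) \<le> gaussian_density (x - e)" .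
    have "- inner x e \<le> norm x * norm e" using norm_cauchy_schwarz[of "- x" e] by simp
    also have "\<dots> \<le> norm e * (1 + (norm x)\<^sup>2)"
    proof -
      have "norm x \<le> 1 + (norm x)\<^sup>2" using sum_squares_bound[of "norm x" 1] by (simp add: power2_eq_square) (smt (verit) zero_le_square)
      then show ?thesis by (simp add: mult.commute mult_left_mono)
    qed
    finally have "1 \<le> (1 + (inner x e - (norm e)\<^sup>2 / 2)) + B x" by (simp add: B_def)
    then have "gaussian_density x * 1 \<le> gaussian_density x * ((1 + (inner x e - (norm e)\<^sup>2 / 2)) + B x)"
      by (intro mult_left_mono less_imp_le[OF gaussian_density_pos])
    then show ?thesis using 1 by (simp add: distrib_left)
  qed
  have "(\<integral>\<^sup>+\<xi>. f \<xi> \<partial>std_gaussian) = (\<integral>\<^sup>+x. ennreal (gaussian_density x) * f x \<partial>lborel)"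
    by (rule nn_integral_std_gaussian[OF f])
  also have "\<dots> \<le> (\<integral>\<^sup>+x. ennreal (gaussian_density (x - e)) * f x + ennreal (gaussian_density x) * ennreal (B x) \<partial>lborel)"
  proof (rule nn_integral_mono)
    fix x :: 'a
    have "ennreal (gaussian_density x) * f x \<le> (ennreal (gaussian_density (x - e)) + ennreal (gaussian_density x * B x)) * f x"
      using pw[of x] B0[of x] gaussian_density_pos[of x] gaussian_density_pos[of "x - e"]
      by (intro mult_right_mono) (simp_all add: ennreal_plus[symmetric] ennreal_leI del: ennreal_plus)
    also have "\<dots> \<le> ennreal (gaussian_density (x - e)) * f x + ennreal (gaussian_density x * B x) * 1"
      unfolding distrib_right by (intro add_left_mono mult_left_mono f1) simp
    finally show "ennreal (gaussian_density x) * f x \<le> ennreal (gaussian_density (x - e)) * f x + ennreal (gaussian_density x) * ennreal (B x)"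
      using B0[of x] gaussian_density_pos[of x] by (simp add: ennreal_mult)
  qed
  also have "\<dots> = (\<integral>\<^sup>+x. ennreal (gaussian_density (x - e)) * f x \<partial>lborel) + (\<integral>\<^sup>+x. ennreal (gaussian_density x) * ennreal (B x) \<partial>lborel)"
    by (rule nn_integral_add) (simp_all add: B_def)
  also have "(\<integral>\<^sup>+x. ennreal (gaussian_density (x - e)) * f x \<partial>lborel) = (\<integral>\<^sup>+\<xi>. f (e + \<xi>) \<partial>std_gaussian)"
    using nn_integral_gaussian_affine[of 1 f e] by simp
  also have "(\<integral>\<^sup>+x. ennreal (gaussian_density x) * ennreal (B x) \<partial>lborel) = (\<integral>\<^sup>+x. ennreal (B x) \<partial>std_gaussian)"
    by (rule nn_integral_std_gaussian[symmetric]) (simp add: B_def)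
  also have "\<dots> = (\<integral>\<^sup>+x. ennreal ((norm e)\<^sup>2 / 2 + norm e) + ennreal (norm e) * ennreal ((norm x)\<^sup>2) \<partial>(std_gaussian :: 'a measure))"
    by (intro nn_integral_cong) (simp add: B_def ennreal_mult[symmetric] ennreal_plus[symmetric] distrib_left add_ac del: ennreal_plus)
  also have "\<dots> = ennreal ((norm e)\<^sup>2 / 2 + norm e) + ennreal (norm e) * (\<integral>\<^sup>+x. ennreal ((norm x)\<^sup>2) \<partial>(std_gaussian :: 'a measure))"
    by (subst nn_integral_add) (simp_all add: nn_integral_cmult GU)
  also have "\<dots> \<le> ennreal ((norm e)\<^sup>2 / 2 + norm e) + ennreal (norm e) * ennreal (4 * sqrt 2 ^ DIM('a))"
    by (intro add_left_mono mult_left_mono gaussian_second_moment) simp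
  also have "\<dots> = ennreal ((norm e)\<^sup>2 / 2 + norm e * (1 + 4 * sqrt 2 ^ DIM('a)))"
    by (simp add: ennreal_mult[symmetric] ennreal_plus[symmetric] distrib_left add_ac del: ennreal_plus)
  finally show ?thesis by simp
qed

text \<open>About \<open>2 \<rho> / \<bar>d\<bar>\<close> translations by \<open>d\<close> move the ball of radius \<open>\<rho>\<close>, which carries most of the mass,
  to a disjoint place. The mass then drops by at least \<open>1 / 2\<close>, while each translation changes it by at
  most the total variation distance.\<close>

lemma tv_dist_translate_ge:
  fixes \<mu> :: "'b::euclidean_space measure"
  assumes P: "prob_space \<mu>" and S: "sets \<mu> = sets borel" and \<rho>: "0 \<le> \<rho>"
    and tight: "measure \<mu> {y. \<rho> < norm y} \<le> 1 / 4" and d: "d \<noteq> 0" "norm d \<le> 1"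
  shows "norm d / (4 * (\<rho> + 1)) \<le> tv_dist \<mu> (distr \<mu> borel (\<lambda>y. y + d))"
proof -
  interpret prob_space \<mu> by (rule P)
  have [simp]: "space \<mu> = UNIV" using sets_eq_imp_space_eq[OF S] by simp
  have m[measurable]: "(\<lambda>y. y + e) \<in> measurable \<mu> borel" for e
    unfolding measurable_cong_sets[OF S refl] by measurable
  define \<nu> where "\<nu> = distr \<mu> borel (\<lambda>y. y + d)"
  have P\<nu>: "prob_space \<nu>" unfolding \<nu>_def by (rule prob_space_distr[OF m])
  define T where "T = tv_dist \<mu> \<nu>"
  define C where "C = cball (0::'b) \<rho>"
  define p where "p = (\<lambda>i::nat. measure \<mu> {y. y + real i *\<^sub>R d \<in> C})"
  have Cs: "{y. y + e \<in> C} \<in> sets borel" for e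
  proof -
    have "{y. y + e \<in> C} = (\<lambda>y. y + e) -` C \<inter> space borel" by auto
    also have "\<dots> \<in> sets borel" by (rule measurable_sets[of _ borel borel]) (auto simp: C_def)
    finally show ?thesis .
  qed
  have step: "\<bar>p i - p (Suc i)\<bar> \<le> T" for i
  proof -
    have "measure \<nu> {y. y + real i *\<^sub>R d \<in> C} = measure \<mu> ((\<lambda>y. y + d) -` {y. y + real i *\<^sub>R d \<in> C} \<inter> space \<mu>)"
      unfolding \<nu>_def by (rule measure_distr[OF m Cs])
    also have "(\<lambda>y. y + d) -` {y. y + real i *\<^sub>R d \<in> C} \<inter> space \<mu> = {y. y + real (Suc i) *\<^sub>R d \<in> C}"
      by (auto simp: algebra_simps)
    finally show ?thesis using tv_dist_ge[OF P P\<nu> Cs[of "real i *\<^sub>R d"]] by (simp add: p_def T_def)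
  qed
  have tele: "p 0 - p k \<le> real k * T" for k
  proof (induction k)
    case (Suc k) then show ?case using step[of k] by (simp add: algebra_simps)
  qed simp
  define k where "k = nat \<lceil>2 * \<rho> / norm d\<rceil> + 1"
  have kd: "2 * \<rho> < real k * norm d"
  proof -
    have "2 * \<rho> / norm d < real k" unfolding k_def by linarith
    then show ?thesis using d by (simp add: field_simps)
  qed
  have kle: "real k * norm d \<le> 2 * (\<rho> + 1)"
  proof -
    have "0 \<le> 2 * \<rho> / norm d" using \<rho> by simp
    then have "real k \<le> 2 * \<rho> / norm d + 2" unfolding k_def by linarith
    then have "real k * norm d \<le> (2 * \<rho> / norm d + 2) * norm d" by (rule mult_right_mono) simp
    also have "\<dots> = 2 * \<rho> + 2 * norm d" using d by (simp add: field_simps)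
    finally show ?thesis using d by simp
  qed
  have big: "{y. \<rho> < norm y} \<in> sets \<mu>" by (simp add: S)
  have "p 0 = 1 - measure \<mu> {y. \<rho> < norm y}"
  proof -
    have "{y. y + real 0 *\<^sub>R d \<in> C} = space \<mu> - {y. \<rho> < norm y}" by (auto simp: C_def)
    then show ?thesis unfolding p_def by (simp only: prob_compl[OF big])
  qed
  moreover have "p k \<le> measure \<mu> {y. \<rho> < norm y}" unfolding p_def
  proof (rule finite_measure_mono[OF _ big], safe)
    fix y assume "y + real k *\<^sub>R d \<in> C"
    then have "norm (y + real k *\<^sub>R d) \<le> \<rho>" by (simp add: C_def)
    moreover have "norm (real k *\<^sub>R d) \<le> norm (y + real k *\<^sub>R d) + norm y"
      using norm_triangle_ineq4[of "y + real k *\<^sub>R d" y] by simp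
    ultimately show "\<rho> < norm y" using kd by simp
  qed
  ultimately have "1 / 2 \<le> real k * T" using tele[of k] tight by linarith
  moreover have "0 < real k" by (simp add: k_def)
  ultimately have T: "0 \<le> T" using zero_less_mult_pos[of "real k" T] by simp
  have "1 / 2 * norm d \<le> (real k * norm d) * T" using mult_right_mono[OF \<open>1 / 2 \<le> real k * T\<close>, of "norm d"] by (simp add: mult_ac)
  also have "\<dots> \<le> 2 * (\<rho> + 1) * T" using kle T by (rule mult_right_mono)
  finally show ?thesis using \<rho> by (simp add: field_simps T_def \<nu>_def)
qed

lemma tight_of_second_moment:
  fixes \<mu> :: "'b::euclidean_space measure"
  assumes S: "sets \<mu> = sets borel" and m: "(\<integral>\<^sup>+y. ennreal ((norm y)\<^sup>2) \<partial>\<mu>) \<le> ennreal B" and B: "0 < B"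
  shows "measure \<mu> {y. 2 * sqrt B < norm y} \<le> 1 / 4"
proof -
  have [simp]: "space \<mu> = UNIV" using sets_eq_imp_space_eq[OF S] by simp
  have [measurable]: "{y. 2 * sqrt B < norm y} \<in> sets \<mu>" by (simp add: S)
  have "ennreal (4 * B) * emeasure \<mu> {y. 2 * sqrt B < norm y} = (\<integral>\<^sup>+y. ennreal (4 * B) * indicator {y. 2 * sqrt B < norm y} y \<partial>\<mu>)"
    by (simp add: nn_integral_cmult_indicator)
  also have "\<dots> \<le> (\<integral>\<^sup>+y. ennreal ((norm y)\<^sup>2) \<partial>\<mu>)"
  proof (intro nn_integral_mono)
    fix y :: 'b
    have "4 * B \<le> (norm y)\<^sup>2" if "2 * sqrt B < norm y"
      using power_mono[of "2 * sqrt B" "norm y" 2] that B by (simp add: power_mult_distrib)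
    then show "ennreal (4 * B) * indicator {y. 2 * sqrt B < norm y} y \<le> ennreal ((norm y)\<^sup>2)"
      by (auto intro!: ennreal_leI split: split_indicator)
  qed
  also note m
  finally have "ennreal (4 * B) * emeasure \<mu> {y. 2 * sqrt B < norm y} \<le> ennreal B" .
  then have "ennreal (1 / (4 * B)) * (ennreal (4 * B) * emeasure \<mu> {y. 2 * sqrt B < norm y}) \<le> ennreal (1 / (4 * B)) * ennreal B"
    by (rule mult_left_mono) simp
  moreover have "ennreal (1 / (4 * B)) * ennreal (4 * B) = 1"
    using B by (simp add: ennreal_mult[symmetric])
  moreover have "ennreal (1 / (4 * B)) * ennreal B = ennreal (1 / 4)"
    using B by (simp add: ennreal_mult[symmetric])
  ultimately have "emeasure \<mu> {y. 2 * sqrt B < norm y} \<le> ennreal (1 / 4)" by (simp add: mult.assoc[symmetric])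
  then show ?thesis unfolding measure_def by (intro enn2real_leI) simp
qed

section \<open>The exact rate for quadratic potentials\<close>

lemma gradient_quadratic: "gradient (quadratic_potential l) = (\<lambda>x. l *\<^sub>R x)"
proof
  fix x :: 'a
  have "GDERIV (quadratic_potential l) x :> l *\<^sub>R x"
    unfolding gderiv_def quadratic_potential_def[abs_def] power2_norm_eq_inner
    by (auto intro!: derivative_eq_intros simp: inner_commute algebra_simps)
  then show "gradient (quadratic_potential l) x = l *\<^sub>R x" by (rule gradient_eqI)
qed

text \<open>A complex eigenvalue acts on the plane as multiplication by a complex number; this is why two
  dimensions suffice for the exact rate.\<close>

definition plane :: "complex \<Rightarrow> real ^ 2" where
  "plane z = vector [Re z, Im z]"

lemma plane_nth[simp]: "plane z $ 1 = Re z" "plane z $ 2 = Im z"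
  by (simp_all add: plane_def)

lemma plane_simps: "plane (a + b) = plane a + plane b" "plane (a - b) = plane a - plane b"
  "x *\<^sub>R plane a = plane (of_real x * a)" "plane 0 = 0"
  by (simp_all add: Finite_Cartesian_Product.vec_eq_iff forall_2)

lemma inner_plane: "inner (plane a) (plane b) = Re (a * cnj b)"
  by (simp add: inner_vec_def sum_2)

lemma norm_plane: "norm (plane a) = cmod a"
  using norm_eq_sqrt_inner[of "plane a"] by (simp add: inner_plane cmod_def power2_eq_square)

context obabo begin

text \<open>The complex number \<open>\<eta>\<close> makes \<open>D b = (b, \<eta> b)\<close> an eigendirection of the linear step: shifting the start by
  \<open>D b\<close> shifts the next state, for the same noise, by \<open>D (w b)\<close>. So the law after \<open>n\<close> steps from \<open>D 1\<close> is the law from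
  \<open>0\<close> translated by \<open>D (w\<^sup>n)\<close>. The distance of a tight family of laws from its small translates is at
  least proportional to the translation; and it is at most proportional to it because the noise of the
  last step, shifted by a multiple of the translation, reproduces it. Taking \<open>n\<close>-th roots leaves \<open>\<bar>w\<bar>\<close>.\<close>

lemma quadratic_total_variation_rate:
  fixes w :: complex
  assumes a: "\<bar>1 + \<beta> - s * l\<bar> < 1 + \<beta>" and w: "w\<^sup>2 - of_real (1 + \<beta> - s * l) * w + of_real \<beta> = 0"
    and w1: "cmod w < 1" "w \<noteq> 0"
  obtains z :: "(real^2) \<times> (real^2)" where
    "(\<lambda>n. root n (tv_dist (dirac_iterate (obabo_kernel h \<gamma> (quadratic_potential l)) n 0)
                          (dirac_iterate (obabo_kernel h \<gamma> (quadratic_potential l)) n z))) \<longlonglongrightarrow> cmod w"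
proof -
  define U :: "real^2 \<Rightarrow> real" where "U = quadratic_potential l"
  define K where "K = obabo_kernel h \<gamma> U"
  have gU: "gradient U = (\<lambda>x. l *\<^sub>R x)" unfolding U_def by (rule gradient_quadratic)
  have gc: "continuous_on UNIV (gradient U)" unfolding gU by (intro continuous_intros)
  have gm: "gradient U \<in> borel_measurable borel" by (rule borel_measurable_continuous_onI[OF gc])
  have KM: "K \<in> measurable borel (subprob_algebra borel)" unfolding K_def by (rule kernel_measurable[OF gm])
  have KP: "prob_space (K z)" for z unfolding K_def by (rule kernel_prob[OF gm])
  have KS: "sets (K z) = sets borel" for z by (simp add: K_def)
  define \<mu> where "\<mu> = (\<lambda>n. dirac_iterate K n 0)"
  have \<mu>P: "prob_space (\<mu> n)" and \<mu>S: "sets (\<mu> n) = sets borel" for n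
    using dirac_iterate_prob[OF KM KP, of n 0] by (auto simp: \<mu>_def)
  have \<mu>ne: "space (\<mu> n) \<noteq> {}" for n using sets_eq_imp_space_eq[OF \<mu>S[of n]] by simp
  define \<eta> where "\<eta> = ((w - 1) / of_real h + of_real (h / 2 * l)) / of_real r"
  define D where "D = (\<lambda>b. (plane b, plane (\<eta> * b)))"
  have \<eta>1: "1 + of_real h * (of_real r * \<eta> - of_real (h / 2 * l)) = w"
    using h_pos r_pos by (simp add: \<eta>_def field_simps)
  have \<eta>2: "of_real r * ((w - 1) / of_real h - of_real (h / 2 * l) * w) = \<eta> * w"
  proof -
    have b: "of_real \<beta> = (of_real r)\<^sup>2" using r_sq by (metis of_real_power)
    have sl: "s * l = h\<^sup>2 * l / 2 * (1 + \<beta>)" by (simp add: s_def)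
    have "of_real h * of_real r * (of_real r * ((w - 1) / of_real h - of_real (h / 2 * l) * w) - \<eta> * w)
      = of_real \<beta> * (w - 1 - of_real (h\<^sup>2 * l / 2) * w) - (w - 1 + of_real (h\<^sup>2 * l / 2)) * w"
      using h_pos r_pos unfolding \<eta>_def b by (simp add: field_simps power2_eq_square)
    also have "\<dots> = - (w\<^sup>2 - of_real (1 + \<beta> - s * l) * w + of_real \<beta>)"
      unfolding sl by (simp add: field_simps power2_eq_square)
    also have "\<dots> = 0" using w by simp
    finally show ?thesis using h_pos r_pos by simp
  qed
  have D_add: "D (b + c) = D b + D c" for b c by (simp add: D_def plane_simps distrib_left)
  have nD: "norm (D b) = cmod b * sqrt (1 + (cmod \<eta>)\<^sup>2)" for b
    proof -
      have "norm (D b) = sqrt ((cmod b)\<^sup>2 + (cmod \<eta> * cmod b)\<^sup>2)" by (simp add: D_def norm_Pair norm_plane norm_mult)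
      also have "(cmod b)\<^sup>2 + (cmod \<eta> * cmod b)\<^sup>2 = (cmod b)\<^sup>2 * (1 + (cmod \<eta>)\<^sup>2)"
        by (simp add: power_mult_distrib algebra_simps)
      also have "sqrt \<dots> = cmod b * sqrt (1 + (cmod \<eta>)\<^sup>2)" by (simp add: real_sqrt_mult)
      finally show ?thesis .
    qed
  have normD: "norm (D b) = cmod b * norm (D 1)" for b unfolding nD by simp
  have D1: "0 < norm (D 1)" unfolding nD by (simp add: add_pos_nonneg)
  have look: "lookahead U (z + D b) = lookahead U z + plane (w * b)" for z b
  proof -
    have "lookahead U (z + D b) = lookahead U z + (plane b + h *\<^sub>R (r *\<^sub>R plane (\<eta> * b) - (h / 2) *\<^sub>R (l *\<^sub>R plane b)))"
      by (simp add: lookahead_def gU D_def algebra_simps)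
    also have "plane b + h *\<^sub>R (r *\<^sub>R plane (\<eta> * b) - (h / 2) *\<^sub>R (l *\<^sub>R plane b))
      = plane ((1 + of_real h * (of_real r * \<eta> - of_real (h / 2 * l))) * b)"
      unfolding plane_simps by (simp add: algebra_simps plane_simps)
    finally show ?thesis by (simp only: \<eta>1)
  qed
  have step: "obabo_step h \<gamma> U (z + D b) \<xi> = obabo_step h \<gamma> U z \<xi> + D (w * b)" for z b \<xi>
  proof -
    define X where "X = lookahead U z + (h * \<sigma>) *\<^sub>R fst \<xi>"
    have "mean_velocity U (fst (z + D b)) (X + plane (w * b))
      = mean_velocity U (fst z) X + r *\<^sub>R ((1 / h) *\<^sub>R (plane (w * b) - plane b) - (h / 2) *\<^sub>R (l *\<^sub>R plane (w * b)))"
      by (simp add: mean_velocity_def gU D_def algebra_simps)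
    also have "r *\<^sub>R ((1 / h) *\<^sub>R (plane (w * b) - plane b) - (h / 2) *\<^sub>R (l *\<^sub>R plane (w * b)))
      = plane (of_real r * ((w - 1) / of_real h - of_real (h / 2 * l) * w) * b)"
      unfolding plane_simps(3) plane_simps(2)[symmetric] by (rule arg_cong[where f=plane]) (simp add: field_simps)
    finally have "mean_velocity U (fst (z + D b)) (X + plane (w * b)) = mean_velocity U (fst z) X + plane (\<eta> * w * b)"
      by (simp only: \<eta>2)
    then show ?thesis unfolding obabo_step_eq look Let_def
      by (simp add: X_def D_def algebra_simps)
  qed
  have addm: "(\<lambda>y. y + d) \<in> measurable borel borel" for d :: "(real^2) \<times> (real^2)" by measurable
  have kern: "K (z + D b) = distr (K z) borel (\<lambda>y. y + D (w * b))" for z b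
    unfolding K_def obabo_kernel_def
  proof -
    have "obabo_step h \<gamma> U (z + D b) = (\<lambda>y. y + D (w * b)) \<circ> obabo_step h \<gamma> U z"
      by (rule ext) (simp only: comp_def step)
    then show "distr (std_gaussian \<Otimes>\<^sub>M std_gaussian) borel (\<lambda>\<xi>. obabo_step h \<gamma> U (z + D b) \<xi>) =
        distr (distr (std_gaussian \<Otimes>\<^sub>M std_gaussian) borel (\<lambda>\<xi>. obabo_step h \<gamma> U z \<xi>)) borel (\<lambda>y. y + D (w * b))"
      by (simp only: distr_distr[OF addm step_measurable'[OF gm]])
  qed
  have iter: "dirac_iterate K n (D b) = distr (\<mu> n) borel (\<lambda>y. y + D (w ^ n * b))" for n b
  proof (induction n)
    case 0 then show ?case by (simp add: dirac_iterate_0 \<mu>_def distr_return)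
  next
    case (Suc n)
    have m: "(\<lambda>y. y + D (w ^ n * b)) \<in> measurable (\<mu> n) borel" using addm by (simp add: measurable_cong_sets[OF \<mu>S refl])
    have Km: "K \<in> measurable (\<mu> n) (subprob_algebra borel)" using KM by (simp add: measurable_cong_sets[OF \<mu>S refl])
    have "dirac_iterate K (Suc n) (D b) = bind (distr (\<mu> n) borel (\<lambda>y. y + D (w ^ n * b))) K"
      by (simp add: dirac_iterate_Suc Suc.IH)
    also have "\<dots> = bind (\<mu> n) (\<lambda>y. K (y + D (w ^ n * b)))" by (rule bind_distr[OF m KM \<mu>ne])
    also have "\<dots> = bind (\<mu> n) (\<lambda>y. distr (K y) borel (\<lambda>y. y + D (w * (w ^ n * b))))" by (simp only: kern)
    also have "\<dots> = distr (bind (\<mu> n) K) borel (\<lambda>y. y + D (w * (w ^ n * b)))"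
      by (rule distr_bind[symmetric, OF Km \<mu>ne addm])
    finally show ?case by (simp add: \<mu>_def dirac_iterate_Suc mult.assoc)
  qed
  define \<tau> where "\<tau> = (\<lambda>n. tv_dist (\<mu> n) (dirac_iterate K n (D 1)))"
  define \<theta> where "\<theta> = cmod w"
  have \<theta>: "0 < \<theta>" "\<theta> < 1" using w1 by (auto simp: \<theta>_def)
  have \<tau>_eq: "\<tau> n = tv_dist (\<mu> n) (distr (\<mu> n) borel (\<lambda>y. y + D (w ^ n)))" for n
    using iter[of n 1] by (simp add: \<tau>_def)
  \<comment> \<open>lower bound: uniform second moments make the laws tight\<close>
  obtain B where B: "0 < B" "\<And>n. (\<integral>\<^sup>+y. ennreal ((norm y)\<^sup>2) \<partial>\<mu> n) \<le> ennreal B"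
  proof -
    obtain B where "0 < B" "\<And>(U :: real^2 \<Rightarrow> real) E n. continuous_on UNIV (gradient U) \<Longrightarrow> (\<And>x. norm (gradient U x - l *\<^sub>R x) \<le> E) \<Longrightarrow>
      (\<integral>\<^sup>+y. ennreal ((norm y)\<^sup>2) \<partial>dirac_iterate (obabo_kernel h \<gamma> U) n 0) \<le> ennreal (B * (1 + E\<^sup>2))"
      apply (rule uniform_second_moments[where 'a="real^2", OF a])
      subgoal premises p for B by (rule that[OF p(2) p(4)])
      done
    from this(1) this(2)[OF gc, of 0] show ?thesis by (intro that[of B]) (auto simp: gU \<mu>_def K_def)
  qed
  define c1 where "c1 = norm (D 1) / (4 * (2 * sqrt B + 1))"
  have c1: "0 < c1" using D1 B by (simp add: c1_def add_nonneg_pos)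
  have lower: "c1 * \<theta> ^ n \<le> \<tau> n" if "\<theta> ^ n * norm (D 1) \<le> 1" for n
  proof -
    have "norm (D (w ^ n)) = \<theta> ^ n * norm (D 1)" using normD[of "w ^ n"] by (simp add: \<theta>_def norm_power)
    moreover have "0 < \<theta> ^ n * norm (D 1)" using \<theta> D1 by simp
    moreover from calculation have "D (w ^ n) \<noteq> 0" by (metis norm_zero less_irrefl)
    ultimately show ?thesis
      using tv_dist_translate_ge[OF \<mu>P \<mu>S _ tight_of_second_moment[OF \<mu>S B(2) B(1)], of "D (w ^ n)" n] that B(1)
      by (simp add: \<tau>_eq c1_def mult.commute)
  qed
  \<comment> \<open>a shift of the first noise also moves the mean of the second; \<open>\<eta>'\<close> is what is left of \<open>\<eta>\<close>\<close>
  define \<eta>' where "\<eta>' = \<eta> - of_real (r * (1 / h - h / 2 * l))"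
  define m where "m = 1 + 4 * sqrt 2 ^ DIM(real^2)"
  have m: "0 < m" by (simp add: m_def add_pos_pos)
  define \<epsilon> where "\<epsilon> = (\<lambda>b::complex. ((cmod b / (h * \<sigma>))\<^sup>2 / 2 + cmod b / (h * \<sigma>) * m) + ((cmod \<eta>' * cmod b / \<sigma>)\<^sup>2 / 2 + cmod \<eta>' * cmod b / \<sigma> * m))"
  have hs: "0 < h * \<sigma>" using h_pos \<sigma>_pos by simp
  have noise: "obabo_step h \<gamma> U z (plane (b / of_real (h * \<sigma>)) + \<xi>1, plane (\<eta>' * b / of_real \<sigma>) + \<xi>2) = obabo_step h \<gamma> U z (\<xi>1, \<xi>2) + D b" for z b \<xi>1 \<xi>2
  proof -
    have cancel: "c *\<^sub>R plane (b / of_real c) = plane b" if "c \<noteq> 0" for c b using that by (simp add: plane_simps(3))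
    have 1: "(h * \<sigma>) *\<^sub>R plane (b / of_real (h * \<sigma>)) = plane b" by (rule cancel) (metis hs less_irrefl)
    have 2: "\<sigma> *\<^sub>R plane (\<eta>' * b / of_real \<sigma>) = plane (\<eta>' * b)" by (rule cancel) (use \<sigma>_pos in simp)
    define X where "X = lookahead U z + (h * \<sigma>) *\<^sub>R \<xi>1"
    have "mean_velocity U (fst z) (X + plane b) = mean_velocity U (fst z) X + (r * (1 / h - h / 2 * l)) *\<^sub>R plane b"
      by (simp add: mean_velocity_def gU algebra_simps)
    moreover have "(r * (1 / h - h / 2 * l)) *\<^sub>R plane b + plane (\<eta>' * b) = plane (\<eta> * b)"
      unfolding plane_simps(3) plane_simps(1)[symmetric] by (rule arg_cong[where f=plane]) (simp add: \<eta>'_def algebra_simps)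
    moreover have "lookahead U z + (h * \<sigma>) *\<^sub>R (plane (b / of_real (h * \<sigma>)) + \<xi>1) = X + plane b"
      unfolding scaleR_add_right 1 by (simp add: X_def)
    moreover have "\<sigma> *\<^sub>R (plane (\<eta>' * b / of_real \<sigma>) + \<xi>2) = plane (\<eta>' * b) + \<sigma> *\<^sub>R \<xi>2"
      unfolding scaleR_add_right 2 ..
    ultimately show ?thesis unfolding obabo_step_eq Let_def fst_conv snd_conv
      by (simp add: X_def[symmetric] D_def add.assoc)
  qed
  have shift: "(\<integral>\<^sup>+y. f y \<partial>K z) \<le> (\<integral>\<^sup>+y. f (y + D b) \<partial>K z) + ennreal (\<epsilon> b)"
    if f: "f \<in> borel_measurable borel" and f1: "\<And>y. f y \<le> 1" for f :: "(real^2) \<times> (real^2) \<Rightarrow> ennreal" and z b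
  proof -
    interpret G: prob_space "std_gaussian :: (real^2) measure" by (rule prob_space_std_gaussian)
    have GU: "emeasure (std_gaussian :: (real^2) measure) UNIV = 1" using G.emeasure_space_1 by simp
    define F where "F = (\<lambda>\<xi>1 \<xi>2. f (obabo_step h \<gamma> U z (\<xi>1, \<xi>2)))"
    have Fm[measurable]: "(\<lambda>(\<xi>1, \<xi>2). F \<xi>1 \<xi>2) \<in> borel_measurable (borel \<Otimes>\<^sub>M borel)"
    proof -
      have "(\<lambda>\<xi>. f (obabo_step h \<gamma> U z \<xi>)) \<in> borel_measurable (std_gaussian \<Otimes>\<^sub>M std_gaussian)"
        by (rule measurable_compose[OF step_measurable'[OF gm] f])
      also have "borel_measurable (std_gaussian \<Otimes>\<^sub>M std_gaussian) = borel_measurable ((borel :: (real^2) measure) \<Otimes>\<^sub>M (borel :: (real^2) measure))"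
        by (intro measurable_cong_sets sets_pair_measure_cong) auto
      finally show ?thesis by (simp add: F_def case_prod_beta')
    qed
    have Fm1[measurable]: "F x \<in> borel_measurable borel" for x
      using measurable_compose[OF measurable_Pair1' Fm, of x] by simp
    have F1: "F x y \<le> 1" for x y by (simp add: F_def f1)
    define e1 where "e1 = plane (b / of_real (h * \<sigma>))"
    define e2 where "e2 = plane (\<eta>' * b / of_real \<sigma>)"
    define \<epsilon>1 where "\<epsilon>1 = (norm e1)\<^sup>2 / 2 + norm e1 * m"
    define \<epsilon>2 where "\<epsilon>2 = (norm e2)\<^sup>2 / 2 + norm e2 * m"
    have \<epsilon>0: "0 \<le> \<epsilon>1" "0 \<le> \<epsilon>2" using m by (auto simp: \<epsilon>1_def \<epsilon>2_def intro!: add_nonneg_nonneg mult_nonneg_nonneg)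
    have \<epsilon>: "\<epsilon>1 + \<epsilon>2 = \<epsilon> b" using hs \<sigma>_pos by (simp add: \<epsilon>1_def \<epsilon>2_def \<epsilon>_def e1_def e2_def norm_plane norm_divide norm_mult del: of_real_mult)
    have "(\<integral>\<^sup>+y. f y \<partial>K z) = (\<integral>\<^sup>+\<xi>1. (\<integral>\<^sup>+\<xi>2. F \<xi>1 \<xi>2 \<partial>std_gaussian) \<partial>std_gaussian)"
      unfolding K_def F_def by (rule nn_integral_kernel[OF gm f])
    also have "\<dots> \<le> (\<integral>\<^sup>+\<xi>1. (\<integral>\<^sup>+\<xi>2. F \<xi>1 (e2 + \<xi>2) \<partial>std_gaussian) + ennreal \<epsilon>2 \<partial>std_gaussian)"
      unfolding \<epsilon>2_def m_def by (intro nn_integral_mono gaussian_shift Fm1 F1)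
    also have "\<dots> = (\<integral>\<^sup>+\<xi>1. (\<integral>\<^sup>+\<xi>2. F \<xi>1 (e2 + \<xi>2) \<partial>std_gaussian) \<partial>std_gaussian) + ennreal \<epsilon>2"
      by (subst nn_integral_add) (simp_all add: GU, measurable)
    also have "\<dots> \<le> ((\<integral>\<^sup>+\<xi>1. (\<integral>\<^sup>+\<xi>2. F (e1 + \<xi>1) (e2 + \<xi>2) \<partial>std_gaussian) \<partial>std_gaussian) + ennreal \<epsilon>1) + ennreal \<epsilon>2"
      unfolding \<epsilon>1_def m_def
    proof (intro add_right_mono gaussian_shift)
      show "(\<integral>\<^sup>+\<xi>2. F \<xi>1 (e2 + \<xi>2) \<partial>std_gaussian) \<le> 1" for \<xi>1
        by (rule order_trans[OF nn_integral_mono[of _ _ "\<lambda>_. 1"]]) (simp_all add: F_def f1 GU)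
    qed measurable
    also have "(\<integral>\<^sup>+\<xi>1. (\<integral>\<^sup>+\<xi>2. F (e1 + \<xi>1) (e2 + \<xi>2) \<partial>std_gaussian) \<partial>std_gaussian) = (\<integral>\<^sup>+y. f (y + D b) \<partial>K z)"
      unfolding K_def F_def e1_def e2_def noise
      by (rule nn_integral_kernel[OF gm, symmetric]) (rule measurable_compose[OF addm f])
    finally show ?thesis using \<epsilon>0 by (simp add: \<epsilon>[symmetric] add.assoc ennreal_plus[symmetric] del: ennreal_plus)
  qed
  have \<epsilon>_minus: "\<epsilon> (- b) = \<epsilon> b" for b by (simp add: \<epsilon>_def)
  have \<epsilon>_nonneg: "0 \<le> \<epsilon> b" for b unfolding \<epsilon>_def using hs \<sigma>_pos m by (intro add_nonneg_nonneg mult_nonneg_nonneg) auto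
  have upper1: "\<tau> (Suc n) \<le> \<epsilon> (w ^ Suc n)" for n
    unfolding \<tau>_eq
  proof (rule tv_dist_le)
    fix A :: "((real^2) \<times> (real^2)) set" assume A[measurable]: "A \<in> sets borel"
    define b where "b = w ^ Suc n"
    define Ab where "Ab = {y. y + D b \<in> A}"
    have Ab[measurable]: "Ab \<in> sets borel"
      using measurable_sets[OF addm[of "D b"] A] by (simp add: Ab_def vimage_def)
    interpret M: prob_space "\<mu> (Suc n)" by (rule \<mu>P)
    interpret M0: prob_space "\<mu> n" by (rule \<mu>P)
    have \<mu>U: "emeasure (\<mu> n) UNIV = 1" using M0.emeasure_space_1 sets_eq_imp_space_eq[OF \<mu>S[of n]] by simp
    have e: "emeasure (\<mu> (Suc n)) B = (\<integral>\<^sup>+z. (\<integral>\<^sup>+y. indicator B y \<partial>K z) \<partial>\<mu> n)" if B: "B \<in> sets borel" for B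
    proof -
      have "emeasure (\<mu> (Suc n)) B = (\<integral>\<^sup>+y. indicator B y \<partial>\<mu> (Suc n))"
        by (rule nn_integral_indicator[symmetric]) (simp add: \<mu>S B)
      also have "\<dots> = (\<integral>\<^sup>+z. (\<integral>\<^sup>+y. indicator B y \<partial>K z) \<partial>\<mu> n)"
        unfolding \<mu>_def dirac_iterate_Suc
        by (rule nn_integral_bind_kernel[OF KM]) (use \<mu>S B in \<open>auto simp: \<mu>_def\<close>)
      finally show ?thesis .
    qed
    have im: "(\<lambda>z. \<integral>\<^sup>+y. indicator B y \<partial>K z) \<in> borel_measurable (\<mu> n)" if B: "B \<in> sets borel" for B
    proof -
      have "(\<lambda>z. emeasure (K z) B) \<in> borel_measurable borel" by (rule measurable_emeasure_kernel[OF KM B])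
      then show ?thesis by (simp add: measurable_cong_sets[OF \<mu>S refl] KS B)
    qed
    have cmp: "emeasure (\<mu> (Suc n)) B \<le> emeasure (\<mu> (Suc n)) B' + ennreal (\<epsilon> b)"
      if B: "B \<in> sets borel" and B': "B' \<in> sets borel" and sh: "\<And>y. indicator B (y + D b') = (indicator B' y :: ennreal)" and b': "b' = b \<or> b' = - b" for B B' b'
    proof -
      have i1: "indicator B y \<le> (1 :: ennreal)" for y :: "(real^2) \<times> (real^2)" by (simp add: indicator_def)
      have "\<epsilon> b' = \<epsilon> b" using b' \<epsilon>_minus by auto
      then have "emeasure (\<mu> (Suc n)) B \<le> (\<integral>\<^sup>+z. (\<integral>\<^sup>+y. indicator B' y \<partial>K z) + ennreal (\<epsilon> b) \<partial>\<mu> n)"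
        unfolding e[OF B] using shift[of "indicator B" _ b', OF _ i1] B
        by (intro nn_integral_mono) (simp add: sh)
      also have "\<dots> = emeasure (\<mu> (Suc n)) B' + ennreal (\<epsilon> b)"
        unfolding e[OF B'] using im[OF B'] by (subst nn_integral_add) (simp_all add: sets_eq_imp_space_eq[OF \<mu>S[of n]] \<mu>U)
      finally show ?thesis .
    qed
    have "emeasure (\<mu> (Suc n)) A \<le> emeasure (\<mu> (Suc n)) Ab + ennreal (\<epsilon> b)"
      by (rule cmp[of _ _ b]) (auto simp: Ab_def indicator_def)
    moreover have "emeasure (\<mu> (Suc n)) Ab \<le> emeasure (\<mu> (Suc n)) A + ennreal (\<epsilon> b)"
    proof (rule cmp[of _ _ "- b"])
      have "D (- b) + D b = 0" unfolding D_add[symmetric] by (simp add: D_def plane_simps zero_prod_def)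
      then have yD: "y + D (- b) + D b = y" for y by (simp add: add.assoc)
      show "indicator Ab (y + D (- b)) = (indicator A y :: ennreal)" for y
        by (simp only: Ab_def indicator_def mem_Collect_eq yD)
    qed auto
    moreover have "measure (distr (\<mu> (Suc n)) borel (\<lambda>y. y + D b)) A = measure (\<mu> (Suc n)) Ab"
    proof -
      have "(\<lambda>y. y + D b) \<in> measurable (\<mu> (Suc n)) borel" using addm by (simp add: measurable_cong_sets[OF \<mu>S refl])
      from measure_distr[OF this A] show ?thesis
        using sets_eq_imp_space_eq[OF \<mu>S[of "Suc n"]] by (simp add: Ab_def vimage_def)
    qed
    ultimately show "\<bar>measure (\<mu> (Suc n)) A - measure (distr (\<mu> (Suc n)) borel (\<lambda>y. y + D (w ^ Suc n))) A\<bar> \<le> \<epsilon> (w ^ Suc n)"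
      unfolding b_def[symmetric]
      using \<epsilon>_nonneg[of b] by (simp add: M.emeasure_eq_measure ennreal_plus[symmetric] abs_le_iff del: ennreal_plus)
  qed
  define c2 where "c2 = ((1 / (h * \<sigma>))\<^sup>2 / 2 + 1 / (h * \<sigma>) * m) + ((cmod \<eta>' / \<sigma>)\<^sup>2 / 2 + cmod \<eta>' / \<sigma> * m)"
  have c2: "0 < c2" unfolding c2_def using hs \<sigma>_pos m by (intro add_pos_nonneg add_nonneg_nonneg mult_nonneg_nonneg add_pos_pos mult_pos_pos divide_pos_pos) auto
  have upper: "\<tau> n \<le> c2 * \<theta> ^ n" if "0 < n" for n
  proof -
    have t: "0 \<le> \<theta> ^ n" "\<theta> ^ n \<le> 1" using \<theta> by (auto simp: power_le_one)
    then have t2: "(\<theta> ^ n)\<^sup>2 \<le> \<theta> ^ n" by (simp add: power2_eq_square mult_left_le)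
    have "\<tau> n \<le> \<epsilon> (w ^ n)" using upper1[of "n - 1"] that by simp
    also have "\<epsilon> (w ^ n) = ((1 / (h * \<sigma>))\<^sup>2 / 2) * (\<theta> ^ n)\<^sup>2 + (1 / (h * \<sigma>) * m) * \<theta> ^ n + (((cmod \<eta>' / \<sigma>)\<^sup>2 / 2) * (\<theta> ^ n)\<^sup>2 + (cmod \<eta>' / \<sigma> * m) * \<theta> ^ n)"
      by (simp add: \<epsilon>_def \<theta>_def norm_power power_divide power_mult_distrib mult_ac)
    also have "\<dots> \<le> ((1 / (h * \<sigma>))\<^sup>2 / 2) * \<theta> ^ n + (1 / (h * \<sigma>) * m) * \<theta> ^ n + (((cmod \<eta>' / \<sigma>)\<^sup>2 / 2) * \<theta> ^ n + (cmod \<eta>' / \<sigma> * m) * \<theta> ^ n)"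
      by (intro add_mono mult_left_mono t2 order_refl) auto
    also have "\<dots> = c2 * \<theta> ^ n" unfolding c2_def by (simp only: distrib_right)
    finally show ?thesis .
  qed
  have "(\<lambda>n. \<theta> ^ n * norm (D 1)) \<longlonglongrightarrow> 0 * norm (D 1)" using \<theta> by (intro tendsto_intros LIMSEQ_realpow_zero) auto
  then have small: "eventually (\<lambda>n. \<theta> ^ n * norm (D 1) < 1) sequentially" by (intro order_tendstoD) auto
  have rt: "(\<lambda>n. root n (c * \<theta> ^ n)) \<longlonglongrightarrow> \<theta>" if c: "0 < c" for c
  proof -
    have "(\<lambda>n. root n c * \<theta>) \<longlonglongrightarrow> 1 * \<theta>" by (intro tendsto_intros LIMSEQ_root_const c)
    moreover have "eventually (\<lambda>n. root n c * \<theta> = root n (c * \<theta> ^ n)) sequentially"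
      by (rule eventually_mono[OF eventually_gt_at_top[of 0]]) (use \<theta> in \<open>simp add: real_root_mult real_root_power_cancel\<close>)
    ultimately show ?thesis by (simp add: Lim_transform_eventually)
  qed
  have "(\<lambda>n. root n (\<tau> n)) \<longlonglongrightarrow> \<theta>"
  proof (rule tendsto_sandwich[OF _ _ rt[OF c1] rt[OF c2]])
    show "eventually (\<lambda>n. root n (c1 * \<theta> ^ n) \<le> root n (\<tau> n)) sequentially"
      using small eventually_gt_at_top[of 0] by eventually_elim (auto intro!: lower)
    show "eventually (\<lambda>n. root n (\<tau> n) \<le> root n (c2 * \<theta> ^ n)) sequentially"
      using eventually_gt_at_top[of 0] by eventually_elim (auto intro!: upper)
  qed
  then show ?thesis by (intro that[of "D 1"]) (simp add: \<tau>_def \<theta>_def \<mu>_def K_def U_def)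
qed

end

section \<open>Metastable cycles\<close>

lemma C_infinity_gradient_continuous:
  fixes U :: "'a::euclidean_space \<Rightarrow> real"
  assumes U: "C_infinity U" and g: "\<And>x. GDERIV U x :> g x"
  shows "continuous_on UNIV g"
proof (subst continuous_on_componentwise, rule ballI)
  fix b :: 'a
  have "frechet_derivative U (at x) b = inner (g x) b" for x
    using frechet_derivative_at[OF g[of x, unfolded gderiv_def]] by (metis inner_commute)
  then show "continuous_on UNIV (\<lambda>x. inner (g x) b)"
    using C_infinity_continuous[OF C_infinity_directional[OF U, of b]] by simp
qed

text \<open>If \<open>x - y\<close> lies in the normal cone of the polytope at the vertex \<open>y\<close>, the polytope lies in a half-space
  that makes \<open>y\<close> the nearest point; it suffices to test the vertices.\<close>

lemma closest_point_hull_eq: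
  assumes fin: "finite Y" and y: "y \<in> Y" and cone: "\<And>z. z \<in> Y \<Longrightarrow> inner (x - y) (z - y) \<le> 0"
  shows "closest_point (convex hull Y) x = (y :: 'a::euclidean_space)"
proof -
  have "convex hull Y \<subseteq> {z. inner (x - y) z \<le> inner (x - y) y}"
    using cone by (intro hull_minimal convex_halfspace_le) (auto simp: inner_diff_right)
  then have half: "inner (x - y) (z - y) \<le> 0" if "z \<in> convex hull Y" for z using that by (auto simp: inner_diff_right)
  have "dist x y \<le> dist x z" if "z \<in> convex hull Y" for z
  proof -
    have "(norm (x - z))\<^sup>2 = (norm (x - y))\<^sup>2 + (norm (z - y))\<^sup>2 - 2 * inner (x - y) (z - y)"
      by (simp add: power2_norm_eq_inner inner_diff inner_commute algebra_simps)
    then have "(norm (x - y))\<^sup>2 \<le> (norm (x - z))\<^sup>2"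
      using half[OF that] zero_le_power2[of "norm (z - y)"] by linarith
    then have "norm (x - y) \<le> norm (x - z)" by (rule power2_le_imp_le) simp
    then show ?thesis by (simp add: dist_norm)
  qed
  then show ?thesis using closest_point_unique[of "convex hull Y" y x] fin y
    by (metis convex_convex_hull finite_imp_compact compact_convex_hull compact_imp_closed hull_inc)
qed

text \<open>A chain started in \<open>B 0\<close> is still in step with the sets \<open>B t\<close> after \<open>n\<close> steps, with probability at least
  \<open>1 - n \<epsilon> \<ge> 15 / 16\<close>. An invariant law cannot be in step: it gives the disjoint sets \<open>B n\<close> and
  \<open>B (n + 1)\<close> almost the same mass, so \<open>B n\<close> has mass at most \<open>1 / (2 - \<epsilon>) \<le> 16 / 31\<close>. For \<open>n = 0\<close> the
  hypothesis does not control \<open>\<epsilon>\<close>, but then the start is a point mass and the invariant law has no atom there.\<close>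

lemma cycle_total_variation:
  fixes Q :: "'b::t1_space \<Rightarrow> 'b measure"
  assumes Q: "Q \<in> measurable borel (subprob_algebra borel)" "\<And>z. prob_space (Q z)"
    and B: "\<And>t. B t \<in> sets borel" "\<And>t. B t \<inter> B (Suc t) = {}"
    and stay: "\<And>t z. z \<in> B t \<Longrightarrow> 1 - \<epsilon> \<le> measure (Q z) (B (Suc t))" and \<epsilon>: "0 \<le> \<epsilon>"
    and z0: "z0 \<in> B 0" and inv: "invariant_law Q \<pi>" and atom: "measure \<pi> {z0} = 0"
    and n: "real n * \<epsilon> \<le> 1 / 16"
  shows "3 / 8 \<le> tv_dist (dirac_iterate Q n z0) \<pi>"
proof (cases "n = 0")
  case True
  have P\<pi>: "prob_space \<pi>" using inv by (simp add: invariant_law_def)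
  have P0: "prob_space (return borel z0)" by (rule prob_space_return) simp
  have "{z0} \<in> sets borel" by simp
  from tv_dist_ge[OF P0 P\<pi> this] show ?thesis
    using True atom by (simp add: dirac_iterate_0 measure_return)
next
  case False
  interpret \<pi>: prob_space \<pi> using inv by (simp add: invariant_law_def)
  have S: "sets \<pi> = sets borel" and b\<pi>: "bind \<pi> Q = \<pi>" using inv by (auto simp: invariant_law_def)
  have "\<epsilon> \<le> real n * \<epsilon>" using False \<epsilon> by (simp add: mult_le_cancel_right1)
  then have \<epsilon>16: "\<epsilon> \<le> 1 / 16" using n by linarith
  interpret Qp: prob_space "Q z" for z by (rule Q(2))
  have push: "(1 - \<epsilon>) * measure \<mu> (B t) \<le> measure (bind \<mu> Q) (B (Suc t))"
    if \<mu>: "prob_space \<mu>" "sets \<mu> = sets borel" "prob_space (bind \<mu> Q)" for \<mu> t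
  proof -
    interpret \<mu>: prob_space \<mu> by (rule \<mu>(1))
    interpret \<mu>Q: prob_space "bind \<mu> Q" by (rule \<mu>(3))
    have "ennreal (1 - \<epsilon>) * emeasure \<mu> (B t) = (\<integral>\<^sup>+z. ennreal (1 - \<epsilon>) * indicator (B t) z \<partial>\<mu>)"
      using B(1)[of t] by (simp add: nn_integral_cmult_indicator \<mu>(2))
    also have "\<dots> \<le> (\<integral>\<^sup>+z. emeasure (Q z) (B (Suc t)) \<partial>\<mu>)"
      using stay[of _ t] by (intro nn_integral_mono) (auto simp: Qp.emeasure_eq_measure intro!: ennreal_leI split: split_indicator)
    also have "\<dots> = emeasure (bind \<mu> Q) (B (Suc t))"
      using B(1)[of "Suc t"] \<mu>.not_empty Q(1)
      by (intro emeasure_bind[symmetric]) (auto simp: measurable_cong_sets[OF \<mu>(2) refl])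
    finally show ?thesis using \<epsilon>16 \<epsilon>
      by (simp add: \<mu>.emeasure_eq_measure \<mu>Q.emeasure_eq_measure ennreal_mult[symmetric] del: ennreal_minus)
  qed
  note D = dirac_iterate_prob[OF Q, of _ z0]
  have chain: "1 - real k * \<epsilon> \<le> measure (dirac_iterate Q k z0) (B k)" for k
  proof (induction k)
    case 0 then show ?case using z0 B(1)[of 0] by (simp add: dirac_iterate_0 measure_return)
  next
    case (Suc k)
    interpret M: prob_space "dirac_iterate Q k z0" using D by blast
    have "(1 - \<epsilon>) * measure (dirac_iterate Q k z0) (B k) \<le> measure (dirac_iterate Q (Suc k) z0) (B (Suc k))"
      unfolding dirac_iterate_Suc using D[of k] D[of "Suc k"] by (intro push) (auto simp: dirac_iterate_Suc)
    moreover have "measure (dirac_iterate Q k z0) (B k) - \<epsilon> \<le> (1 - \<epsilon>) * measure (dirac_iterate Q k z0) (B k)"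
      using mult_left_mono[OF M.prob_le_1 \<epsilon>, of "B k"] by (simp add: algebra_simps)
    ultimately show ?case using Suc.IH by (simp add: algebra_simps)
  qed
  have "(1 - \<epsilon>) * measure \<pi> (B n) \<le> measure \<pi> (B (Suc n))"
    using push[OF \<pi>.prob_space_axioms S] b\<pi> \<pi>.prob_space_axioms by simp
  moreover have "measure \<pi> (B n) + measure \<pi> (B (Suc n)) \<le> 1"
    using \<pi>.finite_measure_Union[of "B n" "B (Suc n)"] B S \<pi>.prob_le_1[of "B n \<union> B (Suc n)"] by simp
  ultimately have "(2 - \<epsilon>) * measure \<pi> (B n) \<le> 1" by (simp add: algebra_simps)
  moreover have "31 / 16 * measure \<pi> (B n) \<le> (2 - \<epsilon>) * measure \<pi> (B n)"
    using \<epsilon>16 by (intro mult_right_mono) auto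
  ultimately have "measure \<pi> (B n) \<le> 16 / 31" by simp
  moreover have "15 / 16 \<le> measure (dirac_iterate Q n z0) (B n)" using chain[of n] n by linarith
  moreover have "\<bar>measure (dirac_iterate Q n z0) (B n) - measure \<pi> (B n)\<bar> \<le> tv_dist (dirac_iterate Q n z0) \<pi>"
    using D[of n] by (intro tv_dist_ge \<pi>.prob_space_axioms B) auto
  ultimately show ?thesis by linarith
qed

text \<open>The product coupling with a point mass costs the second moment about that point.\<close>

lemma W2_return_le:
  fixes \<pi> :: "('b::euclidean_space) measure"
  assumes P: "prob_space \<pi>" and S: "sets \<pi> = sets borel" and D: "0 \<le> D"
    and m: "(\<integral>\<^sup>+y. ennreal ((dist z y)\<^sup>2) \<partial>\<pi>) \<le> ennreal (D\<^sup>2)"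
  shows "W2 (return borel z) \<pi> \<le> ennreal D"
proof -
  interpret prob_space \<pi> by (rule P)
  define \<Gamma> where "\<Gamma> = distr \<pi> (borel \<Otimes>\<^sub>M borel) (\<lambda>y. (z, y))"
  have pm: "(\<lambda>y. (z, y)) \<in> measurable \<pi> (borel \<Otimes>\<^sub>M borel)"
    unfolding measurable_cong_sets[OF S refl] by measurable
  have "distr \<Gamma> borel fst = return borel z"
    unfolding \<Gamma>_def by (subst distr_distr[OF _ pm]) (auto simp: comp_def prob_space.distr_const[OF P])
  moreover have "distr \<Gamma> borel snd = \<pi>"
    unfolding \<Gamma>_def by (subst distr_distr[OF _ pm]) (auto simp: comp_def distr_id2[OF S[symmetric]])
  ultimately have \<Gamma>: "\<Gamma> \<in> couplings (return borel z) \<pi>" by (simp add: couplings_def \<Gamma>_def)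
  have "(\<integral>\<^sup>+p. ennreal ((dist (fst p) (snd p))\<^sup>2) \<partial>\<Gamma>) = (\<integral>\<^sup>+y. ennreal ((dist z y)\<^sup>2) \<partial>\<pi>)"
    unfolding \<Gamma>_def by (subst nn_integral_distr[OF pm]) simp_all
  then have le: "(\<integral>\<^sup>+p. ennreal ((dist (fst p) (snd p))\<^sup>2) \<partial>\<Gamma>) \<le> ennreal (D\<^sup>2)" using m by simp
  have "W2 (return borel z) \<pi> \<le> ennreal_sqrt (\<integral>\<^sup>+p. ennreal ((dist (fst p) (snd p))\<^sup>2) \<partial>\<Gamma>)"
    unfolding W2_def by (rule INF_lower[OF \<Gamma>])
  also have "\<dots> \<le> ennreal D"
  proof -
    have "enn2real (\<integral>\<^sup>+p. ennreal ((dist (fst p) (snd p))\<^sup>2) \<partial>\<Gamma>) \<le> D\<^sup>2"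
      using le by (intro enn2real_leI) auto
    then have "sqrt (enn2real (\<integral>\<^sup>+p. ennreal ((dist (fst p) (snd p))\<^sup>2) \<partial>\<Gamma>)) \<le> D"
      using D real_sqrt_le_mono[of _ "D\<^sup>2"] by fastforce
    moreover have "(\<integral>\<^sup>+p. ennreal ((dist (fst p) (snd p))\<^sup>2) \<partial>\<Gamma>) \<noteq> \<infinity>" using le by (auto simp: top_unique)
    ultimately show ?thesis by (simp add: ennreal_sqrt_def ennreal_leI)
  qed
  finally show ?thesis .
qed

text \<open>The potential is \<open>\<bar>y\<bar>\<^sup>2 / 2\<close> plus \<open>\<kappa> - 1\<close> times the smoothed projection potential of the polygon with vertices
  \<open>p\<^sub>t = c x\<^sub>t\<close>. The strict cone condition leaves room: the projection is constantly \<open>p\<^sub>t\<close> on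
  the ball of radius \<open>2 \<delta>\<close> around \<open>x\<^sub>t\<close>, of which smoothing at scale \<open>\<delta>\<close> preserves half. There the gradient is
  affine with curvature \<open>1\<close>, and everywhere it is a bounded perturbation of the identity.\<close>

lemma exists_cyclic_potential:
  fixes c :: complex and \<kappa> :: real and K :: nat
  assumes K: "3 \<le> K" and \<kappa>: "1 \<le> \<kappa>"
    and cone: "\<And>j::nat. 0 < j \<Longrightarrow> j < K \<Longrightarrow> Re (cnj (1 - c) * (c * (cis (2 * pi / K * j) - 1))) < 0"
  defines "x \<equiv> \<lambda>t::nat. plane (cis (2 * pi / K * t))"
  obtains U :: "real^2 \<Rightarrow> real" and g \<delta> where "C_infinity U" "\<And>y. GDERIV U y :> g y" "0 < \<delta>"
    "\<And>a b. (norm (a - b))\<^sup>2 \<le> inner (g a - g b) (a - b)"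
    "\<And>a b. inner (g a - g b) (a - b) \<le> \<kappa> * (norm (a - b))\<^sup>2"
    "\<And>y. norm (g y - y) \<le> (\<kappa> - 1) * cmod c"
    "\<And>t y. norm (y - x t) \<le> \<delta> \<Longrightarrow> g y = y + (\<kappa> - 1) *\<^sub>R plane (c * cis (2 * pi / K * t))"
proof -
  define \<theta> where "\<theta> = 2 * pi / real K"
  define p where "p = (\<lambda>t::nat. plane (c * cis (\<theta> * t)))"
  have x: "x t = plane (cis (\<theta> * t))" for t by (simp add: x_def \<theta>_def)
  have K0: "real K \<noteq> 0" using K by simp
  have per: "cis (\<theta> * real (t mod K)) = cis (\<theta> * real t)" for t
  proof -
    have "real t = real (t mod K) + real K * real (t div K)"
      by (metis add.commute mult.commute of_nat_add of_nat_mult div_mult_mod_eq)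
    then have "\<theta> * real t = \<theta> * real (t mod K) + 2 * pi * real (t div K)"
      using K0 by (simp add: \<theta>_def distrib_left)
    then show ?thesis by (simp add: cis_mult[symmetric] cis_multiple_2pi)
  qed
  have neg: "inner (x t - p t) (p j - p t) < 0" if tj: "t < K" "j < K" "j \<noteq> t" for t j
  proof -
    define d where "d = (if t \<le> j then j - t else j + K - t)"
    have d: "0 < d" "d < K" using tj by (auto simp: d_def)
    have cd: "cis (\<theta> * real j) * cnj (cis (\<theta> * real t)) = cis (\<theta> * real d)"
    proof (cases "t \<le> j")
      case True then show ?thesis by (simp add: d_def cis_cnj cis_mult of_nat_diff algebra_simps)
    next
      case False
      then have "real d = real j + real K - real t" using tj by (simp add: d_def of_nat_diff)
      then have "\<theta> * real d = (\<theta> * real j - \<theta> * real t) + 2 * pi"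
      proof -
        have "\<theta> * real K = 2 * pi" using K0 by (simp add: \<theta>_def)
        then show ?thesis unfolding \<open>real d = real j + real K - real t\<close> by (simp add: right_diff_distrib distrib_left)
      qed
      then show ?thesis by (simp add: cis_cnj cis_mult cis_mult[symmetric, of "\<theta> * real j - \<theta> * real t" "2 * pi"])
    qed
    have u: "cis (\<theta> * real t) * cnj (cis (\<theta> * real t)) = 1" by (simp add: cis_cnj cis_mult)
    have "inner (x t - p t) (p j - p t) = inner (p j - p t) (x t - p t)" by (rule inner_commute)
    also have "\<dots> = Re ((c * cis (\<theta> * j) - c * cis (\<theta> * t)) * cnj (cis (\<theta> * t) - c * cis (\<theta> * t)))"
      unfolding x p_def plane_simps(2)[symmetric] inner_plane ..
    also have "(c * cis (\<theta> * j) - c * cis (\<theta> * t)) * cnj (cis (\<theta> * t) - c * cis (\<theta> * t))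
      = cnj (1 - c) * (c * (cis (\<theta> * j) * cnj (cis (\<theta> * t)) - cis (\<theta> * t) * cnj (cis (\<theta> * t))))"
      by (simp add: algebra_simps)
    also have "\<dots> = cnj (1 - c) * (c * (cis (\<theta> * d) - 1))" by (simp only: cd u)
    also have "Re \<dots> < 0" using cone[OF d] by (simp add: \<theta>_def)
    finally show ?thesis .
  qed
  have "eventually (\<lambda>\<delta>. \<forall>t\<in>{..<K}. \<forall>j\<in>{..<K}. inner (x t - p t) (p j - p t) + 2 * \<delta> * norm (p j - p t) \<le> 0) (at_right (0::real))"
  proof (intro eventually_ball_finite ballI finite_lessThan)
    fix t j assume tj: "t \<in> {..<K}" "j \<in> {..<K}"
    show "eventually (\<lambda>\<delta>. inner (x t - p t) (p j - p t) + 2 * \<delta> * norm (p j - p t) \<le> 0) (at_right (0::real))"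
    proof (cases "j = t")
      case False
      have "((\<lambda>\<delta>. inner (x t - p t) (p j - p t) + 2 * \<delta> * norm (p j - p t)) \<longlongrightarrow> inner (x t - p t) (p j - p t) + 2 * 0 * norm (p j - p t)) (at_right (0::real))"
        by (intro tendsto_intros)
      then have "eventually (\<lambda>\<delta>. inner (x t - p t) (p j - p t) + 2 * \<delta> * norm (p j - p t) < 0) (at_right (0::real))"
        using neg[of t j] tj False by (intro order_tendstoD) auto
      then show ?thesis by eventually_elim simp
    qed simp
  qed
  then have "eventually (\<lambda>\<delta>. 0 < \<delta> \<and> (\<forall>t\<in>{..<K}. \<forall>j\<in>{..<K}. inner (x t - p t) (p j - p t) + 2 * \<delta> * norm (p j - p t) \<le> 0)) (at_right (0::real))"
    by (intro eventually_conj eventually_at_right_less)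
  then obtain \<delta> where \<delta>: "0 < \<delta>" and \<delta>': "\<And>t j. t < K \<Longrightarrow> j < K \<Longrightarrow> inner (x t - p t) (p j - p t) + 2 * \<delta> * norm (p j - p t) \<le> 0"
    using eventually_happens'[OF trivial_limit_at_right_real] by (metis (no_types, lifting) lessThan_iff)
  define Y where "Y = p ` {..<K}"
  have finY: "finite Y" and neY: "Y \<noteq> {}" using K by (auto simp: Y_def lessThan_empty_iff)
  have near: "closest_point (convex hull Y) y = p t" if t: "t < K" and y: "norm (y - x t) \<le> 2 * \<delta>" for t y
  proof (rule closest_point_hull_eq[OF finY])
    show "p t \<in> Y" using t by (simp add: Y_def)
    fix z assume "z \<in> Y"
    then obtain j where j: "j < K" "z = p j" by (auto simp: Y_def)
    have "inner (y - p t) (z - p t) = inner (x t - p t) (z - p t) + inner (y - x t) (z - p t)"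
      by (simp add: inner_diff_left)
    also have "inner (y - x t) (z - p t) \<le> norm (y - x t) * norm (z - p t)" by (rule norm_cauchy_schwarz)
    also have "\<dots> \<le> 2 * \<delta> * norm (z - p t)" using y by (rule mult_right_mono) simp
    also have "inner (x t - p t) (z - p t) + 2 * \<delta> * norm (z - p t) \<le> 0" using \<delta>'[OF t j(1)] j(2) by simp
    finally show "inner (y - p t) (z - p t) \<le> 0" by simp
  qed
  have hullB: "norm y \<le> cmod c" if "y \<in> convex hull Y" for y
  proof -
    have "convex hull Y \<subseteq> cball 0 (cmod c)"
      by (intro hull_minimal) (auto simp: Y_def p_def norm_plane norm_mult)
    then show ?thesis using that by auto
  qed
  obtain \<Phi> G where \<Phi>: "C_infinity \<Phi>" "\<And>y. GDERIV \<Phi> y :> G y" and GB: "\<And>y. norm (G y) \<le> cmod c"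
    and G0: "\<And>a b. 0 \<le> inner (G a - G b) (a - b)" and G1: "\<And>a b. inner (G a - G b) (a - b) \<le> (norm (a - b))\<^sup>2"
    and Gp: "\<And>y q. (\<And>z. norm (z - y) \<le> \<delta> \<Longrightarrow> closest_point (convex hull Y) z = q) \<Longrightarrow> G y = q"
  proof (rule smooth_projection_potential[of "convex hull Y" \<delta> "cmod c"])
    show "closed (convex hull Y)" using finY by (simp add: finite_imp_compact compact_convex_hull compact_imp_closed)
    show "convex hull Y \<noteq> {}" using neY by simp
  qed (use \<delta> hullB in auto)
  define U where "U = (\<lambda>y. (norm y)\<^sup>2 / 2 + (\<kappa> - 1) * \<Phi> y)"
  define g where "g = (\<lambda>y. y + (\<kappa> - 1) *\<^sub>R G y)"
  have nsq: "(\<lambda>y::real^2. (norm y)\<^sup>2 / 2) = (\<lambda>y. 1 / 2 * (\<Sum>b\<in>Basis. inner y b * inner y b))"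
    unfolding norm_power2_eq_sum by (simp add: power2_eq_square)
  have "Ck_differentiable k (\<lambda>y::real^2. \<Sum>b\<in>B. inner y b * inner y b)" for k and B :: "(real^2) set"
  proof (induction B rule: infinite_finite_induct)
    case (insert b B)
    have "Ck_differentiable k (\<lambda>y. inner y b * inner y b + (\<Sum>b\<in>B. inner y b * inner y b))"
      by (intro Ck_differentiable_add Ck_differentiable_mult Ck_differentiable_linear bounded_linear_inner_left insert.IH)
    then show ?case using insert.hyps by simp
  qed (auto intro: Ck_differentiable_const)
  then have "C_infinity (\<lambda>y::real^2. (norm y)\<^sup>2 / 2)"
    unfolding nsq C_infinity_def by (intro allI Ck_differentiable_mult Ck_differentiable_const)
  then have CU: "C_infinity U" using \<Phi>(1) unfolding C_infinity_def U_def
    by (intro allI Ck_differentiable_add Ck_differentiable_mult Ck_differentiable_const) blast+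
  show ?thesis
  proof (rule that[of U g \<delta>])
    show "C_infinity U" by (rule CU)
    show "GDERIV U y :> g y" for y
    proof -
      have "(U has_derivative (\<lambda>v. inner v y + (\<kappa> - 1) * inner v (G y))) (at y)"
        unfolding U_def power2_norm_eq_inner using \<Phi>(2)[of y, unfolded gderiv_def]
        by (auto intro!: derivative_eq_intros simp: inner_commute)
      then show ?thesis by (simp add: gderiv_def g_def inner_add_right)
    qed
    have gab: "inner (g a - g b) (a - b) = (norm (a - b))\<^sup>2 + (\<kappa> - 1) * inner (G a - G b) (a - b)" for a b
      by (simp add: g_def power2_norm_eq_inner inner_diff inner_add algebra_simps)
    show "(norm (a - b))\<^sup>2 \<le> inner (g a - g b) (a - b)" for a b unfolding gab using G0[of a b] \<kappa> by simp
    show "inner (g a - g b) (a - b) \<le> \<kappa> * (norm (a - b))\<^sup>2" for a b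
      unfolding gab using mult_left_mono[OF G1[of a b], of "\<kappa> - 1"] \<kappa> by (simp add: algebra_simps)
    show "norm (g y - y) \<le> (\<kappa> - 1) * cmod c" for y using GB[of y] \<kappa> by (simp add: g_def mult_left_mono)
    show "g y = y + (\<kappa> - 1) *\<^sub>R plane (c * cis (2 * pi / K * t))" if y: "norm (y - x t) \<le> \<delta>" for t y
    proof -
      have xt: "x (t mod K) = x t" "p (t mod K) = p t" by (simp_all add: x p_def per)
      have "G y = p (t mod K)"
      proof (rule Gp)
        fix z assume "norm (z - y) \<le> \<delta>"
        then have "norm (z - x t) \<le> 2 * \<delta>" using y norm_triangle_ineq[of "z - y" "y - x t"] by simp
        then show "closest_point (convex hull Y) z = p (t mod K)" using K by (intro near) (auto simp: xt)
      qed
      then show ?thesis unfolding xt by (simp add: g_def p_def \<theta>_def)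
    qed
  qed (rule \<delta>)
qed

context obabo begin

text \<open>An invariant law is its own image under a kernel with a density.\<close>

lemma kernel_atomless:
  fixes U :: "'a::euclidean_space \<Rightarrow> real"
  assumes gm: "gradient U \<in> borel_measurable borel" and inv: "invariant_law (obabo_kernel h \<gamma> U) \<pi>"
  shows "measure \<pi> {z} = 0"
proof -
  have S: "sets \<pi> = sets borel" and b: "bind \<pi> (obabo_kernel h \<gamma> U) = \<pi>" using inv by (auto simp: invariant_law_def)
  have "emeasure (obabo_kernel h \<gamma> U y) {z} = 0" for y
  proof -
    have "emeasure (obabo_kernel h \<gamma> U y) {z} = (\<integral>\<^sup>+x. indicator {z} x \<partial>obabo_kernel h \<gamma> U y)"
      by (rule nn_integral_indicator[symmetric]) simp
    also have "\<dots> = (\<integral>\<^sup>+x. ennreal (transition_density U y x) * indicator {z} x \<partial>lborel)"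
      by (rule kernel_density[OF gm]) simp
    also have "\<dots> = (\<integral>\<^sup>+x. 0 \<partial>(lborel :: ('a \<times> 'a) measure))"
    proof (rule nn_integral_cong_AE)
      have "{z} \<in> null_sets (lborel :: ('a \<times> 'a) measure)" by (simp add: null_sets_def)
      then have "AE x in lborel. x \<notin> {z}" by (rule AE_not_in)
      then show "AE x in lborel. ennreal (transition_density U y x) * indicator {z} x = 0"
        by eventually_elim simp
    qed
    finally show ?thesis by simp
  qed
  then have "(\<integral>\<^sup>+x. indicator {z} x \<partial>(bind \<pi> (obabo_kernel h \<gamma> U))) = 0"
    by (subst nn_integral_bind_kernel[OF kernel_measurable[OF gm] S]) simp_all
  then have "emeasure \<pi> {z} = 0" unfolding b using S by (subst (asm) nn_integral_indicator) auto
  then show ?thesis by (simp add: measure_def)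
qed

text \<open>Each of the two planar noises has a tail with the factor \<open>(sqrt 2)\<^sup>2 = 2\<close>.\<close>

lemma noise_tail:
  fixes U :: "real^2 \<Rightarrow> real"
  assumes gm: "gradient U \<in> borel_measurable borel" and t: "0 \<le> t" and A: "A \<in> sets borel"
    and sub: "\<And>\<xi>1 \<xi>2. norm \<xi>1 \<le> t \<Longrightarrow> norm \<xi>2 \<le> t \<Longrightarrow> obabo_step h \<gamma> U z (\<xi>1, \<xi>2) \<in> A"
  shows "1 - 4 * exp (- t\<^sup>2 / 4) \<le> measure (obabo_kernel h \<gamma> U z) A"
proof -
  interpret K: prob_space "obabo_kernel h \<gamma> U z" by (rule kernel_prob[OF gm])
  interpret G: prob_space "std_gaussian :: (real^2) measure" by (rule prob_space_std_gaussian)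
  have GU: "emeasure (std_gaussian :: (real^2) measure) UNIV = 1" using G.emeasure_space_1 by simp
  define T where "T = {\<xi> :: real^2. t < norm \<xi>}"
  have Tm[measurable]: "T \<in> sets borel" unfolding T_def by measurable
  have sp: "space (obabo_kernel h \<gamma> U z) = UNIV" by (simp add: obabo_kernel_def)
  have tail: "emeasure std_gaussian T \<le> ennreal (2 * exp (- t\<^sup>2 / 4))"
    using gaussian_tail[OF t, where 'a="real^2"] by (simp add: T_def)
  have "emeasure (obabo_kernel h \<gamma> U z) (- A) = (\<integral>\<^sup>+y. indicator (- A) y \<partial>obabo_kernel h \<gamma> U z)"
    using A by (intro nn_integral_indicator[symmetric]) simp
  also have "\<dots> = (\<integral>\<^sup>+\<xi>1. (\<integral>\<^sup>+\<xi>2. indicator (- A) (obabo_step h \<gamma> U z (\<xi>1, \<xi>2)) \<partial>std_gaussian) \<partial>std_gaussian)"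
    using A by (intro nn_integral_kernel[OF gm]) simp
  also have "\<dots> \<le> (\<integral>\<^sup>+\<xi>1. (\<integral>\<^sup>+\<xi>2. indicator T \<xi>1 + indicator T \<xi>2 \<partial>(std_gaussian :: (real^2) measure)) \<partial>(std_gaussian :: (real^2) measure))"
    using sub by (intro nn_integral_mono) (auto simp: T_def not_less split: split_indicator)
  also have "\<dots> = (\<integral>\<^sup>+\<xi>1. indicator T \<xi>1 + emeasure std_gaussian T \<partial>(std_gaussian :: (real^2) measure))"
    by (intro nn_integral_cong) (simp add: nn_integral_add GU)
  also have "\<dots> = emeasure std_gaussian T + emeasure std_gaussian T"
    by (simp add: nn_integral_add GU)
  also have "\<dots> \<le> ennreal (2 * exp (- t\<^sup>2 / 4)) + ennreal (2 * exp (- t\<^sup>2 / 4))" by (intro add_mono tail)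
  also have "\<dots> = ennreal (4 * exp (- t\<^sup>2 / 4))" by (simp add: ennreal_plus[symmetric] del: ennreal_plus)
  finally have "measure (obabo_kernel h \<gamma> U z) (- A) \<le> 4 * exp (- t\<^sup>2 / 4)"
    by (simp add: K.emeasure_eq_measure)
  moreover have "measure (obabo_kernel h \<gamma> U z) (- A) = 1 - measure (obabo_kernel h \<gamma> U z) A"
    using K.prob_compl[of A] A by (simp add: sp Compl_eq_Diff_UNIV)
  ultimately show ?thesis by linarith
qed

text \<open>Around each point of the dilated cycle, of radius \<open>R\<close>, the gradient is affine with curvature \<open>1\<close> on a ball of radius
  \<open>\<delta> R\<close>. The trap \<open>T t\<close> consists of the states whose deviation from the cycle at time \<open>t\<close> is at most \<open>\<rho> R\<close> in
  the contracted norm. If both noises are at most \<open>\<eta> R\<close>, a state of \<open>T t\<close> steps into \<open>T (t + 1)\<close>: the new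
  position stays in the ball where the gradient is affine, and the contraction absorbs the noise. So
  a step fails with probability at most \<open>4 exp (- \<eta>\<^sup>2 R\<^sup>2 / 4)\<close>, uniformly over the trap.\<close>

lemma metastable_cycle:
  fixes c :: complex and \<kappa> :: real and K :: nat
  assumes a: "\<bar>1 + \<beta> - s * 1\<bar> < 1 + \<beta>" and \<kappa>: "1 \<le> \<kappa>" and K: "3 \<le> K"
    and rec: "cis (2 * pi / K) = of_real (1 + \<beta>) - of_real \<beta> * cis (- (2 * pi / K)) - of_real s * (1 + of_real (\<kappa> - 1) * c)"
    and cone: "\<And>j::nat. 0 < j \<Longrightarrow> j < K \<Longrightarrow> Re (cnj (1 - c) * (c * (cis (2 * pi / K * j) - 1))) < 0"
  shows "\<exists>U \<in> (potentials \<kappa> :: (real^2 \<Rightarrow> real) set). \<exists>c0 > 0. \<exists>C0 > 0. \<forall>R \<ge> 1.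
        dilated_potential R U \<in> potentials \<kappa> \<and>
        (\<exists>\<pi>. invariant_law (obabo_kernel h \<gamma> (dilated_potential R U)) \<pi> \<and>
             (\<forall>\<pi>'. invariant_law (obabo_kernel h \<gamma> (dilated_potential R U)) \<pi>' \<longrightarrow> \<pi>' = \<pi>) \<and>
             (\<exists>z :: (real^2) \<times> (real^2).
                W2 (return borel z) \<pi> \<le> ennreal (C0 * (1 + R)) \<and>
                (\<forall>n::nat. int n \<le> \<lfloor>exp (c0 * R\<^sup>2) / 16\<rfloor> \<longrightarrow>
                   tv_dist (dirac_iterate (obabo_kernel h \<gamma> (dilated_potential R U)) n z) \<pi> \<ge> 3 / 8)))"
proof -
  define \<theta> where "\<theta> = 2 * pi / real K"
  define x where "x = (\<lambda>t::nat. plane (cis (\<theta> * t)))"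
  obtain U :: "real^2 \<Rightarrow> real" and g \<delta> where U: "C_infinity U" "\<And>y. GDERIV U y :> g y" and \<delta>: "0 < \<delta>"
    and lo: "\<And>a b. (norm (a - b))\<^sup>2 \<le> inner (g a - g b) (a - b)"
    and hi: "\<And>a b. inner (g a - g b) (a - b) \<le> \<kappa> * (norm (a - b))\<^sup>2"
    and gE: "\<And>y. norm (g y - y) \<le> (\<kappa> - 1) * cmod c"
    and gx: "\<And>t y. norm (y - x t) \<le> \<delta> \<Longrightarrow> g y = y + (\<kappa> - 1) *\<^sub>R plane (c * cis (\<theta> * t))"
    apply (rule exists_cyclic_potential[OF K \<kappa> cone])
     apply assumption+
    subgoal premises p for U g \<delta> by (rule that[unfolded x_def \<theta>_def, OF p(2-8)])
    done
  obtain B where B: "0 < B"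
    and mom: "\<And>(U :: real^2 \<Rightarrow> real) E. continuous_on UNIV (gradient U) \<Longrightarrow> (\<And>x. norm (gradient U x - 1 *\<^sub>R x) \<le> E) \<Longrightarrow>
      \<exists>\<pi>. invariant_law (obabo_kernel h \<gamma> U) \<pi> \<and> (\<forall>\<pi>'. invariant_law (obabo_kernel h \<gamma> U) \<pi>' \<longrightarrow> \<pi>' = \<pi>) \<and>
        (\<integral>\<^sup>+y. ennreal ((norm y)\<^sup>2) \<partial>\<pi>) \<le> ennreal (B * (1 + E\<^sup>2))"
    apply (rule uniform_second_moments[where 'a="real^2", OF a])
    subgoal premises p for B by (rule that[OF p(2) p(3)])
    done
  obtain \<tau> cN C and N :: "(real^2) \<times> (real^2) \<Rightarrow> real" where \<tau>: "0 < \<tau>" "\<tau> < 1" and cN: "0 < cN" and C: "0 < C"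
    and N: "\<And>p. cN * norm p \<le> N p" "\<And>p. N p \<le> C * norm p" "continuous_on UNIV N"
    and con: "\<And>U z \<xi> p0 p1 p2 c0 E. p2 = (1 + \<beta>) *\<^sub>R p1 - \<beta> *\<^sub>R p0 - s *\<^sub>R (1 *\<^sub>R p1 + c0) \<Longrightarrow>
      norm (gradient U (fst (obabo_step h \<gamma> U z \<xi>)) - 1 *\<^sub>R fst (obabo_step h \<gamma> U z \<xi>) - c0) \<le> E \<Longrightarrow>
      N (lookahead U (obabo_step h \<gamma> U z \<xi>) - p2, fst (obabo_step h \<gamma> U z \<xi>) - p1)
        \<le> \<tau> * N (lookahead U z - p1, fst z - p0) + C * (norm (fst \<xi>) + norm (snd \<xi>) + E)"
    apply (rule heavy_ball_contraction[where 'a="real^2", OF a])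
    subgoal premises p for N c C \<theta> by (rule that[OF p(2-9)])
    done
  define gap where "gap = norm (x 0 - x 1)"
  have gap_eq: "norm (x t - x (Suc t)) = gap" for t
  proof -
    have "x t - x (Suc t) = plane (cis (\<theta> * t) * (1 - cis \<theta>))" for t
      by (simp add: x_def plane_simps(2)[symmetric] right_diff_distrib cis_mult distrib_left add.commute)
    then have "norm (x t - x (Suc t)) = cmod (1 - cis \<theta>)" for t by (simp add: norm_plane norm_mult)
    from this[of t] this[of 0] show ?thesis by (simp add: gap_def)
  qed
  have gap: "0 < gap"
  proof -
    have "0 < \<theta>" "\<theta> < pi" using K by (auto simp: \<theta>_def field_simps)
    then have "0 < sin \<theta>" by (intro sin_gt_zero) auto
    then have "cis \<theta> \<noteq> 1" by (auto simp: complex_eq_iff)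
    then have "x 0 \<noteq> x 1" unfolding x_def by (auto simp: Finite_Cartesian_Product.vec_eq_iff forall_2 complex_eq_iff)
    then show ?thesis by (simp add: gap_def)
  qed
  \<comment> \<open>small enough for the affine region, and for consecutive traps to be disjoint\<close>
  define \<rho> where "\<rho> = cN * min (\<delta> / 2) (gap / 4)"
  have \<rho>: "0 < \<rho>" using cN \<delta> gap by (simp add: \<rho>_def)
  have hs: "0 < h * \<sigma>" using h_pos \<sigma>_pos by simp
  \<comment> \<open>the first bound keeps the position in the affine region, the second preserves the trap\<close>
  define \<eta> where "\<eta> = min (\<delta> / (2 * (h * \<sigma>))) ((1 - \<tau>) * \<rho> / (2 * C))"
  have \<eta>: "0 < \<eta>" using \<delta> hs \<tau> \<rho> C by (simp add: \<eta>_def)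
  \<comment> \<open>half of the exponent of the failure probability: a step then fails with probability at most \<open>4 / exp (c0 R\<^sup>2)\<^sup>2\<close>\<close>
  define c0 where "c0 = \<eta>\<^sup>2 / 8"
  have c0: "0 < c0" using \<eta> by (simp add: c0_def)
  define E where "E = (\<kappa> - 1) * cmod c"
  have E: "0 \<le> E" using \<kappa> by (simp add: E_def)
  define A1 where "A1 = (1 + (2 / h + h / 2 * \<bar>1\<bar>) / r) * 2 + (h / 2 / r) * E"
  have A1: "0 \<le> A1" using h_pos r_pos E by (simp add: A1_def)
  define C0 where "C0 = sqrt (2 * A1\<^sup>2 + 2 * B * (1 + E\<^sup>2))"
  have C0: "0 < C0" using B by (simp add: C0_def add_nonneg_pos add_pos_nonneg)
  have main: "dilated_potential R U \<in> potentials \<kappa> \<and>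
        (\<exists>\<pi>. invariant_law (obabo_kernel h \<gamma> (dilated_potential R U)) \<pi> \<and>
             (\<forall>\<pi>'. invariant_law (obabo_kernel h \<gamma> (dilated_potential R U)) \<pi>' \<longrightarrow> \<pi>' = \<pi>) \<and>
             (\<exists>z :: (real^2) \<times> (real^2).
                W2 (return borel z) \<pi> \<le> ennreal (C0 * (1 + R)) \<and>
                (\<forall>n::nat. int n \<le> \<lfloor>exp (c0 * R\<^sup>2) / 16\<rfloor> \<longrightarrow>
                   tv_dist (dirac_iterate (obabo_kernel h \<gamma> (dilated_potential R U)) n z) \<pi> \<ge> 3 / 8)))"
    if R1: "1 \<le> R" for R
  proof -
    have R: "0 < R" using R1 by simp
    define V where "V = dilated_potential R U"
    have VP: "V \<in> potentials \<kappa>" unfolding V_def by (rule dilated_potentials[OF U lo hi R])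
    have gV: "GDERIV V y :> R *\<^sub>R g (y /\<^sub>R R)" for y unfolding V_def by (rule dilated_gderiv[OF U(2)]) (use R in simp)
    have grad: "gradient V = (\<lambda>y. R *\<^sub>R g (y /\<^sub>R R))" using gradient_eqI[OF gV] by auto
    have gc: "continuous_on UNIV (gradient V)"
      unfolding grad using VP by (intro C_infinity_gradient_continuous[of V] gV) (simp add: potentials_def)
    have gm: "gradient V \<in> borel_measurable borel" by (rule borel_measurable_continuous_onI[OF gc])
    have gVE: "norm (gradient V y - 1 *\<^sub>R y) \<le> R * E" for y
    proof -
      have "gradient V y - 1 *\<^sub>R y = R *\<^sub>R (g (y /\<^sub>R R) - y /\<^sub>R R)" using R by (simp add: grad scaleR_diff_right)
      then show ?thesis using gE[of "y /\<^sub>R R"] R by (simp add: E_def)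
    qed
    define Q where "Q = obabo_kernel h \<gamma> V"
    obtain \<pi> where \<pi>: "invariant_law Q \<pi>" "\<And>\<pi>'. invariant_law Q \<pi>' \<Longrightarrow> \<pi>' = \<pi>"
      and \<pi>m: "(\<integral>\<^sup>+y. ennreal ((norm y)\<^sup>2) \<partial>\<pi>) \<le> ennreal (B * (1 + (R * E)\<^sup>2))"
      using mom[OF gc gVE] unfolding Q_def by blast
    have \<pi>P: "prob_space \<pi>" and \<pi>S: "sets \<pi> = sets borel" using \<pi>(1) by (auto simp: invariant_law_def)
    define p where "p = (\<lambda>t. R *\<^sub>R x t)"
    define e where "e = (\<lambda>t::nat. ((\<kappa> - 1) * R) *\<^sub>R plane (c * cis (\<theta> * t)))"
    have prec: "p (Suc (Suc t)) = (1 + \<beta>) *\<^sub>R p (Suc t) - \<beta> *\<^sub>R p t - s *\<^sub>R (1 *\<^sub>R p (Suc t) + e (Suc t))" for t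
    proof -
      define w where "w = cis (\<theta> * real (Suc t))"
      have 1: "cis (\<theta> * real (Suc (Suc t))) = w * cis \<theta>" "cis (\<theta> * real t) = w * cis (- \<theta>)"
        by (simp_all add: w_def cis_mult algebra_simps)
      have "w * cis \<theta> = of_real (1 + \<beta>) * w - of_real \<beta> * (w * cis (- \<theta>)) - of_real s * (w + of_real (\<kappa> - 1) * (c * w))"
        unfolding rec[folded \<theta>_def] by (simp add: algebra_simps)
      then have "plane (w * cis \<theta>) = (1 + \<beta>) *\<^sub>R plane w - \<beta> *\<^sub>R plane (w * cis (- \<theta>)) - s *\<^sub>R (plane w + (\<kappa> - 1) *\<^sub>R plane (c * w))"
        unfolding plane_simps(3) plane_simps(1,2)[symmetric] by simp
      then have "R *\<^sub>R plane (w * cis \<theta>) = R *\<^sub>R ((1 + \<beta>) *\<^sub>R plane w - \<beta> *\<^sub>R plane (w * cis (- \<theta>)) - s *\<^sub>R (plane w + (\<kappa> - 1) *\<^sub>R plane (c * w)))" by simp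
      then show ?thesis unfolding p_def x_def e_def 1 w_def[symmetric]
        by (simp add: scaleR_add_right scaleR_diff_right mult_ac)
    qed
    have gp: "gradient V y - 1 *\<^sub>R y - e t = 0" if y: "norm (y - p t) \<le> \<delta> * R" for t y
    proof -
      have "y /\<^sub>R R - x t = (y - p t) /\<^sub>R R" using R by (simp add: p_def scaleR_diff_right)
      then have "norm (y /\<^sub>R R - x t) = norm (y - p t) / R" using R by (simp add: divide_inverse mult.commute)
      then have "norm (y /\<^sub>R R - x t) \<le> \<delta>" using y R by (simp add: divide_le_eq)
      from gx[OF this] show ?thesis using R by (simp add: grad e_def scaleR_add_right mult.commute)
    qed
    define T where "T = (\<lambda>t. {z. N (lookahead V z - p (Suc t), fst z - p t) \<le> \<rho> * R})"
    have Tm: "T t \<in> sets borel" for t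
    proof -
      note [measurable] = measurable_lookahead[OF gm]
      have [measurable]: "fst \<in> borel_measurable (borel :: ((real^2) \<times> (real^2)) measure)"
        by (intro borel_measurable_continuous_onI continuous_intros)
      have [measurable]: "N \<in> borel_measurable (borel \<Otimes>\<^sub>M borel)"
        using borel_measurable_continuous_onI[OF N(3)] by (simp add: borel_prod)
      have "(\<lambda>z. N (lookahead V z - p (Suc t), fst z - p t)) \<in> borel_measurable borel" by measurable
      then have "(\<lambda>z. N (lookahead V z - p (Suc t), fst z - p t)) -` {..\<rho> * R} \<inter> space borel \<in> sets borel"
        by (rule measurable_sets) simp
      then show ?thesis by (simp add: T_def vimage_def)
    qed
    have T_near: "norm (lookahead V z - p (Suc t)) \<le> min (\<delta> / 2) (gap / 4) * R" "norm (fst z - p t) \<le> min (\<delta> / 2) (gap / 4) * R"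
      if "z \<in> T t" for z t
    proof -
      define q where "q = (lookahead V z - p (Suc t), fst z - p t)"
      have "cN * norm q \<le> \<rho> * R" using that N(1)[of q] by (simp add: T_def q_def)
      then have "cN * norm q \<le> cN * (min (\<delta> / 2) (gap / 4) * R)" by (simp add: \<rho>_def mult.assoc)
      then have "norm q \<le> min (\<delta> / 2) (gap / 4) * R" by (rule mult_left_le_imp_le) (rule cN)
      then show "norm (lookahead V z - p (Suc t)) \<le> min (\<delta> / 2) (gap / 4) * R" "norm (fst z - p t) \<le> min (\<delta> / 2) (gap / 4) * R"
        using norm_fst_le[of "fst q" "snd q"] norm_snd_le[of "snd q" "fst q"] by (auto simp: q_def)
    qed
    have minR: "min (\<delta> / 2) (gap / 4) * R \<le> \<delta> / 2 * R" "min (\<delta> / 2) (gap / 4) * R \<le> gap / 4 * R"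
      using R by (auto intro!: mult_right_mono)
    have disj: "T t \<inter> T (Suc t) = {}" for t
    proof (rule ccontr)
      assume "T t \<inter> T (Suc t) \<noteq> {}"
      then obtain z where z: "z \<in> T t" "z \<in> T (Suc t)" by blast
      have "R * gap = norm (p t - p (Suc t))"
        using gap_eq[of t] R by (simp add: p_def scaleR_diff_right[symmetric])
      also have "\<dots> \<le> norm (fst z - p t) + norm (fst z - p (Suc t))"
        using norm_triangle_ineq4[of "fst z - p (Suc t)" "fst z - p t"] by simp
      also have "\<dots> \<le> gap / 4 * R + gap / 4 * R"
        using T_near(2)[OF z(1)] T_near(2)[OF z(2)] minR(2) by linarith
      finally show False using gap R by (simp add: field_simps)
    qed
    have stay: "1 - 4 * exp (- (\<eta> * R)\<^sup>2 / 4) \<le> measure (Q z) (T (Suc t))" if z: "z \<in> T t" for z t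
      unfolding Q_def
    proof (rule noise_tail[OF gm _ Tm])
      show "0 \<le> \<eta> * R" using \<eta> R by simp
      fix \<xi>1 \<xi>2 :: "real^2" assume \<xi>: "norm \<xi>1 \<le> \<eta> * R" "norm \<xi>2 \<le> \<eta> * R"
      define z' where "z' = obabo_step h \<gamma> V z (\<xi>1, \<xi>2)"
      have "norm (fst z' - p (Suc t)) = norm ((lookahead V z - p (Suc t)) + (h * \<sigma>) *\<^sub>R \<xi>1)"
        by (simp add: z'_def fst_obabo_step algebra_simps)
      also have "\<dots> \<le> norm (lookahead V z - p (Suc t)) + h * \<sigma> * norm \<xi>1"
        using norm_triangle_ineq[of "lookahead V z - p (Suc t)" "(h * \<sigma>) *\<^sub>R \<xi>1"] unfolding norm_scaleR abs_of_pos[OF hs] .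
      also have "\<dots> \<le> \<delta> / 2 * R + h * \<sigma> * (\<delta> / (2 * (h * \<sigma>)) * R)"
      proof (intro add_mono mult_left_mono)
        show "norm (lookahead V z - p (Suc t)) \<le> \<delta> / 2 * R"
          using T_near(1)[OF z] minR(1) by linarith
        show "norm \<xi>1 \<le> \<delta> / (2 * (h * \<sigma>)) * R"
        proof -
          have "\<eta> * R \<le> \<delta> / (2 * (h * \<sigma>)) * R" using R by (intro mult_right_mono) (simp_all only: \<eta>_def min.cobounded1 less_imp_le)
          then show ?thesis using \<xi>(1) by linarith
        qed
      qed (use hs in simp)
      also have "\<dots> = \<delta> * R"
      proof -
        have "k * (\<delta> / (2 * k) * R) = \<delta> / 2 * R" if "0 < k" for k using that by simp
        from this[OF hs] show ?thesis by linarith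
      qed
      finally have "gradient V (fst z') - 1 *\<^sub>R fst z' - e (Suc t) = 0" by (rule gp)
      then have "N (lookahead V z' - p (Suc (Suc t)), fst z' - p (Suc t))
        \<le> \<tau> * N (lookahead V z - p (Suc t), fst z - p t) + C * (norm \<xi>1 + norm \<xi>2 + 0)"
        using con[OF prec[of t], of V z "(\<xi>1, \<xi>2)" 0] by (simp add: z'_def)
      also have "\<dots> \<le> \<tau> * (\<rho> * R) + C * (2 * ((1 - \<tau>) * \<rho> / (2 * C) * R))"
      proof (intro add_mono mult_left_mono)
        show "N (lookahead V z - p (Suc t), fst z - p t) \<le> \<rho> * R" using z by (simp add: T_def)
        have "\<eta> * R \<le> (1 - \<tau>) * \<rho> / (2 * C) * R" using R by (intro mult_right_mono) (auto simp: \<eta>_def)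
        then show "norm \<xi>1 + norm \<xi>2 + 0 \<le> 2 * ((1 - \<tau>) * \<rho> / (2 * C) * R)" using \<xi> by linarith
      qed (use \<tau> C in auto)
      also have "\<dots> = \<rho> * R" using C by (simp add: field_simps)
      finally show "obabo_step h \<gamma> V z (\<xi>1, \<xi>2) \<in> T (Suc t)" by (simp add: T_def z'_def)
    qed
    \<comment> \<open>the velocity for which the noiseless next position is \<open>p 1\<close>\<close>
    define v0 where "v0 = (1 / r) *\<^sub>R ((1 / h) *\<^sub>R (p 1 - p 0) + (h / 2) *\<^sub>R gradient V (p 0))"
    define z0 where "z0 = (p 0, v0)"
    have look0: "lookahead V z0 = p 1"
      using h_pos r_pos by (simp add: lookahead_def z0_def v0_def)
    have z0T: "z0 \<in> T 0"
    proof -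
      have "N (0, 0) \<le> 0" using N(2)[of "(0, 0)"] by (simp add: norm_Pair)
      then show ?thesis using look0 \<rho> R by (simp add: T_def z0_def order_trans[of _ 0] zero_prod_def)
    qed
    have z0n: "norm z0 \<le> A1 * R"
    proof -
      have nx: "norm (p t) = R" for t using R by (simp add: p_def x_def norm_plane)
      have "norm (p 1, p 0) \<le> 2 * R" using norm_Pair_le[of "p 1" "p 0"] by (simp add: nx)
      then have "(1 + (2 / h + h / 2 * \<bar>1\<bar>) / r) * norm (p 1, p 0) \<le> (1 + (2 / h + h / 2 * \<bar>1\<bar>) / r) * (2 * R)"
        using h_pos r_pos by (intro mult_left_mono) auto
      then have "norm z0 \<le> (1 + (2 / h + h / 2 * \<bar>1\<bar>) / r) * (2 * R) + (h / 2 / r) * (R * E)"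
        using position_velocity_bound[OF gVE[of "fst z0"]] unfolding look0 by (simp add: z0_def)
      also have "\<dots> = A1 * R" unfolding A1_def by (simp only: distrib_right mult.assoc mult.commute[of R E])
      finally show ?thesis .
    qed
    have "W2 (return borel z0) \<pi> \<le> ennreal (C0 * (1 + R))"
    proof (rule W2_return_le[OF \<pi>P \<pi>S])
      show "0 \<le> C0 * (1 + R)" using C0 R by simp
      interpret prob_space \<pi> by (rule \<pi>P)
      have "(\<integral>\<^sup>+y. ennreal ((dist z0 y)\<^sup>2) \<partial>\<pi>) \<le> (\<integral>\<^sup>+y. ennreal (2 * (norm z0)\<^sup>2) + ennreal 2 * ennreal ((norm y)\<^sup>2) \<partial>\<pi>)"
      proof (intro nn_integral_mono)
        fix y
        have "(dist z0 y)\<^sup>2 \<le> (norm z0 + norm y)\<^sup>2" by (intro power_mono) (auto simp: dist_norm norm_triangle_ineq4)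
        also have "\<dots> \<le> 2 * (norm z0)\<^sup>2 + 2 * (norm y)\<^sup>2"
        proof -
          have "0 \<le> (norm z0 - norm y)\<^sup>2" by simp
          then show ?thesis by (simp add: power2_eq_square algebra_simps)
        qed
        finally show "ennreal ((dist z0 y)\<^sup>2) \<le> ennreal (2 * (norm z0)\<^sup>2) + ennreal 2 * ennreal ((norm y)\<^sup>2)"
          by (simp add: ennreal_mult[symmetric] ennreal_plus[symmetric] ennreal_leI del: ennreal_plus ennreal_numeral)
      qed
      also have "\<dots> = ennreal (2 * (norm z0)\<^sup>2) + ennreal 2 * (\<integral>\<^sup>+y. ennreal ((norm y)\<^sup>2) \<partial>\<pi>)"
      proof -
        have "(\<lambda>y. ennreal ((norm y)\<^sup>2)) \<in> borel_measurable \<pi>" unfolding measurable_cong_sets[OF \<pi>S refl] by measurable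
        then show ?thesis by (subst nn_integral_add) (simp_all add: nn_integral_cmult emeasure_space_1)
      qed
      also have "\<dots> \<le> ennreal (2 * (norm z0)\<^sup>2) + ennreal 2 * ennreal (B * (1 + (R * E)\<^sup>2))"
        by (intro add_left_mono mult_left_mono \<pi>m) simp
      also have "\<dots> = ennreal (2 * (norm z0)\<^sup>2 + 2 * (B * (1 + (R * E)\<^sup>2)))"
        using B by (simp add: ennreal_mult[symmetric] ennreal_plus[symmetric] del: ennreal_plus ennreal_numeral)
      also have "\<dots> \<le> ennreal ((C0 * (1 + R))\<^sup>2)"
      proof (rule ennreal_leI)
        have "(norm z0)\<^sup>2 \<le> (A1 * R)\<^sup>2" using z0n by (intro power_mono) auto
        also have "\<dots> \<le> A1\<^sup>2 * (1 + R)\<^sup>2" unfolding power_mult_distrib using R by (intro mult_left_mono power_mono) auto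
        finally have 1: "(norm z0)\<^sup>2 \<le> A1\<^sup>2 * (1 + R)\<^sup>2" .
        have 2: "1 + (R * E)\<^sup>2 \<le> (1 + E\<^sup>2) * (1 + R)\<^sup>2"
        proof -
          have "1 \<le> (1 + R)\<^sup>2" "R\<^sup>2 \<le> (1 + R)\<^sup>2" using R by (auto intro!: power_mono one_le_power)
          then have "1 + E\<^sup>2 * R\<^sup>2 \<le> (1 + R)\<^sup>2 + E\<^sup>2 * (1 + R)\<^sup>2" by (intro add_mono mult_left_mono) auto
          then show ?thesis by (simp add: power_mult_distrib distrib_right mult.commute)
        qed
        have "2 * (norm z0)\<^sup>2 + 2 * (B * (1 + (R * E)\<^sup>2)) \<le> 2 * (A1\<^sup>2 * (1 + R)\<^sup>2) + 2 * (B * ((1 + E\<^sup>2) * (1 + R)\<^sup>2))"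
          using 1 2 B by (intro add_mono mult_left_mono) auto
        also have "\<dots> = C0\<^sup>2 * (1 + R)\<^sup>2"
          using B by (simp add: C0_def algebra_simps)
        finally show "2 * (norm z0)\<^sup>2 + 2 * (B * (1 + (R * E)\<^sup>2)) \<le> (C0 * (1 + R))\<^sup>2" by (simp add: power_mult_distrib)
      qed
      finally show "(\<integral>\<^sup>+y. ennreal ((dist z0 y)\<^sup>2) \<partial>\<pi>) \<le> ennreal ((C0 * (1 + R))\<^sup>2)" .
    qed
    moreover have "3 / 8 \<le> tv_dist (dirac_iterate Q n z0) \<pi>" if n: "int n \<le> \<lfloor>exp (c0 * R\<^sup>2) / 16\<rfloor>" for n
    proof (rule cycle_total_variation[where B=T and \<epsilon>="4 * exp (- (\<eta> * R)\<^sup>2 / 4)"])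
      show "Q \<in> borel \<rightarrow>\<^sub>M subprob_algebra borel" unfolding Q_def by (rule kernel_measurable[OF gm])
      show "prob_space (Q z)" for z unfolding Q_def by (rule kernel_prob[OF gm])
      show "measure \<pi> {z0} = 0" by (rule kernel_atomless[OF gm \<pi>(1)[unfolded Q_def]])
      define y where "y = exp (c0 * R\<^sup>2)"
      have y: "0 < y" by (simp add: y_def)
      have ny: "real n \<le> y / 16" using n unfolding y_def by (simp add: le_floor_iff)
      have "- (\<eta> * R)\<^sup>2 / 4 = - (c0 * R\<^sup>2) + - (c0 * R\<^sup>2)" by (simp add: c0_def power_mult_distrib)
      then have e: "exp (- (\<eta> * R)\<^sup>2 / 4) = inverse y * inverse y" by (simp only: exp_add exp_minus y_def)
      show "real n * (4 * exp (- (\<eta> * R)\<^sup>2 / 4)) \<le> 1 / 16"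
      proof (cases "n = 0")
        case False
        then have "16 \<le> y" using ny by simp
        have "real n * (4 * (inverse y * inverse y)) \<le> y / 16 * (4 * (inverse y * inverse y))"
          using ny y by (intro mult_right_mono) auto
        also have "\<dots> = inverse y / 4" using y by (simp add: field_simps)
        also have "\<dots> \<le> 1 / 16" using \<open>16 \<le> y\<close> y by (simp add: field_simps)
        finally show ?thesis unfolding e .
      qed simp
    qed (use Tm disj stay z0T \<pi>(1) in auto)
    ultimately show ?thesis using VP \<pi> unfolding V_def Q_def by blast
  qed
  have UP: "U \<in> potentials \<kappa>" by (rule potentialsI[OF U lo hi])
  show ?thesis using UP c0 C0 main by blast
qed

end

section \<open>The dichotomy\<close>

text \<open>A rate below \<open>q\<close> for the curvature \<open>1\<close> forces \<open>(1 - q) (1 - \<beta> / q) < s\<close>. Since \<open>\<kappa> (1 - q) = C (1 + q)\<close>, this reads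
  \<open>C (1 + q) (1 - \<beta> / q) < s \<kappa>\<close>. As \<open>\<beta> < q\<^sup>2\<close>, the factor \<open>1 - \<beta> / q\<close> is at least \<open>1 - q\<close> and at least \<open>q - \<beta>\<close>;
  adding the two bounds gives \<open>C (1 + q) (1 - \<beta>) \<le> 2 s \<kappa>\<close>. The first bound with \<open>s \<kappa> < 4\<close> and \<open>C > 27\<close> also
  places \<open>q\<close> so near \<open>1\<close> that \<open>C (1 + q) > 50\<close>.\<close>

lemma quadratic_rate_below_imp_curvature:
  fixes C \<kappa> \<beta> s q :: real
  assumes C: "C > (3 + sqrt 5)\<^sup>2" and \<kappa>: "\<kappa> \<ge> 2 * C" and \<beta>: "0 < \<beta>" "\<beta> < 1" and s: "0 < s"
    and q: "q = (1 - C / \<kappa>) / (1 + C / \<kappa>)" and L4: "s * \<kappa> < 4"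
    and rad: "quadratic_radius (1 + \<beta> - s) \<beta> < q"
  shows "25 * (1 - \<beta>) \<le> s * \<kappa>" "50 \<le> \<kappa>"
proof -
  have "(11 / 5)\<^sup>2 \<le> (5::real)" by (simp add: power2_eq_square)
  then have "11 / 5 \<le> sqrt 5" by (rule real_le_rsqrt)
  then have "(3 + 11 / 5)\<^sup>2 \<le> (3 + sqrt 5)\<^sup>2" by (intro power_mono) auto
  then have C27: "27 < C" using C by (simp add: power2_eq_square)
  then show "50 \<le> \<kappa>" using \<kappa> by simp
  have \<kappa>0: "0 < \<kappa>" using \<kappa> C27 by simp
  have ck: "0 < C / \<kappa>" "C / \<kappa> \<le> 1 / 2" using \<kappa> \<kappa>0 C27 by (auto simp: field_simps)
  have q0: "0 < q" unfolding q by (intro divide_pos_pos) (use ck in linarith)+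
  have q1: "q < 1" unfolding q using ck by (subst divide_less_eq_1_pos) auto
  note q0 = q0 q1
  have qk: "\<kappa> * (1 - q) = C * (1 + q)"
  proof -
    have "1 - C / \<kappa> = (\<kappa> - C) / \<kappa>" "1 + C / \<kappa> = (\<kappa> + C) / \<kappa>" using \<kappa>0 by (simp_all add: field_simps)
    then have "q = (\<kappa> - C) / (\<kappa> + C)" using \<kappa>0 unfolding q by simp
    then have "q * (\<kappa> + C) = \<kappa> - C" using \<kappa>0 C27 by simp
    then show ?thesis by (simp add: algebra_simps)
  qed
  note r = quadratic_radius_less[OF \<beta>(1) rad]
  define d where "d = 1 - \<beta> / q"
  have d1: "1 - q \<le> d" using r(1) q0 by (simp add: d_def field_simps power2_eq_square)
  have d2: "q - \<beta> \<le> d"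
  proof -
    have "q\<^sup>2 \<le> q" using q0 by (simp add: power2_eq_square mult_left_le)
    then have "(q - \<beta>) * q \<le> q - \<beta>" using r(1) q0 by (intro mult_left_le) auto
    then have "q - \<beta> \<le> (q - \<beta>) / q" using q0 by (simp add: pos_le_divide_eq)
    then show ?thesis using q0 by (simp add: d_def diff_divide_distrib)
  qed
  have "1 + \<beta> - s < q + \<beta> / q" using r(2) by linarith
  then have "(1 - q) * d < s" using q0 by (simp add: d_def field_simps)
  then have "\<kappa> * ((1 - q) * d) < \<kappa> * s" using \<kappa>0 by simp
  moreover have "\<kappa> * ((1 - q) * d) = C * (1 + q) * d" by (simp only: mult.assoc[symmetric] qk)
  ultimately have L: "C * (1 + q) * d < s * \<kappa>" by (simp only: mult.commute[of s])
  have Cq: "0 < C * (1 + q)" using C27 q0 by simp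
  have 1: "C * (1 + q) * (1 - q) \<le> C * (1 + q) * d" using d1 Cq by (intro mult_left_mono) auto
  have 2: "C * (1 + q) * (q - \<beta>) \<le> C * (1 + q) * d" using d2 Cq by (intro mult_left_mono) auto
  have "27 * (1 - q\<^sup>2) \<le> C * (1 - q\<^sup>2)" using C27 q0 by (intro mult_right_mono) (auto simp: power_le_one)
  also have "C * (1 - q\<^sup>2) = C * (1 + q) * (1 - q)" by (simp add: power2_eq_square algebra_simps)
  also have "\<dots> < 4" using 1 L L4 by linarith
  finally have "23 / 27 < q\<^sup>2" by simp
  have q9: "9 / 10 < q"
  proof (rule ccontr)
    assume "\<not> 9 / 10 < q"
    then have "q\<^sup>2 \<le> (9 / 10)\<^sup>2" using q0 by (intro power_mono) auto
    then show False using \<open>23 / 27 < q\<^sup>2\<close> by (simp add: power2_eq_square)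
  qed
  have "50 * (1 - \<beta>) \<le> C * (1 + q) * (1 - \<beta>)"
  proof -
    have "27 * (1 + 9 / 10) \<le> C * (1 + q)" using C27 q9 by (intro mult_mono) auto
    then show ?thesis using \<beta> by (intro mult_right_mono) auto
  qed
  also have "\<dots> = C * (1 + q) * (1 - q) + C * (1 + q) * (q - \<beta>)" by (simp add: algebra_simps)
  also have "\<dots> \<le> 2 * (s * \<kappa>)" using 1 2 L by linarith
  finally show "25 * (1 - \<beta>) \<le> s * \<kappa>" by simp
qed

theorem theorem1p1:
  fixes C_star \<kappa> h \<gamma> \<beta> s q :: real
  assumes "C_star > (3 + sqrt 5)\<^sup>2"
    and "\<kappa> \<ge> 2 * C_star"
    and "h > 0" and "\<gamma> > 0"
    and "h < 2 / sqrt \<kappa>"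
    and "\<beta> = exp (- \<gamma> * h)"
    and "s = h\<^sup>2 / 2 * (1 + \<beta>)"
    and "q = (1 - C_star / \<kappa>) / (1 + C_star / \<kappa>)"
  shows
    "(\<exists>l\<in>{1..\<kappa>}. \<exists>z z' :: (real^2) \<times> (real^2).
        (\<lambda>n. root n (tv_dist
            (dirac_iterate (obabo_kernel h \<gamma> (quadratic_potential l)) n z)
            (dirac_iterate (obabo_kernel h \<gamma> (quadratic_potential l)) n z')))
          \<longlonglongrightarrow> rho_q s \<beta> \<kappa> \<and>
        rho_q s \<beta> \<kappa> \<ge> q)
     \<or>
     (\<exists>U \<in> (potentials \<kappa> :: (real^2 \<Rightarrow> real) set). \<exists>c0 > 0. \<exists>C0 > 0. \<forall>R \<ge> 1.
        dilated_potential R U \<in> potentials \<kappa> \<and>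
        (\<exists>\<pi>. invariant_law (obabo_kernel h \<gamma> (dilated_potential R U)) \<pi> \<and>
             (\<forall>\<pi>'. invariant_law (obabo_kernel h \<gamma> (dilated_potential R U)) \<pi>' \<longrightarrow> \<pi>' = \<pi>) \<and>
             (\<exists>z :: (real^2) \<times> (real^2).
                W2 (return borel z) \<pi> \<le> ennreal (C0 * (1 + R)) \<and>
                (\<forall>n::nat. int n \<le> \<lfloor>exp (c0 * R\<^sup>2) / 16\<rfloor> \<longrightarrow>
                   tv_dist (dirac_iterate (obabo_kernel h \<gamma> (dilated_potential R U)) n z) \<pi> \<ge> 3 / 8))))"
proof -
  interpret P: obabo h \<gamma> by unfold_locales (fact assms(3), fact assms(4))
  have b: "P.\<beta> = \<beta>" unfolding P.\<beta>_def assms(6) ..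
  have s: "P.s = s" unfolding P.s_def b assms(7) ..
  have \<beta>: "0 < \<beta>" "\<beta> < 1" and s0: "0 < s" using P.\<beta> P.s_pos by (simp_all add: b s)
  have "(3::real)\<^sup>2 \<le> (3 + sqrt 5)\<^sup>2" by (intro power_mono) auto
  then have \<kappa>: "1 < \<kappa>" using assms(1,2) by simp
  have stable: "s * \<kappa> < 2 * (1 + \<beta>)"
  proof -
    have "h * sqrt \<kappa> < 2" using assms(5) \<kappa> by (simp add: field_simps)
    then have "(h * sqrt \<kappa>)\<^sup>2 < 2\<^sup>2" using assms(3) \<kappa> by (intro power_strict_mono) auto
    then have "h\<^sup>2 * \<kappa> < 4" using \<kappa> by (simp add: power_mult_distrib)
    then have "h\<^sup>2 * \<kappa> * (1 + \<beta>) < 4 * (1 + \<beta>)" using \<beta> by (intro mult_strict_right_mono) auto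
    moreover have "s * \<kappa> = h\<^sup>2 * \<kappa> * (1 + \<beta>) / 2" unfolding assms(7) by simp
    ultimately show ?thesis by linarith
  qed
  have stable_l: "\<bar>1 + \<beta> - s * l\<bar> < 1 + \<beta>" if "l \<in> {1..\<kappa>}" for l
  proof -
    have "0 < s * l" "s * l \<le> s * \<kappa>" using that s0 by auto
    moreover have "\<bar>1 + b - x\<bar> < 1 + b" if "0 < x" "x \<le> y" "y < 2 * (1 + b)" for x y b :: real
      using that by (simp add: abs_less_iff)
    ultimately show ?thesis using stable by blast
  qed
  show ?thesis
  proof (cases "q \<le> rho_q s \<beta> \<kappa>")
    case True
    obtain l where l: "l \<in> {1..\<kappa>}" "rho_q s \<beta> \<kappa> = quadratic_radius (1 + \<beta> - s * l) \<beta>"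
      by (rule rho_q_attained[OF \<beta>(1) s0 less_imp_le[OF \<kappa>]])
    obtain w :: complex where w: "w\<^sup>2 - of_real (1 + \<beta> - s * l) * w + of_real \<beta> = 0"
      "cmod w = quadratic_radius (1 + \<beta> - s * l) \<beta>"
      by (rule quadratic_radius_root[OF \<beta>(1)])
    have w1: "cmod w < 1" unfolding w(2) by (rule quadratic_radius_less_one[OF \<beta> stable_l[OF l(1)]])
    have w0: "w \<noteq> 0" using w(1) \<beta> by auto
    obtain z where lim: "(\<lambda>n. root n (tv_dist (dirac_iterate (obabo_kernel h \<gamma> (quadratic_potential l)) n 0)
                          (dirac_iterate (obabo_kernel h \<gamma> (quadratic_potential l)) n (z :: (real^2) \<times> (real^2))))) \<longlonglongrightarrow> cmod w"
      by (rule P.quadratic_total_variation_rate[of l w, unfolded b s, OF stable_l[OF l(1)] w(1) w1 w0])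
    have eq: "cmod w = rho_q s \<beta> \<kappa>" by (simp only: w(2) l(2))
    show ?thesis
      by (rule disjI1) (intro bexI[of _ l] exI[of _ 0] exI[of _ z] conjI lim[unfolded eq] True l(1))
  next
    case False
    have "quadratic_radius (1 + \<beta> - s) \<beta> \<le> rho_q s \<beta> \<kappa>"
      by (rule rho_q_attained[OF \<beta>(1) s0 less_imp_le[OF \<kappa>]])
    then have rad: "quadratic_radius (1 + \<beta> - s) \<beta> < q" using False by simp
    have L4: "s * \<kappa> < 4" using stable \<beta> by simp
    note curv = quadratic_rate_below_imp_curvature[OF assms(1,2) \<beta> s0 assms(8) L4 rad]
    obtain K :: nat and c :: complex where K: "3 \<le> K"
      "cis (2 * pi / K) = of_real (1 + \<beta>) - of_real \<beta> * cis (- (2 * pi / K)) - of_real s * (1 + of_real (\<kappa> - 1) * c)"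
      "\<And>j::nat. 0 < j \<Longrightarrow> j < K \<Longrightarrow> Re (cnj (1 - c) * (c * (cis (2 * pi / K * j) - 1))) < 0"
      apply (rule exists_cycle[OF \<beta> s0 curv(2) L4 curv(1)])
      subgoal premises p for K c by (rule that[OF p(2-4)])
      done
    have "1 \<in> {1..\<kappa>}" using \<kappa> by simp
    then have a: "\<bar>1 + \<beta> - s * 1\<bar> < 1 + \<beta>" by (rule stable_l)
    show ?thesis
      by (rule disjI2) (rule P.metastable_cycle[unfolded b s, OF a less_imp_le[OF \<kappa>] K])
  qed
qed

end
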